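(* Let $\mu>0$, $R\ge1$. Assume $\lambda_i\le C_A i^{-p}$ for $i=1,\dots,D$ with some $p>1/2$ and $0<C_A<\infty$, $\xi=\delta Z$ with $Z\sim\mathcal N(0,I_D)$, $\delta\in(0,1)$, and $|\kappa-\delta^2D|\le C_\kappa\delta^2\sqrt D$ for some $C_\kappa\ge0$. Write $\mathcal R^{\mathrm{pred}}=R^{2/(4\mu p+2p+1)}\delta^{(8\mu p+4p)/(4\mu p+2p+1)}$. If $\|f\|_\mu\le R$, then the stopping rule $\tau=\inf\{t\in[0,d]:R_t^2\le\kappa\}$ satisfies $$\mathbb{E}\big[\|A(\widehat f_\tau-f)\|^2\big]\le C_{\mu,p,C_A,C_\kappa}\big(\mathcal R^{\mathrm{pred}}+\delta^2\sqrt D\big)$$ with a constant $C_{\mu,p,C_A,C_\kappa}>0$ depending only on $\mu,p,C_A,C_\kappa$. If in addition $\lambda_i\ge c_A i^{-p}$ for $i=1,\dots,D$ with some $c_A>0$, this gives the minimax optimal rate (for the prediction error over signals with $\|f\|_\mu\le R$) for all regularities $\mu>0$ such that $\sqrt D\lesssim (R^2\delta^{-2})^{1/(4\mu p+2p+1)}\lesssim_{\mu,p,c_A} D$.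
   Context: Model: $D\ge 3$ and $P\ge D$ are integers, $A\in\mathbb{R}^{D\times P}$ has rank $D$, $f\in\mathbb{R}^P$, $g=Af$, $\xi\in\mathbb{R}^D$ is an error vector, and $Y=g+\xi$ is observed. $\|\cdot\|$ is the Euclidean norm, $A^\dagger=A^\top(AA^\top)^{-1}$. Let $\lambda_1\ge\dots\ge\lambda_D>0$ be the nonzero singular values of $A$ (with multiplicity), $u_i$, $v_i$ the left and right singular vectors, $\tilde\lambda_1>\dots>\tilde\lambda_d>0$ the distinct singular values. Put $Y_i=\langle Y,u_i\rangle$, $f_i=\langle f,v_i\rangle$. For a function $h$ on $[0,\infty)$ and $w\in\mathbb{R}^D$, $h(AA^\top)w=\sum_{i=1}^D h(\lambda_i^2)\langle w,u_i\rangle u_i$. Standing assumption: $\sum_{j:\lambda_j=\lambda_i}Y_j^2>0$ for all $i=1,\dots,D$ (this holds almost surely under Gaussian noise). Source condition: $\|f\|_\mu=\big(\sum_{i=1}^D\lambda_i^{-4\mu}f_i^2\big)^{1/2}$. Interpolated conjugate gradients: for $k=0,\dots,d$, $r_k$ is the unique minimiser of $\|p(AA^\top)Y\|^2$ over real polynomials $p$ of degree at most $k$ with $p(0)=1$. For $t=k+\alpha$, $k\in\{0,\dots,d-1\}$, $\alpha\in(0,1]$, $r_t=(1-\alpha)r_k+\alpha r_{k+1}$. For $t\in[0,d]$: $\widehat f_t=A^\dagger(I_D-r_t(AA^\top))Y$ and $R_t^2=\|A\widehat f_t-Y\|^2=\|r_t(AA^\top)Y\|^2$. The number $\kappa>0$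 is the critical value of the stopping rule. Notation: $\lesssim$ denotes an inequality up to an absolute constant; indices, as in $\lesssim_{\mu,p,c_A}$, indicate that the constant may depend on the listed quantities. The minimax rate for the prediction error is the order of $\inf_{\widehat f}\sup_{f:\|f\|_\mu\le R}\mathbb{E}_f[\|A(\widehat f-f)\|^2]$, the infimum being over all $\mathbb{R}^P$-valued estimators and $\mathbb{E}_f$ the expectation when the true signal is $f$. *)

theory Defs
  imports
    "HOL-Probability.Probability"
    "Jordan_Normal_Form.DL_Rank"
    "Jordan_Normal_Form.Gauss_Jordan_Elimination"
begin

unbundle no inner_syntax
no_notation Finite_Cartesian_Product.vec_nth (infixl \<open>$\<close> 90)

text \<open>
  The constants of the theorem are uniform in the dimensions, so vectors and matrices are taken
  with explicit carriers (\<open>carrier_vec n\<close>, \<open>carrier_mat n m\<close>).  Entries are numbered from \<open>0\<close>, whereas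
  singular values and singular vectors are numbered from \<open>1\<close> to \<open>D\<close> as in \<open>\<lambda>\<^sub>i \<le> C\<^sub>A i\<^sup>-\<^sup>p\<close>.
\<close>

definition sqnorm :: "real vec \<Rightarrow> real" where
  "sqnorm w = w \<bullet> w"

definition pinv :: "real mat \<Rightarrow> real mat" where
  "pinv A = A\<^sup>T * the (mat_inverse (A * A\<^sup>T))"

definition singular_system ::
    "real mat \<Rightarrow> (nat \<Rightarrow> real) \<Rightarrow> (nat \<Rightarrow> real vec) \<Rightarrow> (nat \<Rightarrow> real vec) \<Rightarrow> bool" where
  "singular_system A lam u v \<longleftrightarrow>
     (\<forall>i\<in>{1..dim_row A}. \<forall>j\<in>{1..dim_row A}. i \<le> j \<longrightarrow> lam j \<le> lam i) \<and>
     (\<forall>i\<in>{1..dim_row A}. 0 < lam i \<and>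
        u i \<in> carrier_vec (dim_row A) \<and> v i \<in> carrier_vec (dim_col A) \<and>
        A *\<^sub>v v i = lam i \<cdot>\<^sub>v u i \<and> A\<^sup>T *\<^sub>v u i = lam i \<cdot>\<^sub>v v i) \<and>
     (\<forall>i\<in>{1..dim_row A}. \<forall>j\<in>{1..dim_row A}.
        u i \<bullet> u j = (if i = j then 1 else 0) \<and> v i \<bullet> v j = (if i = j then 1 else 0))"

text \<open>The vector \<open>h(A A\<^sup>T) w\<close>, for a \<open>D\<close>-dimensional \<open>w\<close>.\<close>

definition spectral_apply ::
    "(nat \<Rightarrow> real) \<Rightarrow> (nat \<Rightarrow> real vec) \<Rightarrow> (real \<Rightarrow> real) \<Rightarrow> real vec \<Rightarrow> real vec" where
  "spectral_apply lam u h w =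
     vec (dim_vec w) (\<lambda>l. \<Sum>i=1..dim_vec w. h ((lam i)\<^sup>2) * (w \<bullet> u i) * (u i $ l))"

definition source_norm ::
    "nat \<Rightarrow> (nat \<Rightarrow> real) \<Rightarrow> (nat \<Rightarrow> real vec) \<Rightarrow> real \<Rightarrow> real vec \<Rightarrow> real" where
  "source_norm D lam v \<mu> f = sqrt (\<Sum>i=1..D. lam i powr (- 4 * \<mu>) * (f \<bullet> v i)\<^sup>2)"

definition source_ball ::
    "real mat \<Rightarrow> (nat \<Rightarrow> real) \<Rightarrow> (nat \<Rightarrow> real vec) \<Rightarrow> real \<Rightarrow> real \<Rightarrow> real vec set" where
  "source_ball A lam v \<mu> R =
     {f \<in> carrier_vec (dim_col A). source_norm (dim_row A) lam v \<mu> f \<le> R}"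

definition is_cg_minimiser ::
    "(nat \<Rightarrow> real) \<Rightarrow> (nat \<Rightarrow> real vec) \<Rightarrow> real vec \<Rightarrow> nat \<Rightarrow> real poly \<Rightarrow> bool" where
  "is_cg_minimiser lam u y k q \<longleftrightarrow>
     Polynomial.degree q \<le> k \<and> poly q 0 = 1 \<and>
     (\<forall>q'. Polynomial.degree q' \<le> k \<and> poly q' 0 = 1 \<longrightarrow>
        sqnorm (spectral_apply lam u (poly q) y) \<le> sqnorm (spectral_apply lam u (poly q') y))"

text \<open>
  The minimiser is unique for every \<open>k \<le> d\<close> (the number of distinct singular values) as soon as \<open>y\<close>
  has a nonzero component in each eigenspace of \<open>A A\<^sup>T\<close>, which holds almost surely for the Gaussian
  observations below.  The value \<open>1\<close> in the absence of uniqueness is therefore only relevant on a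
  null set, where it keeps the estimators measurable.
\<close>

definition cg_poly ::
    "(nat \<Rightarrow> real) \<Rightarrow> (nat \<Rightarrow> real vec) \<Rightarrow> real vec \<Rightarrow> nat \<Rightarrow> real poly" where
  "cg_poly lam u y k =
     (if \<exists>!q. is_cg_minimiser lam u y k q then THE q. is_cg_minimiser lam u y k q else 1)"

text \<open>
  For \<open>t = k + \<alpha>\<close> with \<open>\<alpha> \<in> (0,1]\<close> one has \<open>k = \<lceil>t\<rceil> - 1\<close>; at \<open>t = 0\<close> the truncated subtraction on the
  naturals gives \<open>k = 0\<close> and \<open>\<alpha> = 0\<close>, that is, \<open>r\<^sub>0\<close>.
\<close>

definition cg_poly_interp ::
    "(nat \<Rightarrow> real) \<Rightarrow> (nat \<Rightarrow> real vec) \<Rightarrow> real vec \<Rightarrow> real \<Rightarrow> real poly" where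
  "cg_poly_interp lam u y t =
     (let k = nat \<lceil>t\<rceil> - 1; \<alpha> = t - real k
      in Polynomial.smult (1 - \<alpha>) (cg_poly lam u y k) +
         Polynomial.smult \<alpha> (cg_poly lam u y (Suc k)))"

definition cg_estimator ::
    "real mat \<Rightarrow> (nat \<Rightarrow> real) \<Rightarrow> (nat \<Rightarrow> real vec) \<Rightarrow> real vec \<Rightarrow> real \<Rightarrow> real vec" where
  "cg_estimator A lam u y t =
     pinv A *\<^sub>v (y - spectral_apply lam u (poly (cg_poly_interp lam u y t)) y)"

definition cg_sqresidual ::
    "real mat \<Rightarrow> (nat \<Rightarrow> real) \<Rightarrow> (nat \<Rightarrow> real vec) \<Rightarrow> real vec \<Rightarrow> real \<Rightarrow> real" where
  "cg_sqresidual A lam u y t = sqnorm (A *\<^sub>v cg_estimator A lam u y t - y)"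

definition stopping_time ::
    "real mat \<Rightarrow> (nat \<Rightarrow> real) \<Rightarrow> (nat \<Rightarrow> real vec) \<Rightarrow> real \<Rightarrow> real vec \<Rightarrow> real" where
  "stopping_time A lam u \<kappa> y =
     Inf {t \<in> {0..real (card (lam ` {1..dim_row A}))}. cg_sqresidual A lam u y t \<le> \<kappa>}"

definition stopped_cg ::
    "real mat \<Rightarrow> (nat \<Rightarrow> real) \<Rightarrow> (nat \<Rightarrow> real vec) \<Rightarrow> real \<Rightarrow> real vec \<Rightarrow> real vec" where
  "stopped_cg A lam u \<kappa> y = cg_estimator A lam u y (stopping_time A lam u \<kappa> y)"

definition borel_vec :: "nat \<Rightarrow> real vec measure" where
  "borel_vec n =
     vimage_algebra (carrier_vec n) (\<lambda>w. \<lambda>i\<in>{..<n}. w $ i) (\<Pi>\<^sub>M i\<in>{..<n}. (borel :: real measure))"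

definition std_gaussian_vec :: "nat \<Rightarrow> real vec measure" where
  "std_gaussian_vec n =
     distr (\<Pi>\<^sub>M i\<in>{..<n}. std_normal_distribution) (borel_vec n) (\<lambda>z. vec n z)"

definition estimators :: "real mat \<Rightarrow> (real vec \<Rightarrow> real vec) set" where
  "estimators A = borel_vec (dim_row A) \<rightarrow>\<^sub>M borel_vec (dim_col A)"

text \<open>\<open>E\<^sub>f \<parallel>A (F(Y) - f)\<parallel>\<^sup>2\<close> for the observation \<open>Y = A f + \<delta> Z\<close> with \<open>Z\<close> standard normal.\<close>

definition pred_risk ::
    "real mat \<Rightarrow> real \<Rightarrow> (real vec \<Rightarrow> real vec) \<Rightarrow> real vec \<Rightarrow> ennreal" where
  "pred_risk A \<delta> F f =
     (\<integral>\<^sup>+ z. ennreal (sqnorm (A *\<^sub>v (F (A *\<^sub>v f + \<delta> \<cdot>\<^sub>v z) - f))) \<partial>std_gaussian_vec (dim_row A))"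

definition max_pred_risk ::
    "real mat \<Rightarrow> real \<Rightarrow> (real vec \<Rightarrow> real vec) \<Rightarrow> real vec set \<Rightarrow> ennreal" where
  "max_pred_risk A \<delta> F \<F> = (SUP f\<in>\<F>. pred_risk A \<delta> F f)"

definition minimax_pred_risk :: "real mat \<Rightarrow> real \<Rightarrow> real vec set \<Rightarrow> ennreal" where
  "minimax_pred_risk A \<delta> \<F> = (INF F\<in>estimators A. max_pred_risk A \<delta> F \<F>)"

definition pred_rate :: "real \<Rightarrow> real \<Rightarrow> real \<Rightarrow> real \<Rightarrow> real" where
  "pred_rate \<mu> p R \<delta> =
     R powr (2 / (4 * \<mu> * p + 2 * p + 1)) *
     \<delta> powr ((8 * \<mu> * p + 4 * p) / (4 * \<mu> * p + 2 * p + 1))"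

definition cg_setting ::
    "real \<Rightarrow> real \<Rightarrow> real \<Rightarrow> nat \<Rightarrow> nat \<Rightarrow> real mat \<Rightarrow> (nat \<Rightarrow> real) \<Rightarrow> (nat \<Rightarrow> real vec) \<Rightarrow>
     (nat \<Rightarrow> real vec) \<Rightarrow> real \<Rightarrow> real \<Rightarrow> bool" where
  "cg_setting p C\<^sub>A C\<^sub>\<kappa> D P A lam u v \<delta> \<kappa> \<longleftrightarrow>
     3 \<le> D \<and> D \<le> P \<and> A \<in> carrier_mat D P \<and> vec_space.rank D A = D \<and>
     singular_system A lam u v \<and>
     (\<forall>i\<in>{1..D}. lam i \<le> C\<^sub>A * real i powr (- p)) \<and>
     0 < \<delta> \<and> \<delta> < 1 \<and> 0 < \<kappa> \<and>
     \<bar>\<kappa> - \<delta>\<^sup>2 * real D\<bar> \<le> C\<^sub>\<kappa> * \<delta>\<^sup>2 * sqrt (real D)"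

end

theory Submission
  imports Defs
begin

text \<open>
  In the coordinates \<open>Y\<^sub>i\<close> the prediction error at \<open>t\<close> is \<open>\<Sum>(\<xi>\<^sub>i - r\<^sub>t(\<lambda>\<^sub>i\<^sup>2) Y\<^sub>i)\<^sup>2\<close>, and \<open>r\<^sub>k\<close> is a least-squares
  projection in \<open>L\<^sup>2(\<Sum> Y\<^sub>i\<^sup>2 \<delta>\<^bsub>\<lambda>\<^sub>i\<^sup>2\<^esub>)\<close>.  All zeros of \<open>r\<^sub>t\<close> are real and positive, so below its first zero
  \<open>r\<^sub>t\<close> is a decreasing filter \<open>w\<close> with \<open>1 - \<rho>x \<le> w(x) \<le> exp(-\<rho>x)\<close>, \<open>\<rho> = -r\<^sub>t'(0)\<close>, while by orthogonality
  the part of the residual beyond the first zero is at most \<open>\<Sum> w(1 - w) Y\<^sub>i\<^sup>2\<close>.  As \<open>\<rho>\<close> is continuous in \<open>t\<close>,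
  a data-dependent \<open>t\<close> realises the deterministic value of \<open>\<rho>\<close> that balances bias and variance, and the
  stopped estimator is compared with this iterate through
  \<open>\<parallel>(r\<^sub>s - r\<^sub>t) Y\<parallel>\<^sup>2 \<le> R\<^sub>s\<^sup>2 - R\<^sub>t\<^sup>2\<close> for \<open>s \<le> t\<close>.  The remaining stochastic terms, \<open>\<parallel>\<xi>\<parallel>\<^sup>2 - \<kappa>\<close> and the cross
  term \<open>\<Sum> w g\<^sub>i \<xi>\<^sub>i\<close> with monotone weights, are of order \<open>\<delta>\<^sup>2 \<surd>D\<close>.  The minimax lower bound is Assouad's
  lemma on a hypercube, with the Cameron-Martin formula in place of a likelihood-ratio bound.
\<close>

section \<open>Krylov residual polynomials\<close>

text \<open>The obstacle is that the conjugate gradient polynomial depends on \<open>Y\<close>, so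
  the error does not split into bias and variance of a fixed linear filter. The remedy is a bound
  valid for every nondegenerate \<open>Y\<close>, in which the data-dependent weights
  \<open>w\<close> are replaced by the envelopes \<open>exp (- (\<rho> * x))\<close> and
  \<open>min 1 (\<rho> * x)\<close> with \<open>\<rho>\<close> fixed in advance. Only the signed
  cross term resists this; there a bound for all tail sums at once takes the place of independence.
  Interpolation weakens two identities: between whole iterations the residual polynomial is
  orthogonal to one degree less, and \<open><r,r> = <r,1>\<close> becomes
  \<open><r,r> \<le> <r,1>\<close>; both remain strong enough for the argument on zeros. In return
  the squared residual is continuous in \<open>t\<close>, so that it equals \<open>\<kappa>\<close>
  at the stopping time unless stopping occurs at time 0. The estimates concern almost every
  \<open>Y\<close>, whereas measurability concerns all \<open>Y\<close>; hence the orthogonal basis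
  is set up for degenerate weights as well.\<close>

declare One_nat_def [simp del]

text \<open>Only a semi-inner product: it sees polynomials through their values at nodes of nonzero
  weight, so distinct polynomials may be indistinguishable.\<close>

definition ip :: "nat \<Rightarrow> (nat \<Rightarrow> real) \<Rightarrow> (nat \<Rightarrow> real) \<Rightarrow> real poly \<Rightarrow> real poly \<Rightarrow> real" where
  "ip D x W p q = (\<Sum>i=1..D. W i * poly p (x i) * poly q (x i))"

lemma ip_commute: "ip D x W p q = ip D x W q p"
  by (simp add: ip_def mult_ac)

lemma ip_add_left: "ip D x W (p + p') q = ip D x W p q + ip D x W p' q"
  by (simp add: ip_def algebra_simps sum.distrib)

lemma ip_diff_left: "ip D x W (p - p') q = ip D x W p q - ip D x W p' q"
  by (simp add: ip_def algebra_simps sum_subtractf)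

lemma ip_smult_left: "ip D x W (Polynomial.smult c p) q = c * ip D x W p q"
  by (simp add: ip_def algebra_simps sum_distrib_left)

lemma ip_sum_left: "ip D x W (\<Sum>j\<in>J. p j) q = (\<Sum>j\<in>J. ip D x W (p j) q)"
  by (simp add: ip_def poly_sum sum_distrib_left sum_distrib_right sum.swap[of _ J] mult_ac)

lemma ip_add_right: "ip D x W q (p + p') = ip D x W q p + ip D x W q p'"
  and ip_diff_right: "ip D x W q (p - p') = ip D x W q p - ip D x W q p'"
  and ip_smult_right: "ip D x W q (Polynomial.smult c p) = c * ip D x W q p"
  and ip_sum_right: "ip D x W q (\<Sum>j\<in>J. h j) = (\<Sum>j\<in>J. ip D x W q (h j))"
  by (simp_all add: ip_commute[of D x W q] ip_add_left ip_diff_left ip_smult_left ip_sum_left)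

lemmas ip_linear = ip_add_left ip_diff_left ip_smult_left ip_sum_left
  ip_add_right ip_diff_right ip_smult_right ip_sum_right

text \<open>Gram-Schmidt on \<open>X, X^2, ...\<close> without normalisation. Every element vanishes
  at 0, so 1 plus the span of the first \<open>k\<close> elements is exactly the set of competitors
  of degree at most \<open>k\<close>. A vanishing denominator gives coefficient 0, which is harmless
  by \<open>ip_self_zero\<close>.\<close>

function krylov_basis :: "nat \<Rightarrow> (nat \<Rightarrow> real) \<Rightarrow> (nat \<Rightarrow> real) \<Rightarrow> nat \<Rightarrow> real poly" where
  "krylov_basis D x W k = Polynomial.monom 1 (Suc k) -
     (\<Sum>j<k. Polynomial.smult
        (ip D x W (Polynomial.monom 1 (Suc k)) (krylov_basis D x W j) /
         ip D x W (krylov_basis D x W j) (krylov_basis D x W j))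
        (krylov_basis D x W j))"
  by pat_completeness auto
termination by (relation "Wellfounded.measure (\<lambda>(D, x, W, k). k)") auto


declare krylov_basis.simps [simp del]

definition cg_coef :: "nat \<Rightarrow> (nat \<Rightarrow> real) \<Rightarrow> (nat \<Rightarrow> real) \<Rightarrow> nat \<Rightarrow> real" where
  "cg_coef D x W j = ip D x W 1 (krylov_basis D x W j) /
     ip D x W (krylov_basis D x W j) (krylov_basis D x W j)"

text \<open>The damping \<open>\<phi>\<close> covers all iterates at once: constant 1 gives
  \<open>r_n\<close>, and \<open>clamp01 t\<close> gives the interpolated \<open>r_t\<close>. By
  orthogonality every quadratic quantity is then a diagonal sum over \<open>j\<close>.\<close>

definition cg_residual :: "nat \<Rightarrow> (nat \<Rightarrow> real) \<Rightarrow> (nat \<Rightarrow> real) \<Rightarrow> nat \<Rightarrow> (nat \<Rightarrow> real) \<Rightarrow> real poly" where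
  "cg_residual D x W n \<phi> = 1 - (\<Sum>j<n. Polynomial.smult (\<phi> j * cg_coef D x W j) (krylov_basis D x W j))"

lemma
  shows coeff_krylov_basis_Suc: "Polynomial.coeff (krylov_basis D x W k) (Suc k) = 1"
    and degree_krylov_basis: "Polynomial.degree (krylov_basis D x W k) = Suc k"
    and poly_krylov_basis_0: "poly (krylov_basis D x W k) 0 = 0"
proof (induction k rule: less_induct)
  case (less k)
  let ?s = "\<Sum>j<k. Polynomial.smult
        (ip D x W (Polynomial.monom 1 (Suc k)) (krylov_basis D x W j) /
         ip D x W (krylov_basis D x W j) (krylov_basis D x W j)) (krylov_basis D x W j)"
  have e: "krylov_basis D x W k = Polynomial.monom 1 (Suc k) - ?s"
    by (subst krylov_basis.simps) simp
  have deg: "Polynomial.degree ?s \<le> k"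
    by (intro degree_sum_le) (use less in \<open>auto intro!: order_trans[OF degree_smult_le]\<close>)
  then have c: "Polynomial.coeff ?s (Suc k) = 0"
    by (intro coeff_eq_0) simp
  show 1: "Polynomial.coeff (krylov_basis D x W k) (Suc k) = 1"
    unfolding e using c by simp
  have "Polynomial.degree (krylov_basis D x W k) \<le> Suc k"
    unfolding e using deg by (intro degree_diff_le) (auto simp: Polynomial.degree_monom_eq)
  with 1 show "Polynomial.degree (krylov_basis D x W k) = Suc k"
    by (metis le_antisym le_degree one_neq_zero)
  show "poly (krylov_basis D x W k) 0 = 0"
    unfolding e using less(3) by (simp add: poly_sum poly_monom)
qed

lemma krylov_basis_span:
  assumes "Polynomial.degree p \<le> k" "poly p 0 = 0"
  shows "\<exists>b. p = (\<Sum>j<k. Polynomial.smult (b j) (krylov_basis D x W j))"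
  using assms
proof (induction k arbitrary: p)
  case 0
  then have "p = 0"
    by (metis degree_eq_zeroE le_zero_eq pCons_0_0 poly_pCons mult_zero_left add_0_right)
  then show ?case by simp
next
  case (Suc k)
  let ?e = "krylov_basis D x W k"
  define q where "q = p - Polynomial.smult (Polynomial.coeff p (Suc k)) ?e"
  have "Polynomial.degree q \<le> Suc k"
    unfolding q_def using Suc.prems(1)
    by (intro degree_diff_le) (auto simp: degree_krylov_basis intro!: order_trans[OF degree_smult_le])
  moreover have "Polynomial.coeff q (Suc k) = 0"
    by (simp add: q_def coeff_krylov_basis_Suc)
  ultimately have "Polynomial.degree q \<le> k"
    by (metis degree_0 le_SucE le_zero_eq leading_coeff_0_iff nat_le_linear)
  moreover have "poly q 0 = 0"
    using Suc.prems(2) by (simp add: q_def poly_krylov_basis_0)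
  ultimately obtain b where b: "q = (\<Sum>j<k. Polynomial.smult (b j) (krylov_basis D x W j))"
    using Suc.IH by blast
  have "p = (\<Sum>j<Suc k. Polynomial.smult ((b(k := Polynomial.coeff p (Suc k))) j) (krylov_basis D x W j))"
    using b by (simp add: q_def algebra_simps)
  then show ?case by blast
qed

locale weighted_nodes =
  fixes D :: nat and x W :: "nat \<Rightarrow> real"
  assumes W_nonneg: "i \<in> {1..D} \<Longrightarrow> 0 \<le> W i"
begin

abbreviation "ipw \<equiv> ip D x W"
abbreviation "e \<equiv> krylov_basis D x W"
abbreviation "c \<equiv> cg_coef D x W"
abbreviation "res \<equiv> cg_residual D x W"

lemma ip_self_nonneg: "0 \<le> ipw p p"
  unfolding ip_def by (intro sum_nonneg) (use W_nonneg in \<open>simp add: mult.assoc\<close>)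

text \<open>The degenerate case of Cauchy-Schwarz. It makes orthogonality and projection formulas
  hold even where a norm in a denominator is zero.\<close>

lemma ip_self_zero:
  assumes "ipw p p = 0"
  shows "ipw q p = 0"
proof -
  have "\<forall>i\<in>{1..D}. W i * poly p (x i) * poly p (x i) = 0"
    using assms unfolding ip_def
    by (subst (asm) sum_nonneg_eq_0_iff) (use W_nonneg in \<open>auto simp: mult.assoc\<close>)
  then show ?thesis unfolding ip_def by (intro sum.neutral) auto
qed

lemma ip_krylov_basis_aux: "j < k \<Longrightarrow> ipw (e k) (e j) = 0"
proof (induction k arbitrary: j rule: less_induct)
  case (less k)
  let ?m = "Polynomial.monom 1 (Suc k)"
  let ?c = "\<lambda>l. ipw ?m (e l) / ipw (e l) (e l)"
  have "ipw (e k) (e j) = ipw ?m (e j) - (\<Sum>l<k. ?c l * ipw (e l) (e j))"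
    by (subst krylov_basis.simps) (simp add: ip_linear)
  also have "(\<Sum>l<k. ?c l * ipw (e l) (e j)) = (\<Sum>l\<in>{j}. ?c l * ipw (e l) (e j))"
  proof (rule sum.mono_neutral_right)
    show "\<forall>l\<in>{..<k} - {j}. ?c l * ipw (e l) (e j) = 0"
      using less.IH less.prems by (metis DiffE insertI1 lessThan_iff linorder_neqE_nat mult_zero_right ip_commute)
  qed (use less.prems in auto)
  \<comment> \<open>Either the norm of \<open>e j\<close> cancels, or it is zero and then the
    right-hand side is zero too.\<close>
  also have "\<dots> = ipw ?m (e j)"
    using ip_self_zero[of "e j" ?m] by auto
  finally show ?case by simp
qed

lemma ip_krylov_basis: "j \<noteq> k \<Longrightarrow> ipw (e k) (e j) = 0"
  using ip_krylov_basis_aux by (metis ip_commute linorder_neqE_nat)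

lemma ip_sum_krylov_basis:
  assumes "j < n"
  shows "ipw (\<Sum>l<n. Polynomial.smult (b l) (e l)) (e j) = b j * ipw (e j) (e j)"
proof -
  have "ipw (\<Sum>l<n. Polynomial.smult (b l) (e l)) (e j) = (\<Sum>l<n. b l * ipw (e l) (e j))"
    by (simp add: ip_linear)
  also have "\<dots> = (\<Sum>l\<in>{j}. b l * ipw (e l) (e j))"
    by (rule sum.mono_neutral_right) (use assms ip_krylov_basis in auto)
  finally show ?thesis by simp
qed

lemma ip_sum_sum_krylov_basis:
  "ipw (\<Sum>l<n. Polynomial.smult (a l) (e l)) (\<Sum>l<n. Polynomial.smult (b l) (e l))
     = (\<Sum>l<n. a l * b l * ipw (e l) (e l))"
  by (subst ip_sum_right, intro sum.cong refl, subst ip_smult_right, subst ip_sum_krylov_basis) auto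

lemma cg_coef_mult: "c j * ipw (e j) (e j) = ipw 1 (e j)"
  unfolding cg_coef_def using ip_self_zero[of "e j" 1] by auto

lemma ip_res_krylov_basis:
  assumes "j < n"
  shows "ipw (res n \<phi>) (e j) = (1 - \<phi> j) * ipw 1 (e j)"
  unfolding cg_residual_def ip_diff_left ip_sum_krylov_basis[OF assms]
  by (simp add: mult.assoc cg_coef_mult algebra_simps)

lemma poly_res_0: "poly (res n \<phi>) 0 = 1"
  by (simp add: cg_residual_def poly_sum poly_krylov_basis_0)

lemma degree_res: "Polynomial.degree (res n \<phi>) \<le> n"
  unfolding cg_residual_def
  by (intro degree_diff_le degree_sum_le) (auto intro!: order_trans[OF degree_smult_le] simp: degree_krylov_basis)

lemma ip_res_orthogonal:
  assumes "\<And>j. j < m \<Longrightarrow> \<phi> j = 1" "m \<le> n" "Polynomial.degree p \<le> m" "poly p 0 = 0"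
  shows "ipw (res n \<phi>) p = 0"
proof -
  obtain b where p: "p = (\<Sum>j<m. Polynomial.smult (b j) (e j))"
    using krylov_basis_span assms(3,4) by blast
  show ?thesis unfolding p
    using assms(1,2) by (simp add: ip_linear ip_res_krylov_basis)
qed

text \<open>Pythagoras: \<open>q - r_k\<close> has degree at most \<open>k\<close> and vanishes at
  0, hence is orthogonal to \<open>r_k\<close>.\<close>

lemma res_minimal:
  assumes "Polynomial.degree q \<le> k" "poly q 0 = 1"
  shows "ipw q q = ipw (res k (\<lambda>_. 1)) (res k (\<lambda>_. 1)) + ipw (q - res k (\<lambda>_. 1)) (q - res k (\<lambda>_. 1))"
proof -
  let ?r = "res k (\<lambda>_. 1)"
  have "ipw ?r (q - ?r) = 0"
    by (rule ip_res_orthogonal[where m = k]) (use assms degree_res poly_res_0 in \<open>auto intro!: degree_diff_le\<close>)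
  then show ?thesis
    by (simp add: ip_linear ip_commute[of D x W q ?r])
qed

definition is_min :: "nat \<Rightarrow> real poly \<Rightarrow> bool" where
  "is_min k q \<longleftrightarrow> Polynomial.degree q \<le> k \<and> poly q 0 = 1 \<and>
     (\<forall>q'. Polynomial.degree q' \<le> k \<and> poly q' 0 = 1 \<longrightarrow> ipw q q \<le> ipw q' q')"

lemma is_min_res: "is_min k (res k (\<lambda>_. 1))"
  unfolding is_min_def using degree_res poly_res_0 res_minimal ip_self_nonneg
  by (metis add_increasing2 le_add_same_cancel1)

lemma is_min_unique:
  assumes "\<And>j. j < k \<Longrightarrow> ipw (e j) (e j) \<noteq> 0" and q: "is_min k q"
  shows "q = res k (\<lambda>_. 1)"
proof -
  let ?r = "res k (\<lambda>_. 1)"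
  have "ipw q q \<le> ipw ?r ?r"
    using q degree_res poly_res_0 unfolding is_min_def by blast
  then have z: "ipw (q - ?r) (q - ?r) = 0"
    using res_minimal[of q k] q ip_self_nonneg[of "q - ?r"] unfolding is_min_def by fastforce
  obtain b where b: "q - ?r = (\<Sum>j<k. Polynomial.smult (b j) (e j))"
    using krylov_basis_span[of "q - ?r" k D x W] q degree_res poly_res_0
    unfolding is_min_def by (auto intro!: degree_diff_le)
  have "b j = 0" if "j < k" for j
    using ip_self_zero[OF z, of "e j"] ip_sum_krylov_basis[OF that, of b] assms(1)[OF that]
    unfolding b by (simp add: ip_commute)
  then have "q - ?r = 0" unfolding b by simp
  then show ?thesis by simp
qed

text \<open>Adding a basis element of norm zero to a minimiser changes neither the value at 0 nor
  the norm.\<close>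

lemma is_min_not_unique:
  assumes "j < k" "ipw (e j) (e j) = 0"
  shows "\<not> (\<exists>!q. is_min k q)"
proof -
  let ?r = "res k (\<lambda>_. 1)"
  have "is_min k (?r + e j)"
  proof -
    have "ipw (?r + e j) (?r + e j) = ipw ?r ?r"
      using ip_self_zero[OF assms(2)] assms(2) by (simp add: ip_linear ip_commute[of D x W "e j" ?r])
    moreover have "Polynomial.degree (?r + e j) \<le> k"
      using assms(1) degree_res by (intro degree_add_le) (auto simp: degree_krylov_basis)
    ultimately show ?thesis
      using is_min_res[of k] unfolding is_min_def by (simp add: poly_krylov_basis_0)
  qed
  moreover have "e j \<noteq> 0" using degree_krylov_basis[of D x W j] by auto
  ultimately show ?thesis
    using is_min_res[of k] by (metis add_cancel_right_right)
qed

text \<open>Unique existence becomes finitely many conditions \<open>\<noteq> 0\<close> on explicit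
  functions of the weights, and the definite description becomes a formula. Measurability in the
  observation rests on this.\<close>

lemma the_min:
  "(if \<exists>!q. is_min k q then THE q. is_min k q else 1)
     = (if \<forall>j<k. ipw (e j) (e j) \<noteq> 0 then res k (\<lambda>_. 1) else 1)"
proof (cases "\<forall>j<k. ipw (e j) (e j) \<noteq> 0")
  case True
  then have "is_min k = (\<lambda>q. q = res k (\<lambda>_. 1))"
    using is_min_unique is_min_res by blast
  then show ?thesis using True by simp
next
  case False
  then show ?thesis using is_min_not_unique by auto
qed

lemma ip_res_diff:
  "ipw (res n \<phi> - res n \<psi>) (res n \<phi> - res n \<psi>) = (\<Sum>j<n. (\<phi> j - \<psi> j)\<^sup>2 * (c j)\<^sup>2 * ipw (e j) (e j))"
proof -
  have "res n \<phi> - res n \<psi> = (\<Sum>j<n. Polynomial.smult ((\<psi> j - \<phi> j) * c j) (e j))"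
    by (simp add: cg_residual_def sum_subtractf smult_diff_left algebra_simps)
  then show ?thesis
    by (simp add: ip_sum_sum_krylov_basis power2_eq_square algebra_simps)
qed

lemma ip_res_self:
  "ipw (res n \<phi>) (res n \<phi>) = ipw 1 1 - (\<Sum>j<n. (1 - (1 - \<phi> j)\<^sup>2) * (c j)\<^sup>2 * ipw (e j) (e j))"
proof -
  have "ipw 1 (\<Sum>j<n. Polynomial.smult (\<phi> j * c j) (e j)) = (\<Sum>j<n. \<phi> j * (c j)\<^sup>2 * ipw (e j) (e j))"
    by (simp add: ip_linear power2_eq_square mult.assoc cg_coef_mult)
  then show ?thesis
    unfolding cg_residual_def
    by (simp add: ip_linear(2,6) ip_sum_sum_krylov_basis ip_commute[of D x W "e j" 1 for j] ip_commute[of D x W "sum f F" 1 for f F])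
      (simp add: power2_eq_square algebra_simps sum.distrib sum_subtractf sum_distrib_left)
qed

lemma ip_res_one:
  "ipw (res n \<phi>) 1 = ipw 1 1 - (\<Sum>j<n. \<phi> j * (c j)\<^sup>2 * ipw (e j) (e j))"
  unfolding cg_residual_def
  by (simp add: ip_linear power2_eq_square mult.assoc cg_coef_mult ip_commute[of D x W "e j" 1 for j] ip_commute[of D x W "sum f F" 1 for f F])

text \<open>In each coordinate the slack of the inequality is
  \<open>2 * (\<psi> j - \<phi> j) * (1 - \<psi> j)\<close>, which is nonnegative because the
  damping increases and stays below 1.\<close>

lemma ip_res_mono:
  assumes "\<And>j. j < n \<Longrightarrow> 0 \<le> \<phi> j \<and> \<phi> j \<le> \<psi> j \<and> \<psi> j \<le> 1"
  shows "ipw (res n \<phi> - res n \<psi>) (res n \<phi> - res n \<psi>)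
     \<le> ipw (res n \<phi>) (res n \<phi>) - ipw (res n \<psi>) (res n \<psi>)"
proof -
  have "(\<phi> j - \<psi> j)\<^sup>2 \<le> (1 - \<phi> j)\<^sup>2 - (1 - \<psi> j)\<^sup>2" if "j < n" for j
  proof -
    have "(1 - \<phi> j)\<^sup>2 - (1 - \<psi> j)\<^sup>2 - (\<phi> j - \<psi> j)\<^sup>2 = 2 * (\<psi> j - \<phi> j) * (1 - \<psi> j)"
      by (simp add: power2_eq_square algebra_simps)
    moreover have "0 \<le> 2 * (\<psi> j - \<phi> j) * (1 - \<psi> j)" using assms[OF that] by simp
    ultimately show ?thesis by linarith
  qed
  then have "(\<Sum>j<n. (\<phi> j - \<psi> j)\<^sup>2 * ((c j)\<^sup>2 * ipw (e j) (e j)))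
      \<le> (\<Sum>j<n. ((1 - \<phi> j)\<^sup>2 - (1 - \<psi> j)\<^sup>2) * ((c j)\<^sup>2 * ipw (e j) (e j)))"
    by (intro sum_mono mult_right_mono) (auto simp: ip_self_nonneg)
  then show ?thesis
    unfolding ip_res_diff ip_res_self
    by (simp add: algebra_simps sum.distrib sum_subtractf)
qed

text \<open>For damping in \<open>{0,1}\<close> this is the equality expressing that
  \<open>r - 1\<close> is orthogonal to \<open>r\<close>. At fractional damping
  \<open>\<phi> \<le> \<phi> * (2 - \<phi>)\<close> leaves an inequality, in the direction that
  \<open>root_filter\<close> needs.\<close>

lemma ip_res_self_le_one:
  assumes "\<And>j. j < n \<Longrightarrow> 0 \<le> \<phi> j \<and> \<phi> j \<le> 1"
  shows "ipw (res n \<phi>) (res n \<phi>) \<le> ipw (res n \<phi>) 1"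
proof -
  have "\<phi> j \<le> 1 - (1 - \<phi> j)\<^sup>2" if "j < n" for j
    using mult_nonneg_nonneg[of "\<phi> j" "1 - \<phi> j"] assms[OF that]
    by (simp add: power2_eq_square algebra_simps)
  then have "(\<Sum>j<n. \<phi> j * ((c j)\<^sup>2 * ipw (e j) (e j)))
      \<le> (\<Sum>j<n. (1 - (1 - \<phi> j)\<^sup>2) * ((c j)\<^sup>2 * ipw (e j) (e j)))"
    by (intro sum_mono mult_right_mono) (auto simp: ip_self_nonneg)
  then show ?thesis
    unfolding ip_res_one ip_res_self by (simp add: mult.assoc)
qed

end

section \<open>Zeros of the residual polynomials\<close>

text \<open>Factors \<open>1 - y/z\<close> instead of \<open>y - z\<close> build in the value 1 at 0
  and make the slope at 0 the negative sum of reciprocal zeros.\<close>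

definition root_poly :: "real list \<Rightarrow> real poly" where
  "root_poly zs = prod_list (map (\<lambda>z. [:1, - (1 / z):]) zs)"

lemma root_poly_simps: "root_poly [] = 1" "root_poly (z # zs) = [:1, - (1 / z):] * root_poly zs"
  by (simp_all add: root_poly_def)

lemma root_poly_remove1: "z \<in> set zs \<Longrightarrow> root_poly zs = [:1, - (1 / z):] * root_poly (remove1 z zs)"
  by (induction zs) (auto simp: root_poly_simps mult.left_commute simp del: mult_pCons_left mult_pCons_right)

lemma poly_root_poly_0 [simp]: "poly (root_poly zs) 0 = 1"
  by (induction zs) (simp_all add: root_poly_simps)

lemma poly_root_poly_eq_0:
  "(\<And>z. z \<in> set zs \<Longrightarrow> z \<noteq> 0) \<Longrightarrow> poly (root_poly zs) y = 0 \<longleftrightarrow> y \<in> set zs"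
  by (induction zs) (auto simp: root_poly_simps field_simps)

lemma degree_root_poly:
  assumes "\<And>z. z \<in> set zs \<Longrightarrow> 0 < z"
  shows "Polynomial.degree (root_poly zs) = length zs"
    and "(-1) ^ length zs * Polynomial.coeff (root_poly zs) (length zs) > 0"
proof -
  have *: "Polynomial.degree (root_poly zs) = length zs \<and> (-1) ^ length zs * lead_coeff (root_poly zs) > 0"
    using assms
  proof (induction zs)
    case (Cons z zs)
    then have "root_poly zs \<noteq> 0" by auto
    with Cons have "Polynomial.degree (root_poly (z # zs)) = length (z # zs)"
      unfolding root_poly_simps by (subst Polynomial.degree_mult_eq) auto
    moreover have "lead_coeff (root_poly (z # zs)) = - (1/z) * lead_coeff (root_poly zs)"
      using Cons.prems[of z] unfolding root_poly_simps lead_coeff_mult by simp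
    ultimately show ?case using Cons by (auto simp: zero_less_divide_iff)
  qed (simp add: root_poly_simps)
  then show "Polynomial.degree (root_poly zs) = length zs" by blast
  with * show "(-1) ^ length zs * Polynomial.coeff (root_poly zs) (length zs) > 0" by simp
qed

lemma coeff_root_poly_1: "Polynomial.coeff (root_poly zs) 1 = - (\<Sum>z\<leftarrow>zs. 1 / z)"
proof (induction zs)
  case (Cons z zs)
  have "Polynomial.coeff (root_poly zs) 0 = 1"
    using poly_root_poly_0[of zs] by (simp add: poly_0_coeff_0)
  with Cons show ?case by (simp add: root_poly_simps coeff_pCons One_nat_def)
qed (simp add: root_poly_simps)

text \<open>All factors lie in \<open>[0,1]\<close> below the first zero. The lower bound is the
  Weierstrass product inequality, the upper one is \<open>1 - a \<le> exp (- a)\<close> in each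
  factor.\<close>

lemma poly_root_poly_bounds:
  assumes "0 \<le> y" "\<And>z. z \<in> set zs \<Longrightarrow> y < z"
  shows "0 \<le> poly (root_poly zs) y" (is ?A) and "poly (root_poly zs) y \<le> 1" (is ?B)
    and "1 - y * (\<Sum>z\<leftarrow>zs. 1 / z) \<le> poly (root_poly zs) y" (is ?C)
    and "poly (root_poly zs) y \<le> exp (- (y * (\<Sum>z\<leftarrow>zs. 1 / z)))" (is ?D)
proof -
  have "?A \<and> ?B \<and> ?C \<and> ?D"
    using assms(2)
  proof (induction zs)
    case (Cons z zs)
    let ?P = "poly (root_poly zs) y" and ?s = "\<Sum>z\<leftarrow>zs. 1 / z"
    have IH: "0 \<le> ?P" "?P \<le> 1" "1 - y * ?s \<le> ?P" "?P \<le> exp (- (y * ?s))"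
      using Cons by auto
    have y: "y < z" "0 < z" using Cons.prems[of z] assms(1) by auto
    then have u: "0 \<le> 1 - y / z" "1 - y / z \<le> 1" "0 \<le> y / z" using assms(1) by auto
    have eq: "poly (root_poly (z # zs)) y = (1 - y / z) * ?P"
      by (simp add: root_poly_simps algebra_simps)
    have "(1 - y / z) * ?P \<le> 1" using u IH by (simp add: mult_le_one)
    moreover have "?P - (y / z) * ?P \<ge> ?P - y / z"
      using mult_left_mono[OF IH(2) u(3)] by simp
    moreover have "(1 - y / z) * ?P \<le> exp (- (y / z)) * exp (- (y * ?s))"
      using IH u exp_ge_add_one_self[of "- (y / z)"] by (intro mult_mono) auto
    ultimately show ?case
      unfolding eq using IH u mult_nonneg_nonneg[OF u(1) IH(1)] by (simp add: algebra_simps flip: exp_add)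
  qed (simp add: root_poly_simps)
  then show ?A ?B ?C ?D by auto
qed

lemma poly_root_poly_antimono:
  assumes "0 \<le> y" "y \<le> y'" "\<And>z. z \<in> set zs \<Longrightarrow> y' < z"
  shows "poly (root_poly zs) y' \<le> poly (root_poly zs) y"
  using assms(3)
proof (induction zs)
  case (Cons z zs)
  have "y' < z" using Cons.prems by simp
  then have "0 \<le> 1 - y' / z" "1 - y' / z \<le> 1 - y / z" using assms(1,2) by (auto simp: divide_right_mono)
  moreover have "0 \<le> poly (root_poly zs) y'" using assms Cons.prems by (intro poly_root_poly_bounds) auto
  ultimately have "(1 - y' / z) * poly (root_poly zs) y' \<le> (1 - y / z) * poly (root_poly zs) y"
    using Cons by (intro mult_mono) auto
  then show ?case by (simp add: root_poly_simps algebra_simps)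
qed (simp add: root_poly_simps)

text \<open>Positive zeros are divided out with multiplicity; a cofactor without positive zeros that
  equals 1 at 0 stays positive by the intermediate value theorem.\<close>

lemma split_positive_roots:
  fixes q :: "real poly"
  assumes "poly q 0 = 1"
  shows "\<exists>zs s. q = root_poly zs * s \<and> (\<forall>z\<in>set zs. 0 < z) \<and> (\<forall>y\<ge>0. 0 < poly s y)"
  using assms
proof (induction "Polynomial.degree q" arbitrary: q rule: less_induct)
  case less
  show ?case
  proof (cases "\<exists>y>0. poly q y = 0")
    case True
    then obtain y where y: "0 < y" "poly q y = 0" by blast
    then obtain q' where q': "q = [:- y, 1:] * q'"
      unfolding poly_eq_0_iff_dvd by (auto elim: dvdE)
    have "q' \<noteq> 0" using less.prems q' by auto
    then have "Polynomial.degree q = 1 + Polynomial.degree q'"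
      unfolding q' by (subst Polynomial.degree_mult_eq) auto
    \<comment> \<open>Passing from \<open>X - y\<close> to \<open>1 - X/y\<close> moves the factor
      \<open>- y\<close> into the cofactor and restores the normalisation at 0.\<close>
    moreover have "poly (Polynomial.smult (- y) q') 0 = 1"
      using less.prems q' by simp
    ultimately obtain zs s where zs: "Polynomial.smult (- y) q' = root_poly zs * s"
        "\<forall>z\<in>set zs. 0 < z" "\<forall>y\<ge>0. 0 < poly s y"
      using less.hyps[of "Polynomial.smult (- y) q'"] y(1) by auto
    have "q = [:1, - (1 / y):] * Polynomial.smult (- y) q'"
      using y(1) unfolding q' mult_smult_right mult_smult_left[symmetric] by simp
    then have "q = root_poly (y # zs) * s"
      unfolding zs(1) root_poly_simps by (simp add: mult.assoc del: mult_pCons_left)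
    then show ?thesis using zs(2,3) y(1) by (intro exI[of _ "y # zs"] exI[of _ s]) auto
  next
    case False
    have "0 < poly q y" if "0 \<le> y" for y
    proof (rule ccontr)
      assume "\<not> 0 < poly q y"
      then have "y \<noteq> 0" using less.prems by auto
      with that have "0 < y" by simp
      with False \<open>\<not> 0 < poly q y\<close> have "poly q y < 0" by (meson linorder_neqE)
      then show False
        using poly_IVT_neg[of 0 y q] less.prems False \<open>0 < y\<close> by auto
    qed
    then show ?thesis by (intro exI[of _ "[]"] exI[of _ q]) (simp add: root_poly_simps)
  qed
qed

text \<open>For \<open>t = k + \<alpha>\<close> the values are 1 for \<open>j < k\<close>,
  \<open>\<alpha>\<close> at \<open>j = k\<close>, and 0 afterwards. This replaces the case
  distinction by \<open>\<lceil>t\<rceil>\<close> with weights that are continuous and monotone in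
  \<open>t\<close>.\<close>

definition clamp01 :: "real \<Rightarrow> nat \<Rightarrow> real" where
  "clamp01 t j = max 0 (min 1 (t - real j))"

lemma clamp01_bounds: "0 \<le> clamp01 t j" "clamp01 t j \<le> 1"
  by (auto simp: clamp01_def)

lemma clamp01_mono: "s \<le> t \<Longrightarrow> clamp01 s j \<le> clamp01 t j"
  by (auto simp: clamp01_def)

lemma continuous_on_clamp01 [continuous_intros]: "continuous_on S (\<lambda>t. clamp01 t j)"
  unfolding clamp01_def by (intro continuous_intros)

section \<open>Residual polynomials at nondegenerate observations: all zeros are positive\<close>

locale positive_nodes = weighted_nodes +
  assumes W_pos: "i \<in> {1..D} \<Longrightarrow> 0 < W i" and x_pos: "i \<in> {1..D} \<Longrightarrow> 0 < x i"
begin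

abbreviation "d \<equiv> card (x ` {1..D})"

lemma ip_self_eq_0: "ipw p p = 0 \<Longrightarrow> i \<in> {1..D} \<Longrightarrow> poly p (x i) = 0"
  unfolding ip_def
  by (subst (asm) sum_nonneg_eq_0_iff) (use W_pos in \<open>fastforce simp: mult.assoc less_imp_le\<close>)+

text \<open>A zero norm would force \<open>e j\<close>, of degree \<open>j + 1\<close>, to vanish at
  the \<open>d\<close> distinct nodes and at 0, which are \<open>d + 1\<close> points.\<close>

lemma krylov_basis_nonzero:
  assumes "j < d"
  shows "ipw (e j) (e j) \<noteq> 0"
proof
  assume "ipw (e j) (e j) = 0"
  then have *: "insert 0 (x ` {1..D}) \<subseteq> {y. poly (e j) y = 0}"
    using ip_self_eq_0 poly_krylov_basis_0 by blast
  have "e j \<noteq> 0" using degree_krylov_basis[of D x W j] by auto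
  then have "card (insert 0 (x ` {1..D})) \<le> Suc j"
    using card_mono[OF poly_roots_finite *] card_poly_roots_bound[of "e j"]
    unfolding degree_krylov_basis by linarith
  moreover have "0 \<notin> x ` {1..D}" using x_pos by fastforce
  ultimately show False using assms by simp
qed

text \<open>The classical argument for zeros of orthogonal polynomials. With too few positive zeros,
  \<open>X\<close> times their product \<open>P\<close> is an admissible test polynomial; its
  product with \<open>q\<close> is \<open>X * s * P^2\<close>, nonnegative at the nodes, so
  \<open>P\<close> would vanish at all \<open>d\<close> of them.\<close>

lemma length_roots_ge:
  assumes q: "q = root_poly zs * s" and zs: "\<forall>z\<in>set zs. 0 < z" and s: "\<forall>y\<ge>0. 0 < poly s y"
    and orth: "\<And>p. Polynomial.degree p \<le> k \<Longrightarrow> poly p 0 = 0 \<Longrightarrow> ipw q p = 0" and "k \<le> d"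
  shows "k \<le> length zs"
proof (rule ccontr)
  assume less: "\<not> k \<le> length zs"
  let ?P = "root_poly zs"
  have "Polynomial.degree (pCons 0 ?P) \<le> k"
    using less zs degree_root_poly(1)[of zs] by (simp add: degree_pCons_eq_if)
  then have "ipw q (pCons 0 ?P) = 0" by (rule orth) simp
  then have "(\<Sum>i=1..D. W i * x i * poly s (x i) * (poly ?P (x i))\<^sup>2) = 0"
    unfolding ip_def q by (simp add: power2_eq_square mult_ac)
  then have "\<forall>i\<in>{1..D}. W i * x i * poly s (x i) * (poly ?P (x i))\<^sup>2 = 0"
    by (subst (asm) sum_nonneg_eq_0_iff) (use W_pos x_pos s in \<open>auto intro!: mult_nonneg_nonneg simp: less_imp_le\<close>)
  moreover have "W i * x i * poly s (x i) \<noteq> 0" if "i \<in> {1..D}" for i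
    using W_pos[OF that] x_pos[OF that] s by (simp add: less_imp_le less_imp_neq[THEN not_sym])
  ultimately have "\<forall>i\<in>{1..D}. poly ?P (x i) = 0" by auto
  then have "x ` {1..D} \<subseteq> set zs"
    using poly_root_poly_eq_0[of zs] zs by fastforce
  then have "d \<le> length zs"
    by (meson List.finite_set card_length card_mono order_trans)
  then show False using less assms(5) by simp
qed

lemma res_full_roots:
  assumes "n \<le> d"
  shows "\<exists>zs. res n (\<lambda>_. 1) = root_poly zs \<and> (\<forall>z\<in>set zs. 0 < z) \<and> length zs = n"
proof -
  obtain zs s where zs: "res n (\<lambda>_. 1) = root_poly zs * s" "\<forall>z\<in>set zs. 0 < z" "\<forall>y\<ge>0. 0 < poly s y"
    using split_positive_roots poly_res_0 by blast
  have len: "n \<le> length zs"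
    by (rule length_roots_ge[OF zs]) (use assms in \<open>auto intro!: ip_res_orthogonal[where m = n]\<close>)
  have "root_poly zs \<noteq> 0" using poly_root_poly_0[of zs] by force
  moreover have "s \<noteq> 0" using zs(3) by auto
  ultimately have "length zs + Polynomial.degree s \<le> n"
    using degree_res[of n "\<lambda>_. 1"] zs(2) degree_root_poly(1)[of zs]
    unfolding zs(1) by (subst (asm) Polynomial.degree_mult_eq) auto
  with len have "length zs = n" "Polynomial.degree s = 0" by auto
  moreover have "poly s 0 = 1"
    using poly_res_0[of n "\<lambda>_. 1"] unfolding zs(1) by simp
  ultimately have "s = 1" by (metis degree_eq_zeroE one_pCons poly_pCons mult_zero_left add_0_right)
  then show ?thesis using zs \<open>length zs = n\<close> by auto
qed

lemma coeff_res_Suc: "Polynomial.coeff (res (Suc k) \<phi>) (Suc k) = - \<phi> k * c k"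
proof -
  have "Polynomial.coeff (e j) (Suc k) = 0" if "j < k" for j
    using that by (intro coeff_eq_0) (simp add: degree_krylov_basis)
  then show ?thesis
    by (simp add: cg_residual_def coeff_sum coeff_krylov_basis_Suc)
qed

text \<open>The leading coefficient of \<open>r_(k+1)\<close> is \<open>- c k\<close>, and its sign
  is determined because all \<open>k + 1\<close> zeros are positive.\<close>

lemma sign_cg_coef:
  assumes "k < d"
  shows "0 < (-1) ^ k * c k"
proof -
  obtain zs where "res (Suc k) (\<lambda>_. 1) = root_poly zs" "\<forall>z\<in>set zs. 0 < z" "length zs = Suc k"
    using res_full_roots[of "Suc k"] assms by auto
  then have "0 < (-1) ^ Suc k * Polynomial.coeff (res (Suc k) (\<lambda>_. 1)) (Suc k)"
    using degree_root_poly(2)[of zs] by simp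
  then show ?thesis unfolding coeff_res_Suc by simp
qed

text \<open>Orthogonality reaches only degree \<open>k\<close> here and gives \<open>k\<close>
  positive zeros. A missing last zero would leave a cofactor \<open>1 + b * X\<close> with
  \<open>b \<ge> 0\<close>, and the leading coefficient would then contradict
  \<open>sign_cg_coef\<close>.\<close>

lemma res_interp_roots:
  assumes "k < d" "0 < \<phi> k" "\<And>j. j < k \<Longrightarrow> \<phi> j = 1"
  shows "\<exists>zs. res (Suc k) \<phi> = root_poly zs \<and> (\<forall>z\<in>set zs. 0 < z) \<and> length zs = Suc k"
proof -
  let ?q = "res (Suc k) \<phi>"
  obtain zs s where zs: "?q = root_poly zs * s" "\<forall>z\<in>set zs. 0 < z" "\<forall>y\<ge>0. 0 < poly s y"
    using split_positive_roots poly_res_0 by blast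
  have len: "k \<le> length zs"
    by (rule length_roots_ge[OF zs]) (use assms in \<open>auto intro!: ip_res_orthogonal[where m = k]\<close>)
  have nz: "s \<noteq> 0" using zs(3) by auto
  have "root_poly zs \<noteq> 0" using poly_root_poly_0[of zs] by force
  with nz have deg: "length zs + Polynomial.degree s \<le> Suc k"
    using degree_res[of "Suc k" \<phi>] zs(2) degree_root_poly(1)[of zs]
    unfolding zs(1) by (subst (asm) Polynomial.degree_mult_eq) auto
  have s0: "poly s 0 = 1" using poly_res_0[of "Suc k" \<phi>] unfolding zs(1) by simp
  have sgn: "0 < (-1) ^ Suc k * Polynomial.coeff ?q (Suc k)"
    using mult_pos_pos[OF assms(2) sign_cg_coef[OF assms(1)]] by (simp add: coeff_res_Suc mult_ac)
  have "length zs \<noteq> k"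
  proof
    assume l: "length zs = k"
    then have "Polynomial.degree s \<le> 1" using deg by simp
    then obtain b where b: "s = [:1, b:]"
    proof -
      obtain a s' where s: "s = pCons a s'" by (cases s)
      then have "Polynomial.degree s' = 0"
        using \<open>Polynomial.degree s \<le> 1\<close> by (simp add: degree_pCons_eq_if split: if_splits)
      then obtain b where "s' = [:b:]" by (rule degree_eq_zeroE)
      then show ?thesis using s s0 that by simp
    qed
    have "0 \<le> b"
    proof (rule ccontr)
      assume "\<not> 0 \<le> b"
      then have "poly s (- (1 / b)) = 0" "0 \<le> - (1 / b)" unfolding b by auto
      then show False using zs(3) by (metis less_irrefl)
    qed
    have "Polynomial.coeff (root_poly zs) (Suc k) = 0"
      using l zs(2) degree_root_poly(1)[of zs] by (intro coeff_eq_0) simp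
    then have "Polynomial.coeff ?q (Suc k) = b * Polynomial.coeff (root_poly zs) k"
      unfolding zs(1) b by simp
    moreover have "0 \<le> b * ((-1) ^ k * Polynomial.coeff (root_poly zs) k)"
      using \<open>0 \<le> b\<close> degree_root_poly(2)[of zs] zs(2) l by (simp add: less_imp_le)
    ultimately show False using sgn by (simp add: mult_ac)
  qed
  with len deg have "length zs = Suc k" "Polynomial.degree s = 0" by auto
  then have "s = 1" using s0 by (metis degree_eq_zeroE one_pCons poly_pCons mult_zero_left add_0_right)
  then show ?thesis using zs \<open>length zs = Suc k\<close> by auto
qed

end

text \<open>The weights \<open>w\<close> agree with \<open>q\<close> below the first zero of \<open>q\<close> and vanish on the set \<open>B\<close> of nodes beyond it.\<close>

definition residual_filter ::
    "nat \<Rightarrow> (nat \<Rightarrow> real) \<Rightarrow> (nat \<Rightarrow> real) \<Rightarrow> real poly \<Rightarrow> real \<Rightarrow> (nat \<Rightarrow> real) \<Rightarrow> nat set \<Rightarrow> bool" where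
  "residual_filter D x W q \<rho> w B \<longleftrightarrow>
    B \<subseteq> {1..D} \<and> (\<forall>i\<in>{1..D} - B. poly q (x i) = w i) \<and> (\<forall>i\<in>B. w i = 0) \<and>
    (\<Sum>i\<in>B. W i * (poly q (x i))\<^sup>2) \<le> (\<Sum>i=1..D. W i * (w i * (1 - w i))) \<and>
    (\<forall>i\<in>{1..D}. 0 \<le> w i \<and> w i \<le> 1 \<and> w i \<le> exp (- (\<rho> * x i)) \<and> 1 - w i \<le> \<rho> * x i) \<and>
    (\<forall>i\<in>{1..D}. \<forall>j\<in>{1..D}. x i \<le> x j \<longrightarrow> w j \<le> w i)"

context positive_nodes
begin

text \<open>The smallest zero \<open>z1\<close> is removed from \<open>q\<close>. The quotient
  \<open>h\<close> equals 1 at 0 and has low enough degree for \<open>q\<close> to be orthogonal to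
  \<open>h - 1\<close>; comparing \<open>q\<close> with \<open>h\<close> then isolates the sign
  change at \<open>z1\<close>.\<close>

lemma root_filter:
  assumes rp: "q = root_poly zs" and zs: "\<forall>z\<in>set zs. 0 < z" "zs \<noteq> []"
    and orth: "\<And>p. Polynomial.degree p < length zs - 1 + 1 \<Longrightarrow> poly p 0 = 0 \<Longrightarrow> ipw q p = 0"
    and le: "ipw q q \<le> ipw q 1"
  defines "\<rho> \<equiv> - Polynomial.coeff q 1"
  shows "\<exists>w B. residual_filter D x W q \<rho> w B"
proof -
  define z1 where "z1 = Min (set zs)"
  have z1: "z1 \<in> set zs" "\<And>z. z \<in> set zs \<Longrightarrow> z1 \<le> z" "0 < z1"
    using zs unfolding z1_def by auto
  define h where "h = root_poly (remove1 z1 zs)"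
  have q_h: "poly q y = (1 - y / z1) * poly h y" for y
    unfolding rp h_def root_poly_remove1[OF z1(1)] by (simp add: algebra_simps)
  have rho: "\<rho> = (\<Sum>z\<leftarrow>zs. 1 / z)"
    unfolding \<rho>_def rp coeff_root_poly_1 by simp
  have rho_ge: "1 / z1 \<le> \<rho>"
    unfolding rho using z1(1) zs(1) by (intro member_le_sum_list) (auto simp: less_imp_le)
  define w where "w = (\<lambda>i. if x i < z1 then poly q (x i) else 0)"
  define B where "B = {i\<in>{1..D}. z1 \<le> x i}"
  have bnd: "0 \<le> w i \<and> w i \<le> 1 \<and> w i \<le> exp (- (\<rho> * x i)) \<and> 1 - w i \<le> \<rho> * x i"
    if i: "i \<in> {1..D}" for i
  proof (cases "x i < z1")
    case True
    then have "\<And>z. z \<in> set zs \<Longrightarrow> x i < z" using z1(2) by fastforce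
    from poly_root_poly_bounds[of "x i" zs, OF _ this] x_pos[OF i] True show ?thesis
      unfolding w_def rp rho by (auto simp: less_imp_le mult.commute)
  next
    case False
    have "x i * (1 / z1) \<le> x i * \<rho>" using rho_ge x_pos[OF i] by (intro mult_left_mono) auto
    moreover have "1 \<le> x i * (1 / z1)" using False z1(3) by simp
    ultimately show ?thesis using False by (simp add: w_def mult.commute)
  qed
  have mono: "w j \<le> w i" if "i \<in> {1..D}" "j \<in> {1..D}" "x i \<le> x j" for i j
  proof (cases "x j < z1")
    case True
    have "poly (root_poly zs) (x j) \<le> poly (root_poly zs) (x i)"
      using that x_pos[of i] True z1(2) by (intro poly_root_poly_antimono) (auto simp: less_imp_le intro: less_le_trans)
    then show ?thesis using True that by (simp add: w_def rp)
  next
    case False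
    then show ?thesis using bnd[OF that(1)] by (simp add: w_def)
  qed
  have "Polynomial.degree h = length zs - 1"
    unfolding h_def using zs z1 by (subst degree_root_poly) (auto simp: length_remove1 dest: notin_set_remove1)
  then have "Polynomial.degree (h - 1) \<le> length zs - 1"
    by (intro degree_diff_le) auto
  then have "ipw q (h - 1) = 0"
    by (intro orth) (auto simp: h_def)
  \<comment> \<open>Orthogonality turns \<open><q,1>\<close> into \<open><q,h>\<close>, so the
    hypothesis \<open><q,q> \<le> <q,1>\<close> reads \<open><q,q> \<le> <q,h>\<close>.\<close>
  then have "0 \<le> ipw q (h - q)"
    using le by (simp add: ip_linear)
  also have "ipw q (h - q) = (\<Sum>i=1..D. W i * (poly q (x i) * (poly h (x i) - poly q (x i))))"
    by (simp add: ip_def mult_ac)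
  also have "\<dots> = (\<Sum>i\<in>B. W i * (poly q (x i) * (poly h (x i) - poly q (x i))))
      + (\<Sum>i\<in>{1..D} - B. W i * (poly q (x i) * (poly h (x i) - poly q (x i))))"
    by (subst add.commute, rule sum.subset_diff) (auto simp: B_def)
  also have "\<dots> \<le> (\<Sum>i\<in>B. - (W i * (poly q (x i))\<^sup>2)) + (\<Sum>i\<in>{1..D} - B. W i * (w i * (1 - w i)))"
  proof (intro add_mono sum_mono)
    fix i assume "i \<in> B"
    then have i: "i \<in> {1..D}" "1 \<le> x i / z1" using z1(3) by (auto simp: B_def)
    define a where "a = x i / z1"
    \<comment> \<open>The left side is \<open>q * h\<close>, and \<open>q = (1 - a) * h\<close> with
      \<open>a \<ge> 1\<close> beyond the first zero. These nodes thus contribute at most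
      \<open>- q^2\<close>, while below \<open>z1\<close> the bound \<open>h \<le> 1\<close> leaves
      \<open>w * (1 - w)\<close>.\<close>
    have "poly q (x i) * (poly h (x i) - poly q (x i)) + (poly q (x i))\<^sup>2 = - ((a - 1) * (poly h (x i))\<^sup>2)"
      unfolding q_h a_def[symmetric] by (simp add: power2_eq_square algebra_simps)
    also have "\<dots> \<le> 0" using i(2) by (simp add: a_def)
    finally have "W i * (poly q (x i) * (poly h (x i) - poly q (x i)) + (poly q (x i))\<^sup>2) \<le> 0"
      using W_pos[OF i(1)] by (simp add: mult_nonneg_nonpos less_imp_le)
    then show "W i * (poly q (x i) * (poly h (x i) - poly q (x i))) \<le> - (W i * (poly q (x i))\<^sup>2)"
      by (simp add: algebra_simps)
  next
    fix i assume "i \<in> {1..D} - B"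
    then have i: "i \<in> {1..D}" "x i < z1" by (auto simp: B_def)
    have "\<And>z. z \<in> set (remove1 z1 zs) \<Longrightarrow> x i < z"
      using z1(2) i(2) by (metis less_le_trans notin_set_remove1)
    then have "poly h (x i) \<le> 1"
      using x_pos[OF i(1)] unfolding h_def by (intro poly_root_poly_bounds) auto
    then show "W i * (poly q (x i) * (poly h (x i) - poly q (x i))) \<le> W i * (w i * (1 - w i))"
      using i bnd[OF i(1)] W_pos[OF i(1)] by (auto simp: w_def intro!: mult_left_mono)
  qed
  also have "(\<Sum>i\<in>{1..D} - B. W i * (w i * (1 - w i))) = (\<Sum>i=1..D. W i * (w i * (1 - w i)))"
    by (intro sum.mono_neutral_left) (auto simp: B_def w_def)
  finally have key: "(\<Sum>i\<in>B. W i * (poly q (x i))\<^sup>2) \<le> (\<Sum>i=1..D. W i * (w i * (1 - w i)))"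
    by (simp add: sum_negf)
  have "B \<subseteq> {1..D}" "\<forall>i\<in>{1..D} - B. poly q (x i) = w i" "\<forall>i\<in>B. w i = 0"
    by (auto simp: B_def w_def)
  with key bnd mono show ?thesis
    unfolding residual_filter_def by (intro exI[of _ w] exI[of _ B]) blast
qed

lemma res_truncate:
  assumes "m \<le> n" "\<And>j. m \<le> j \<Longrightarrow> j < n \<Longrightarrow> \<phi> j = 0"
  shows "res n \<phi> = res m \<phi>"
  unfolding cg_residual_def using assms
  by (intro arg_cong[where f = "(-) 1"] sum.mono_neutral_right) auto

lemma res_cong: "(\<And>j. j < n \<Longrightarrow> \<phi> j = \<psi> j) \<Longrightarrow> res n \<phi> = res n \<psi>"
  unfolding cg_residual_def by simp

text \<open>The product of \<open>1 - X/y\<close> over the distinct nodes is a competitor of norm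
  zero, so the minimum is 0.\<close>

lemma res_d_zero:
  assumes "i \<in> {1..D}"
  shows "poly (res d (\<lambda>_. 1)) (x i) = 0"
proof -
  let ?v = "\<Prod>y\<in>x ` {1..D}. [:1, - (1 / y):]"
  have "Polynomial.degree ?v \<le> d"
    using degree_prod_sum_le[of "x ` {1..D}" "\<lambda>y. [:1, - (1 / y):]"]
    by (rule order_trans) (auto intro: order_trans[OF sum_bounded_above[of _ _ 1]])
  moreover have "poly ?v 0 = 1" by (simp add: poly_prod)
  ultimately have "ipw (res d (\<lambda>_. 1)) (res d (\<lambda>_. 1)) \<le> ipw ?v ?v"
    using is_min_res[of d] unfolding is_min_def by blast
  also have "poly ?v (x j) = 0" if "j \<in> {1..D}" for j
    using that x_pos[OF that] by (force simp: poly_prod)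
  then have "ipw ?v ?v = 0" unfolding ip_def by (intro sum.neutral) simp
  finally have "ipw (res d (\<lambda>_. 1)) (res d (\<lambda>_. 1)) = 0"
    using ip_self_nonneg by (simp add: order_antisym)
  from ip_self_eq_0[OF this assms] show ?thesis .
qed

text \<open>The intermediate value theorem is applied to \<open>- r\<^sub>t'(0)\<close>, the sum of the reciprocals of the zeros of \<open>r\<^sub>t\<close>.\<close>

lemma spectral_filter_exists:
  assumes "0 < \<rho>"
  shows "\<exists>t\<in>{0..real d}. \<exists>w B. residual_filter D x W (res d (clamp01 t)) \<rho> w B"
proof (cases "\<forall>i\<in>{1..D}. 1 \<le> \<rho> * x i")
  \<comment> \<open>The slope of \<open>r_d\<close> may be smaller than \<open>\<rho>\<close>, so
    continuity in \<open>t\<close> is of no help. But the zero filter satisfies all constraints,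
    with every node in \<open>B\<close> and \<open>t = d\<close>.\<close>
  case True
  have "poly (res d (clamp01 (real d))) (x i) = 0" if "i \<in> {1..D}" for i
    using res_d_zero[OF that] res_cong[of d "clamp01 (real d)" "\<lambda>_. 1"]
    by (simp add: clamp01_def of_nat_Suc[symmetric] less_eq_Suc_le del: of_nat_Suc)
  then show ?thesis using True
    by (intro bexI[of _ "real d"] exI[of _ "\<lambda>_. 0"] exI[of _ "{1..D}"])
      (auto simp: residual_filter_def)
next
  case False
  then obtain i where i: "i \<in> {1..D}" "\<rho> * x i < 1" by (auto simp: not_le)
  define s where "s = (\<lambda>t. - Polynomial.coeff (res d (clamp01 t)) 1)"
  have s_eq: "s = (\<lambda>t. (\<Sum>j<d. clamp01 t j * c j * Polynomial.coeff (e j) 1))"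
    by (simp add: s_def cg_residual_def coeff_sum coeff_1 One_nat_def)
  have cont: "continuous_on {0..real d} s"
    unfolding s_eq by (intro continuous_intros)
  have "s 0 = 0" unfolding s_eq by (simp add: clamp01_def)
  \<comment> \<open>The node with \<open>\<rho> * x i < 1\<close> is a zero of \<open>r_d\<close>,
    so \<open>1 / x i\<close>, which exceeds \<open>\<rho>\<close>, is one of the reciprocals making
    up the slope.\<close>
  moreover have "\<rho> \<le> s (real d)"
  proof -
    obtain zs where zs: "res d (\<lambda>_. 1) = root_poly zs" "\<forall>z\<in>set zs. 0 < z"
      using res_full_roots[of d] by auto
    have "x i \<in> set zs"
      using res_d_zero[OF i(1)] zs poly_root_poly_eq_0[of zs "x i"] by force
    then have "1 / x i \<le> (\<Sum>z\<leftarrow>zs. 1 / z)"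
      using zs(2) by (intro member_le_sum_list) (auto simp: less_imp_le)
    moreover have "s (real d) = (\<Sum>z\<leftarrow>zs. 1 / z)"
    proof -
      have "res d (clamp01 (real d)) = res d (\<lambda>_. 1)"
        by (rule res_cong) (simp add: clamp01_def of_nat_Suc[symmetric] less_eq_Suc_le del: of_nat_Suc)
      then show ?thesis unfolding s_def zs(1) by (simp add: coeff_root_poly_1 zs(1))
    qed
    moreover have "\<rho> \<le> 1 / x i" using i x_pos[OF i(1)] by (simp add: field_simps)
    ultimately show ?thesis by linarith
  qed
  ultimately obtain t where t: "0 \<le> t" "t \<le> real d" "s t = \<rho>"
    using IVT'[of s 0 \<rho> "real d"] cont assms by auto
  have "t \<noteq> 0" using t(3) \<open>s 0 = 0\<close> assms by auto
  then have tpos: "0 < t" using t(1) by simp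
  \<comment> \<open>Since \<open>t > 0\<close>, it lies in \<open>(k, k+1]\<close>; the damping at
    \<open>k\<close> is then strictly positive, as the count of zeros requires.\<close>
  define k where "k = nat \<lceil>t\<rceil> - 1"
  have "real k < t" "t \<le> real (Suc k)"
    using tpos unfolding k_def by linarith+
  then have k: "k < d" using t(2) by linarith
  let ?\<phi> = "clamp01 t"
  have phi: "0 < ?\<phi> k" "\<And>j. j < k \<Longrightarrow> ?\<phi> j = 1" "\<And>j. Suc k \<le> j \<Longrightarrow> ?\<phi> j = 0"
  proof -
    show "0 < ?\<phi> k" using \<open>real k < t\<close> by (simp add: clamp01_def)
    show "?\<phi> j = 1" if "j < k" for j
    proof -
      have "real j + 1 \<le> real k" using that by linarith
      then show ?thesis using \<open>real k < t\<close> by (simp add: clamp01_def)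
    qed
    show "?\<phi> j = 0" if "Suc k \<le> j" for j
    proof -
      have "real (Suc k) \<le> real j" using that by linarith
      then show ?thesis using \<open>t \<le> real (Suc k)\<close> by (simp add: clamp01_def)
    qed
  qed
  have res_eq: "res d ?\<phi> = res (Suc k) ?\<phi>"
    by (rule res_truncate) (use k phi(3) in auto)
  obtain zs where zs: "res (Suc k) ?\<phi> = root_poly zs" "\<forall>z\<in>set zs. 0 < z" "length zs = Suc k"
    using res_interp_roots[of k ?\<phi>] k phi(1,2) by blast
  have rho: "\<rho> = - Polynomial.coeff (res d ?\<phi>) 1" using t(3) by (simp add: s_def)
  have "zs \<noteq> []" using zs(3) by auto
  have "\<exists>w B. residual_filter D x W (res d ?\<phi>) \<rho> w B"
    unfolding rho
  proof (rule root_filter[OF _ zs(2) \<open>zs \<noteq> []\<close>])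
    show "res d ?\<phi> = root_poly zs" using res_eq zs(1) by simp
    show "ipw (res d ?\<phi>) p = 0" if "Polynomial.degree p < length zs - 1 + 1" "poly p 0 = 0" for p
      by (rule ip_res_orthogonal[where m = k]) (use that zs(3) phi(2) k in auto)
    show "ipw (res d ?\<phi>) (res d ?\<phi>) \<le> ipw (res d ?\<phi>) 1"
      by (rule ip_res_self_le_one) (simp add: clamp01_bounds)
  qed
  then show ?thesis using t(1,2) by (intro bexI[of _ t]) auto
qed

lemma res_increment_le:
  assumes "s \<le> t"
  shows "ipw (res d (clamp01 s) - res d (clamp01 t)) (res d (clamp01 s) - res d (clamp01 t))
    \<le> ipw (res d (clamp01 s)) (res d (clamp01 s)) - ipw (res d (clamp01 t)) (res d (clamp01 t))"
  by (rule ip_res_mono) (use assms in \<open>auto simp: clamp01_bounds clamp01_mono\<close>)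


text \<open>The stopped iterate is compared with the iterate \<open>t\<close> of \<open>spectral_filter_exists\<close>: by the Pythagorean
  inequality \<open>res_increment_le\<close> their distance is governed by the difference of the squared residuals,
  whether \<open>t\<close> lies before or after \<open>\<tau>\<close>.\<close>

lemma stopped_loss_bound:
  fixes g \<xi> :: "nat \<Rightarrow> real"
  assumes W: "\<And>i. i \<in> {1..D} \<Longrightarrow> W i = (g i + \<xi> i)\<^sup>2" and "0 < \<rho>" and "0 \<le> \<tau>"
    and stop: "ipw (res d (clamp01 \<tau>)) (res d (clamp01 \<tau>)) = \<kappa> \<or>
      \<tau> = 0 \<and> ipw (res d (clamp01 \<tau>)) (res d (clamp01 \<tau>)) \<le> \<kappa>"
  obtains w where "\<And>i. i \<in> {1..D} \<Longrightarrow> 0 \<le> w i \<and> w i \<le> 1 \<and> w i \<le> exp (- (\<rho> * x i)) \<and> 1 - w i \<le> \<rho> * x i"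
    "\<And>i j. i \<in> {1..D} \<Longrightarrow> j \<in> {1..D} \<Longrightarrow> x i \<le> x j \<Longrightarrow> w j \<le> w i"
    "(\<Sum>i=1..D. (\<xi> i - poly (res d (clamp01 \<tau>)) (x i) * (g i + \<xi> i))\<^sup>2)
      \<le> 48 * (\<Sum>i=1..D. w i * (g i)\<^sup>2) + 72 * (\<Sum>i=1..D. (1 - w i) * (\<xi> i)\<^sup>2)
        + 4 * \<bar>\<Sum>i=1..D. w i * (g i * \<xi> i)\<bar> + 2 * \<bar>\<kappa> - (\<Sum>i=1..D. (\<xi> i)\<^sup>2)\<bar>"
proof -
  obtain t w B where t: "t \<in> {0..real d}" and B: "B \<subseteq> {1..D}"
    and r_w: "\<And>i. i \<in> {1..D} - B \<Longrightarrow> poly (res d (clamp01 t)) (x i) = w i"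
    and w0: "\<And>i. i \<in> B \<Longrightarrow> w i = 0"
    and key: "(\<Sum>i\<in>B. W i * (poly (res d (clamp01 t)) (x i))\<^sup>2) \<le> (\<Sum>i=1..D. W i * (w i * (1 - w i)))"
    and bnd: "\<forall>i\<in>{1..D}. 0 \<le> w i \<and> w i \<le> 1 \<and> w i \<le> exp (- (\<rho> * x i)) \<and> 1 - w i \<le> \<rho> * x i"
    and mono: "\<forall>i\<in>{1..D}. \<forall>j\<in>{1..D}. x i \<le> x j \<longrightarrow> w j \<le> w i"
    using spectral_filter_exists[OF assms(2)] unfolding residual_filter_def
  proof (elim bexE exE conjE, goal_cases)
    case (1 t w B)
    show ?case by (rule 1(1)[OF 1(2,3) _ _ 1(6-8)]) (use 1(4,5) in auto)
  qed
  define rt where "rt = (\<lambda>i. poly (res d (clamp01 t)) (x i))"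
  define rs where "rs = (\<lambda>i. poly (res d (clamp01 \<tau>)) (x i))"
  \<comment> \<open>In these coordinates \<open>e\<close> below is the prediction error of the
    iterate \<open>t\<close>, and \<open>a\<close>, \<open>S\<close>, \<open>X\<close> are the bias,
    variance and cross terms of the filter \<open>w\<close>.\<close>
  define Y where "Y = (\<lambda>i. g i + \<xi> i)"
  define e where "e = (\<lambda>i. \<xi> i - rt i * Y i)"
  define a where "a = (\<Sum>i=1..D. w i * (g i)\<^sup>2)"
  define S where "S = (\<Sum>i=1..D. (1 - w i) * (\<xi> i)\<^sup>2)"
  define X where "X = (\<Sum>i=1..D. w i * (g i * \<xi> i))"
  define L where "L = (\<Sum>i=1..D. (e i)\<^sup>2)"
  define Rt where "Rt = ipw (res d (clamp01 t)) (res d (clamp01 t))"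
  have split: "(\<Sum>i=1..D. f i) = (\<Sum>i\<in>{1..D} - B. f i) + (\<Sum>i\<in>B. f i)" for f :: "nat \<Rightarrow> real"
    using B by (intro sum.subset_diff) auto
  have S_B: "(\<Sum>i\<in>B. (\<xi> i)\<^sup>2) \<le> S"
  proof -
    have "(\<Sum>i\<in>B. (\<xi> i)\<^sup>2) = (\<Sum>i\<in>B. (1 - w i) * (\<xi> i)\<^sup>2)" using w0 by simp
    also have "\<dots> \<le> S" unfolding S_def using B bnd by (intro sum_mono2) auto
    finally show ?thesis .
  qed
  \<comment> \<open>\<open>W i\<close> is at most \<open>2 * g^2 + 2 * \<xi>^2\<close>; of the
    product \<open>w * (1 - w)\<close> one keeps \<open>w\<close> with the signal and
    \<open>1 - w\<close> with the noise.\<close>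
  have key': "(\<Sum>i\<in>B. (rt i * Y i)\<^sup>2) \<le> 2 * a + 2 * S"
  proof -
    have "(\<Sum>i\<in>B. (rt i * Y i)\<^sup>2) = (\<Sum>i\<in>B. W i * (poly (res d (clamp01 t)) (x i))\<^sup>2)"
      using B W by (intro sum.cong) (auto simp: rt_def Y_def power_mult_distrib)
    also note key
    also have "(\<Sum>i=1..D. W i * (w i * (1 - w i))) \<le> (\<Sum>i=1..D. 2 * (w i * (g i)\<^sup>2) + 2 * ((1 - w i) * (\<xi> i)\<^sup>2))"
    proof (rule sum_mono)
      fix i assume i: "i \<in> {1..D}"
      have b: "0 \<le> w i" "w i \<le> 1" using bnd i by auto
      have "W i * (w i * (1 - w i)) \<le> (2 * (g i)\<^sup>2 + 2 * (\<xi> i)\<^sup>2) * (w i * (1 - w i))"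
        using b sum_squares_bound[of "g i" "\<xi> i"] unfolding W[OF i]
        by (intro mult_right_mono) (auto simp: power2_sum)
      also have "\<dots> = 2 * (w i * (g i)\<^sup>2) * (1 - w i) + 2 * ((1 - w i) * (\<xi> i)\<^sup>2) * w i"
        by (simp add: algebra_simps)
      also have "\<dots> \<le> 2 * (w i * (g i)\<^sup>2) + 2 * ((1 - w i) * (\<xi> i)\<^sup>2)"
        using b by (intro add_mono mult_left_le) auto
      finally show "W i * (w i * (1 - w i)) \<le> 2 * (w i * (g i)\<^sup>2) + 2 * ((1 - w i) * (\<xi> i)\<^sup>2)" .
    qed
    also have "\<dots> = 2 * a + 2 * S" by (simp add: a_def S_def sum.distrib sum_distrib_left)
    finally show ?thesis .
  qed
  \<comment> \<open>Outside \<open>B\<close> the error is that of the filter and costs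
    \<open>2a + 2S\<close>. On \<open>B\<close> it costs twice the noise there, at most
    \<open>2S\<close>, and twice the bound \<open>2a + 2S\<close> for the residual.\<close>
  have L: "L \<le> 6 * a + 8 * S"
  proof -
    have "(\<Sum>i\<in>{1..D} - B. (e i)\<^sup>2) \<le> (\<Sum>i\<in>{1..D} - B. 2 * (w i * (g i)\<^sup>2) + 2 * ((1 - w i) * (\<xi> i)\<^sup>2))"
    proof (rule sum_mono)
      fix i assume i: "i \<in> {1..D} - B"
      then have b: "0 \<le> w i" "w i \<le> 1" using bnd by auto
      have "e i = (1 - w i) * \<xi> i - w i * g i"
        unfolding e_def rt_def Y_def using r_w[OF i] by (simp add: algebra_simps)
      then have "(e i)\<^sup>2 \<le> 2 * ((1 - w i) * \<xi> i)\<^sup>2 + 2 * (w i * g i)\<^sup>2"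
        using sum_squares_bound[of "(1 - w i) * \<xi> i" "- (w i * g i)"] by (simp add: power2_diff)
      also have "\<dots> = 2 * ((1 - w i) * (\<xi> i)\<^sup>2) * (1 - w i) + 2 * (w i * (g i)\<^sup>2) * w i"
        by (simp add: power2_eq_square)
      also have "\<dots> \<le> 2 * ((1 - w i) * (\<xi> i)\<^sup>2) + 2 * (w i * (g i)\<^sup>2)"
        using b by (intro add_mono mult_left_le) auto
      finally show "(e i)\<^sup>2 \<le> 2 * (w i * (g i)\<^sup>2) + 2 * ((1 - w i) * (\<xi> i)\<^sup>2)" by simp
    qed
    also have "\<dots> \<le> (\<Sum>i=1..D. 2 * (w i * (g i)\<^sup>2) + 2 * ((1 - w i) * (\<xi> i)\<^sup>2))"
      using bnd by (intro sum_mono2) auto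
    also have "\<dots> = 2 * a + 2 * S" by (simp add: a_def S_def sum.distrib sum_distrib_left)
    finally have 1: "(\<Sum>i\<in>{1..D} - B. (e i)\<^sup>2) \<le> 2 * a + 2 * S" .
    have "(\<Sum>i\<in>B. (e i)\<^sup>2) \<le> (\<Sum>i\<in>B. 2 * (\<xi> i)\<^sup>2 + 2 * (rt i * Y i)\<^sup>2)"
    proof (rule sum_mono)
      fix i
      show "(e i)\<^sup>2 \<le> 2 * (\<xi> i)\<^sup>2 + 2 * (rt i * Y i)\<^sup>2"
        using sum_squares_bound[of "\<xi> i" "- (rt i * Y i)"] by (simp add: e_def power2_diff)
    qed
    also have "\<dots> = 2 * (\<Sum>i\<in>B. (\<xi> i)\<^sup>2) + 2 * (\<Sum>i\<in>B. (rt i * Y i)\<^sup>2)"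
      by (simp add: sum.distrib sum_distrib_left)
    finally show ?thesis
      using 1 S_B key' unfolding L_def split[of "\<lambda>i. (e i)\<^sup>2"] by linarith
  qed
  \<comment> \<open>This controls the mixed term in the expansion of the squared residual around the
    squared norm of the noise. The nodes in \<open>B\<close> carry no cross term because
    \<open>w\<close> vanishes there.\<close>
  have inner: "\<bar>\<Sum>i=1..D. \<xi> i * e i\<bar> \<le> 2 * S + \<bar>X\<bar> + L"
  proof -
    have "(\<Sum>i\<in>{1..D} - B. \<xi> i * e i) = (\<Sum>i\<in>{1..D} - B. (1 - w i) * (\<xi> i)\<^sup>2 - w i * (g i * \<xi> i))"
      by (intro sum.cong) (auto simp: e_def rt_def Y_def r_w power2_eq_square algebra_simps)
    also have "\<dots> = (\<Sum>i\<in>{1..D} - B. (1 - w i) * (\<xi> i)\<^sup>2) - (\<Sum>i\<in>{1..D} - B. w i * (g i * \<xi> i))"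
      by (simp add: sum_subtractf)
    also have "(\<Sum>i\<in>{1..D} - B. w i * (g i * \<xi> i)) = X"
      unfolding X_def using w0 by (intro sum.mono_neutral_left) auto
    finally have 1: "(\<Sum>i\<in>{1..D} - B. \<xi> i * e i) = (\<Sum>i\<in>{1..D} - B. (1 - w i) * (\<xi> i)\<^sup>2) - X" .
    have "0 \<le> (\<Sum>i\<in>{1..D} - B. (1 - w i) * (\<xi> i)\<^sup>2)" using bnd by (intro sum_nonneg) auto
    moreover have "(\<Sum>i\<in>{1..D} - B. (1 - w i) * (\<xi> i)\<^sup>2) \<le> S"
      unfolding S_def using bnd by (intro sum_mono2) auto
    ultimately have 2: "\<bar>\<Sum>i\<in>{1..D} - B. \<xi> i * e i\<bar> \<le> S + \<bar>X\<bar>" unfolding 1 by linarith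
    have "\<bar>\<Sum>i\<in>B. \<xi> i * e i\<bar> \<le> (\<Sum>i\<in>B. \<bar>\<xi> i * e i\<bar>)" by (rule sum_abs)
    also have "\<dots> \<le> (\<Sum>i\<in>B. (\<xi> i)\<^sup>2 + (e i)\<^sup>2)"
    proof (rule sum_mono)
      fix i
      show "\<bar>\<xi> i * e i\<bar> \<le> (\<xi> i)\<^sup>2 + (e i)\<^sup>2"
        using sum_squares_bound[of "\<bar>\<xi> i\<bar>" "\<bar>e i\<bar>"]
          mult_nonneg_nonneg[of "\<bar>\<xi> i\<bar>" "\<bar>e i\<bar>"] unfolding abs_mult power2_abs by linarith
    qed
    also have "\<dots> = (\<Sum>i\<in>B. (\<xi> i)\<^sup>2) + (\<Sum>i\<in>B. (e i)\<^sup>2)" by (simp add: sum.distrib)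
    also have "(\<Sum>i\<in>B. (e i)\<^sup>2) \<le> L" unfolding L_def using B by (intro sum_mono2) auto
    finally show ?thesis using 2 S_B unfolding split[of "\<lambda>i. \<xi> i * e i"] by linarith
  qed
  have "Rt = (\<Sum>i=1..D. (\<xi> i - e i)\<^sup>2)"
    unfolding Rt_def ip_def
    by (intro sum.cong refl) (auto simp: W e_def rt_def Y_def power2_eq_square)
  also have "\<dots> = (\<Sum>i=1..D. (\<xi> i)\<^sup>2) - 2 * (\<Sum>i=1..D. \<xi> i * e i) + L"
    by (simp add: power2_diff sum.distrib sum_subtractf sum_distrib_left L_def mult.assoc)
  finally have Rt_eq: "Rt = (\<Sum>i=1..D. (\<xi> i)\<^sup>2) - 2 * (\<Sum>i=1..D. \<xi> i * e i) + L" .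
  have Rt: "\<bar>\<kappa> - Rt\<bar> \<le> \<bar>\<kappa> - (\<Sum>i=1..D. (\<xi> i)\<^sup>2)\<bar> + 2 * (2 * S + \<bar>X\<bar> + L) + L"
  proof -
    have "0 \<le> L" unfolding L_def by (intro sum_nonneg) auto
    have "\<bar>\<kappa> - r\<bar> \<le> \<bar>\<kappa> - v\<bar> + 2 * u + L" if "r = v - 2 * y + L" "\<bar>y\<bar> \<le> u" for r v y u
      using that \<open>0 \<le> L\<close> by (auto simp: abs_if split: if_splits)
    from this[OF Rt_eq inner] show ?thesis .
  qed
  \<comment> \<open>For \<open>t \<le> \<tau>\<close> the exact value \<open>\<kappa>\<close> at
    \<open>\<tau>\<close> is needed; if \<open>\<tau> = 0\<close>, where only
    \<open>\<le> \<kappa>\<close> is known, then \<open>t = \<tau>\<close>. For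
    \<open>t > \<tau>\<close> the inequality at \<open>\<tau>\<close> suffices.\<close>
  have dist: "(\<Sum>i=1..D. ((rt i - rs i) * Y i)\<^sup>2) \<le> \<bar>\<kappa> - Rt\<bar>"
  proof -
    have "ipw (res d (clamp01 t) - res d (clamp01 \<tau>)) (res d (clamp01 t) - res d (clamp01 \<tau>)) \<le> \<bar>\<kappa> - Rt\<bar>"
    proof (cases "t \<le> \<tau>")
      case True
      show ?thesis
      proof (cases "\<tau> = 0")
        case True
        with \<open>t \<le> \<tau>\<close> t have "t = \<tau>" by auto
        then show ?thesis by (simp add: ip_def)
      next
        case False
        then show ?thesis using res_increment_le[OF True] stop by (simp add: Rt_def)
      qed
    next
      case False
      have "ipw (p - q) (p - q) = ipw (q - p) (q - p)" for p q
        by (simp add: ip_def algebra_simps)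
      moreover have "\<tau> \<le> t" using False by simp
      ultimately show ?thesis using res_increment_le[of \<tau> t] stop by (auto simp: Rt_def)
    qed
    also have "ipw (res d (clamp01 t) - res d (clamp01 \<tau>)) (res d (clamp01 t) - res d (clamp01 \<tau>))
        = (\<Sum>i=1..D. ((rt i - rs i) * Y i)\<^sup>2)"
      unfolding ip_def by (intro sum.cong refl) (auto simp: W rt_def rs_def Y_def power2_eq_square)
    finally show ?thesis .
  qed
  have "(\<Sum>i=1..D. (\<xi> i - rs i * Y i)\<^sup>2) \<le> (\<Sum>i=1..D. 2 * (e i)\<^sup>2 + 2 * ((rt i - rs i) * Y i)\<^sup>2)"
  proof (rule sum_mono)
    fix i
    have "\<xi> i - rs i * Y i = e i + (rt i - rs i) * Y i" by (simp add: e_def algebra_simps)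
    then show "(\<xi> i - rs i * Y i)\<^sup>2 \<le> 2 * (e i)\<^sup>2 + 2 * ((rt i - rs i) * Y i)\<^sup>2"
      using sum_squares_bound[of "e i" "(rt i - rs i) * Y i"] by (simp add: power2_sum)
  qed
  also have "\<dots> = 2 * L + 2 * (\<Sum>i=1..D. ((rt i - rs i) * Y i)\<^sup>2)"
    by (simp add: sum.distrib sum_distrib_left L_def)
  finally have total: "(\<Sum>i=1..D. (\<xi> i - rs i * Y i)\<^sup>2)
      \<le> 2 * L + 2 * (\<Sum>i=1..D. ((rt i - rs i) * Y i)\<^sup>2)" .
  \<comment> \<open>Collecting terms gives \<open>8L + 8S + 4|X|\<close> plus twice the deviation,
    and \<open>8L \<le> 48a + 64S\<close>.\<close>
  have loss: "(\<Sum>i=1..D. (\<xi> i - rs i * Y i)\<^sup>2) \<le> 48 * a + 72 * S + 4 * \<bar>X\<bar> + 2 * \<bar>\<kappa> - (\<Sum>i=1..D. (\<xi> i)\<^sup>2)\<bar>"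
  proof -
    have "l \<le> 48 * a + 72 * S + 4 * y + 2 * v"
      if "l \<le> 2 * L + 2 * q" "q \<le> u" "u \<le> v + 2 * (2 * S + y + L) + L" for l q u v y :: real
    proof -
      have "2 * u \<le> 2 * v + 8 * S + 4 * y + 6 * L" using that(3) by simp
      moreover have "8 * L \<le> 48 * a + 64 * S" using L by simp
      ultimately show ?thesis using that(1,2) by simp
    qed
    from this[OF total dist Rt] show ?thesis .
  qed
  show ?thesis
    by (rule that[OF _ _ loss[unfolded a_def S_def X_def rs_def Y_def]]) (use bnd mono in auto)
qed

end

text \<open>Summation by parts writes monotone weights as mixtures of the indicators of tails \<open>{m..D}\<close>.\<close>

lemma monotone_weights_cross_term:
  fixes w h G :: "nat \<Rightarrow> real"
  assumes w: "\<And>i. i \<in> {1..D} \<Longrightarrow> 0 \<le> w i \<and> w i \<le> 1"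
    and mono: "\<And>i j. 1 \<le> i \<Longrightarrow> i \<le> j \<Longrightarrow> j \<le> D \<Longrightarrow> w i \<le> w j"
    and G: "\<And>i. i \<in> {1..D} \<Longrightarrow> 0 \<le> G i" and M: "0 \<le> M"
    and tail: "\<And>m. m \<in> {1..D} \<Longrightarrow> (\<Sum>i=m..D. h i)\<^sup>2 \<le> M * (\<Sum>i=m..D. G i)"
  shows "\<bar>\<Sum>i=1..D. w i * h i\<bar> \<le> (\<Sum>i=1..D. w i * G i) + M / 4"
proof -
  \<comment> \<open>The increments are nonnegative and sum to \<open>w D \<le> 1\<close>, so the
    constant \<open>M / 4\<close> is charged at most once.\<close>
  define \<Delta> where "\<Delta> m = w m - (if m = 1 then 0 else w (m - 1))" for m
  have \<Delta>: "0 \<le> \<Delta> m" if "m \<in> {1..D}" for m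
    using w[OF that] mono[of "m - 1" m] that by (auto simp: \<Delta>_def)
  have sum_\<Delta>: "(\<Sum>m=1..i. \<Delta> m) = w i" if "1 \<le> i" for i
    using that by (induction i rule: dec_induct) (auto simp: \<Delta>_def One_nat_def)
  have parts: "(\<Sum>i=1..D. w i * a i) = (\<Sum>m=1..D. \<Delta> m * (\<Sum>i=m..D. a i))" for a :: "nat \<Rightarrow> real"
  proof -
    have "(\<Sum>i=1..D. w i * a i) = (\<Sum>i=1..D. \<Sum>m\<in>{m\<in>{1..D}. m \<le> i}. \<Delta> m * a i)"
    proof (intro sum.cong refl)
      fix i assume i: "i \<in> {1..D}"
      then have "{m\<in>{1..D}. m \<le> i} = {1..i}" by auto
      then show "w i * a i = (\<Sum>m\<in>{m\<in>{1..D}. m \<le> i}. \<Delta> m * a i)"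
        using sum_\<Delta>[of i] i by (simp flip: sum_distrib_right)
    qed
    also have "\<dots> = (\<Sum>m=1..D. \<Sum>i\<in>{i\<in>{1..D}. m \<le> i}. \<Delta> m * a i)"
      by (rule sum.swap_restrict) auto
    also have "\<dots> = (\<Sum>m=1..D. \<Delta> m * (\<Sum>i=m..D. a i))"
      unfolding sum_distrib_left by (intro sum.cong) auto
    finally show ?thesis .
  qed
  have "\<bar>\<Sum>i=1..D. w i * h i\<bar> \<le> (\<Sum>m=1..D. \<bar>\<Delta> m * (\<Sum>i=m..D. h i)\<bar>)"
    unfolding parts by (rule sum_abs)
  also have "\<dots> \<le> (\<Sum>m=1..D. \<Delta> m * ((\<Sum>i=m..D. G i) + M / 4))"
  proof (rule sum_mono)
    fix m assume m: "m \<in> {1..D}"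
    define T where "T = (\<Sum>i=m..D. h i)"
    define H where "H = (\<Sum>i=m..D. G i)"
    have "0 \<le> H" unfolding H_def using m by (intro sum_nonneg G) auto
    have "T\<^sup>2 \<le> M * H" using tail[OF m] by (simp add: T_def H_def)
    \<comment> \<open>AM-GM with the split chosen so that the part multiplying \<open>M\<close> is
      free of \<open>H\<close>; the part \<open>H\<close> reassembles into the weighted sum of
      \<open>G\<close>.\<close>
    also have "\<dots> \<le> (H + M / 4)\<^sup>2"
      using zero_le_power2[of "H - M / 4"] by (simp add: power2_eq_square algebra_simps)
    finally have "\<bar>T\<bar>\<^sup>2 \<le> (H + M / 4)\<^sup>2" unfolding power2_abs .
    moreover have "0 \<le> H + M / 4" using \<open>0 \<le> H\<close> M by simp
    ultimately have "\<bar>T\<bar> \<le> H + M / 4" by (rule power2_le_imp_le)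
    then show "\<bar>\<Delta> m * T\<bar> \<le> \<Delta> m * (H + M / 4)"
      using \<Delta>[OF m] by (simp add: abs_mult mult_left_mono)
  qed
  also have "\<dots> = (\<Sum>i=1..D. w i * G i) + (\<Sum>m=1..D. \<Delta> m) * (M / 4)"
    by (simp add: parts distrib_left sum.distrib sum_distrib_right)
  also have "(\<Sum>m=1..D. \<Delta> m) * (M / 4) \<le> 1 * (M / 4)"
  proof (cases "D = 0")
    case False
    then show ?thesis using sum_\<Delta>[of D] w[of D] M by (intro mult_right_mono) auto
  qed (use M in auto)
  finally show ?thesis by simp
qed

section \<open>Gaussian integrals\<close>

abbreviation gauss :: "nat \<Rightarrow> (nat \<Rightarrow> real) measure" where
  "gauss D \<equiv> \<Pi>\<^sub>M i\<in>{..<D}. std_normal_distribution"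

abbreviation lin :: "nat \<Rightarrow> (nat \<Rightarrow> real) \<Rightarrow> (nat \<Rightarrow> real) \<Rightarrow> real" where
  "lin D a z \<equiv> \<Sum>i<D. a i * z i"

lemma prob_space_std_normal: "prob_space std_normal_distribution"
  by (rule prob_space_normal_density) simp

interpretation gauss: product_prob_space "\<lambda>_::nat. std_normal_distribution" I for I
  by (intro product_prob_spaceI prob_space_std_normal)

lemma prob_space_gauss: "prob_space (gauss D)"
  by (intro prob_space_PiM prob_space_std_normal)

lemma sets_gauss [measurable_cong]: "sets (gauss D) = sets (\<Pi>\<^sub>M i\<in>{..<D}. borel)"
  by (intro sets_PiM_cong) auto

lemma std_normal_shift:
  assumes [measurable]: "\<phi> \<in> borel_measurable borel"
  shows "(\<integral>\<^sup>+ x. \<phi> (x + a) \<partial>std_normal_distribution)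
    = (\<integral>\<^sup>+ x. \<phi> x * ennreal (exp (a * x - a\<^sup>2 / 2)) \<partial>std_normal_distribution)"
proof -
  have "(\<integral>\<^sup>+ x. \<phi> (x + a) \<partial>std_normal_distribution)
      = (\<integral>\<^sup>+ x. ennreal (std_normal_density x) * \<phi> (x + a) \<partial>lborel)"
    by (subst nn_integral_density) auto
  also have "\<dots> = (\<integral>\<^sup>+ x. ennreal (std_normal_density (x - a)) * \<phi> x \<partial>lborel)"
    by (subst nn_integral_real_affine[where c = 1 and t = "- a"]) auto
  also have "\<dots> = (\<integral>\<^sup>+ x. ennreal (std_normal_density x) * (\<phi> x * ennreal (exp (a * x - a\<^sup>2 / 2))) \<partial>lborel)"
  proof (intro nn_integral_cong)
    fix x :: real
    have "std_normal_density (x - a) = std_normal_density x * exp (a * x - a\<^sup>2 / 2)"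
      by (simp add: std_normal_density_def power2_eq_square field_simps flip: exp_add)
    then show "ennreal (std_normal_density (x - a)) * \<phi> x
        = ennreal (std_normal_density x) * (\<phi> x * ennreal (exp (a * x - a\<^sup>2 / 2)))"
      by (simp add: ennreal_mult mult_ac)
  qed
  also have "\<dots> = (\<integral>\<^sup>+ x. \<phi> x * ennreal (exp (a * x - a\<^sup>2 / 2)) \<partial>std_normal_distribution)"
    by (subst nn_integral_density) auto
  finally show ?thesis .
qed

text \<open>Both the shifted measure and the density measure factorise, so they are compared on
  boxes coordinate by coordinate. Exponential moments and null hyperplanes below are derived from
  the same formula.\<close>

theorem Cameron_Martin_gauss:
  assumes [measurable]: "\<phi> \<in> borel_measurable (gauss D)"
  shows "(\<integral>\<^sup>+ z. \<phi> (\<lambda>i\<in>{..<D}. z i + a i) \<partial>gauss D)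
    = (\<integral>\<^sup>+ z. \<phi> z * ennreal (exp (lin D a z - (\<Sum>i<D. (a i)\<^sup>2) / 2)) \<partial>gauss D)"
proof -
  let ?f = "\<lambda>i x. exp (a i * x - (a i)\<^sup>2 / 2)"
  let ?T = "distr (gauss D) (\<Pi>\<^sub>M i\<in>{..<D}. borel) (\<lambda>z. \<lambda>i\<in>{..<D}. z i + a i)"
  let ?S = "density (gauss D) (\<lambda>z. ennreal (\<Prod>i<D. ?f i (z i)))"
  have shift [measurable]: "(\<lambda>z. \<lambda>i\<in>{..<D}. z i + a i) \<in> gauss D \<rightarrow>\<^sub>M (\<Pi>\<^sub>M i\<in>{..<D}. borel)"
    by measurable
  have dens [measurable]: "(\<lambda>z. ennreal (\<Prod>i<D. ?f i (z i))) \<in> borel_measurable (gauss D)"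
    by measurable
  have "?T = ?S"
  proof (rule measure_eqI_PiM_finite[where I = "{..<D}" and M = "\<lambda>_. borel"])
    show "sets ?S = sets (\<Pi>\<^sub>M i\<in>{..<D}. borel)" by (simp add: sets_gauss)
    show "range (\<lambda>_::nat. \<Pi>\<^sub>E i\<in>{..<D}. UNIV) \<subseteq> prod_algebra {..<D} (\<lambda>_. borel)"
      by (auto intro!: prod_algebraI_finite)
    show "(\<Union>i::nat. \<Pi>\<^sub>E i\<in>{..<D}. UNIV) = space (\<Pi>\<^sub>M i\<in>{..<D}. (borel :: real measure))"
      by (simp add: space_PiM)
    interpret T: prob_space ?T by (intro prob_space.prob_space_distr prob_space_gauss shift)
    show "emeasure ?T (\<Pi>\<^sub>E i\<in>{..<D}. UNIV) \<noteq> \<infinity>" by simp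
  next
    fix A :: "nat \<Rightarrow> real set" assume A: "\<And>i. i \<in> {..<D} \<Longrightarrow> A i \<in> sets borel"
    have box: "Pi\<^sub>E {..<D} A \<in> sets (\<Pi>\<^sub>M i\<in>{..<D}. borel)" using A by (intro sets_PiM_I_finite) auto
    have ind: "indicator (Pi\<^sub>E {..<D} A) z = (\<Prod>i<D. indicator (A i) (z i) :: ennreal)"
      if "z \<in> extensional {..<D}" for z
    proof (cases "\<forall>i<D. z i \<in> A i")
      case True
      then show ?thesis using that by (simp add: PiE_def indicator_def)
    next
      case False
      then obtain i where "i < D" "z i \<notin> A i" by blast
      then show ?thesis by (subst prod_zero[where A = "{..<D}"]) (auto simp: indicator_def PiE_def Pi_iff)
    qed
    have "emeasure ?T (Pi\<^sub>E {..<D} A) = (\<integral>\<^sup>+ z. indicator (Pi\<^sub>E {..<D} A) z \<partial>?T)"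
      using box by simp
    also have "\<dots> = (\<integral>\<^sup>+ z. indicator (Pi\<^sub>E {..<D} A) (\<lambda>i\<in>{..<D}. z i + a i) \<partial>gauss D)"
      using box by (subst nn_integral_distr) auto
    also have "\<dots> = (\<integral>\<^sup>+ z. (\<Prod>i<D. indicator (A i) (z i + a i)) \<partial>gauss D)"
      by (intro nn_integral_cong) (subst ind, auto)
    also have "\<dots> = (\<Prod>i<D. \<integral>\<^sup>+ x. indicator (A i) (x + a i) \<partial>std_normal_distribution)"
      using A by (intro gauss.product_nn_integral_prod[where f = "\<lambda>i x. indicator (A i) (x + a i)"]) auto
    also have "\<dots> = (\<Prod>i<D. \<integral>\<^sup>+ x. indicator (A i) x * ennreal (?f i x) \<partial>std_normal_distribution)"
      using A by (intro prod.cong refl std_normal_shift) auto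
    also have "\<dots> = (\<integral>\<^sup>+ z. (\<Prod>i<D. indicator (A i) (z i) * ennreal (?f i (z i))) \<partial>gauss D)"
      using A by (intro gauss.product_nn_integral_prod[symmetric, where f = "\<lambda>i x. indicator (A i) x * ennreal (?f i x)"]) auto
    also have "\<dots> = (\<integral>\<^sup>+ z. ennreal (\<Prod>i<D. ?f i (z i)) * indicator (Pi\<^sub>E {..<D} A) z \<partial>gauss D)"
      by (intro nn_integral_cong) (subst ind, auto simp: space_PiM PiE_def prod.distrib prod_ennreal mult.commute)
    also have "\<dots> = emeasure ?S (Pi\<^sub>E {..<D} A)"
      using box by (subst emeasure_density) (auto simp: sets_gauss)
    finally show "emeasure ?T (Pi\<^sub>E {..<D} A) = emeasure ?S (Pi\<^sub>E {..<D} A)" .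
  qed auto
  then have T_S: "(\<integral>\<^sup>+ z. \<phi> z \<partial>?T) = (\<integral>\<^sup>+ z. \<phi> z \<partial>?S)" by simp
  have T: "(\<integral>\<^sup>+ z. \<phi> z \<partial>?T) = (\<integral>\<^sup>+ z. \<phi> (\<lambda>i\<in>{..<D}. z i + a i) \<partial>gauss D)"
    by (rule nn_integral_distr[OF shift]) measurable
  have S: "(\<integral>\<^sup>+ z. \<phi> z \<partial>?S) = (\<integral>\<^sup>+ z. \<phi> z * ennreal (exp (lin D a z - (\<Sum>i<D. (a i)\<^sup>2) / 2)) \<partial>gauss D)"
    by (subst nn_integral_density)
      (auto simp: exp_sum[symmetric] sum_subtractf sum_divide_distrib mult.commute intro!: nn_integral_cong)
  show ?thesis using T_S unfolding T S .
qed

text \<open>The case of the constant function 1: the Cameron-Martin density integrates to 1.\<close>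

lemma gauss_mgf:
  "(\<integral>\<^sup>+ z. ennreal (exp (lin D a z)) \<partial>gauss D) = ennreal (exp ((\<Sum>i<D. (a i)\<^sup>2) / 2))"
proof -
  let ?s = "(\<Sum>i<D. (a i)\<^sup>2) / 2"
  have "1 = (\<integral>\<^sup>+ z. 1 * ennreal (exp (lin D a z - ?s)) \<partial>gauss D)"
    using Cameron_Martin_gauss[of "\<lambda>_. 1" D a] by (simp add: prob_space.emeasure_space_1[OF prob_space_gauss])
  also have "\<dots> = (\<integral>\<^sup>+ z. ennreal (exp (- ?s)) * ennreal (exp (lin D a z)) \<partial>gauss D)"
    by (intro nn_integral_cong) (simp only: mult_1 ennreal_mult[symmetric] exp_ge_zero exp_add[symmetric] add.commute diff_conv_add_uminus)
  also have "\<dots> = ennreal (exp (- ?s)) * (\<integral>\<^sup>+ z. ennreal (exp (lin D a z)) \<partial>gauss D)"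
    by (intro nn_integral_cmult) measurable
  finally have one: "1 = ennreal (exp (- ?s)) * (\<integral>\<^sup>+ z. ennreal (exp (lin D a z)) \<partial>gauss D)" .
  have "ennreal (exp ?s) * ennreal (exp (- ?s)) = 1"
    by (subst ennreal_mult[symmetric]) (simp_all add: exp_minus)
  then have "(\<integral>\<^sup>+ z. ennreal (exp (lin D a z)) \<partial>gauss D)
      = ennreal (exp ?s) * (ennreal (exp (- ?s)) * (\<integral>\<^sup>+ z. ennreal (exp (lin D a z)) \<partial>gauss D))"
    by (simp only: mult.assoc[symmetric] mult_1)
  also have "\<dots> = ennreal (exp ?s)" by (simp only: one[symmetric] mult_1_right)
  finally show ?thesis .
qed

text \<open>Powers are dominated by exponentials, \<open>t^2 \<le> 2 * exp |t|\<close> and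
  \<open>t^4 \<le> 64 * exp |t|\<close>, and \<open>exp t + exp (- t)\<close> has mean
  \<open>2 * exp (1/2) \<le> 4\<close>. Only the independence of the bounds from \<open>D\<close>
  and \<open>a\<close> matters.\<close>

lemma gauss_even_moments:
  assumes "(\<Sum>i<D. (a i)\<^sup>2) = 1"
  shows "(\<integral>\<^sup>+ z. ennreal ((lin D a z)\<^sup>2) \<partial>gauss D) \<le> 8"
    and "(\<integral>\<^sup>+ z. ennreal ((lin D a z) ^ 4) \<partial>gauss D) \<le> 256"
proof -
  have mgf: "(\<integral>\<^sup>+ z. ennreal (c * (exp (lin D a z) + exp (- lin D a z))) \<partial>gauss D) \<le> ennreal (4 * c)"
    if "0 \<le> c" for c
  proof -
    have "(\<integral>\<^sup>+ z. ennreal (c * (exp (lin D a z) + exp (- lin D a z))) \<partial>gauss D)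
        = ennreal c * ((\<integral>\<^sup>+ z. ennreal (exp (lin D a z)) \<partial>gauss D) + (\<integral>\<^sup>+ z. ennreal (exp (lin D (\<lambda>i. - a i) z)) \<partial>gauss D))"
      using that by (simp add: ennreal_mult ennreal_plus sum_negf nn_integral_add nn_integral_cmult)
    also have "\<dots> = ennreal c * (ennreal (exp (1 / 2)) + ennreal (exp (1 / 2)))"
      unfolding gauss_mgf using assms by simp
    also have "\<dots> = ennreal (c * (2 * exp (1 / 2)))"
      by (simp only: ennreal_plus[symmetric] ennreal_mult[symmetric] that exp_ge_zero add_nonneg_nonneg mult_2)
    also have "exp (1 / 2 :: real) \<le> 2"
      using exp_bound_half[of "1 / 2 :: real"] by simp
    then have "ennreal (c * (2 * exp (1 / 2))) \<le> ennreal (4 * c)"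
      using that by (intro ennreal_leI) (simp add: mult_left_mono mult.commute)
    finally show ?thesis .
  qed
  have sq: "t\<^sup>2 \<le> 2 * (exp t + exp (- t))" for t :: real
  proof -
    have "t\<^sup>2 \<le> 2 * exp \<bar>t\<bar>" using exp_lower_Taylor_quadratic[of "\<bar>t\<bar>"] by auto
    also have "\<dots> \<le> 2 * (exp t + exp (- t))" by (cases "0 \<le> t") auto
    finally show ?thesis .
  qed
  have fourth: "t ^ 4 \<le> 64 * (exp t + exp (- t))" for t :: real
  proof -
    have "t\<^sup>2 \<le> 8 * exp (\<bar>t\<bar> / 2)"
      using exp_lower_Taylor_quadratic[of "\<bar>t\<bar> / 2"] by (auto simp: power_divide)
    then have "(t\<^sup>2)\<^sup>2 \<le> (8 * exp (\<bar>t\<bar> / 2))\<^sup>2" by (intro power_mono) auto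
    then have "t ^ 4 \<le> 64 * exp \<bar>t\<bar>"
      by (simp add: power_mult_distrib exp_double[symmetric])
    also have "\<dots> \<le> 64 * (exp t + exp (- t))" by (cases "0 \<le> t") auto
    finally show ?thesis .
  qed
  have "(\<integral>\<^sup>+ z. ennreal ((lin D a z)\<^sup>2) \<partial>gauss D) \<le> ennreal (4 * 2)"
    by (rule order_trans[OF nn_integral_mono mgf[of 2]]) (simp_all only: ennreal_leI sq zero_le_numeral)
  then show "(\<integral>\<^sup>+ z. ennreal ((lin D a z)\<^sup>2) \<partial>gauss D) \<le> 8" by simp
  have "(\<integral>\<^sup>+ z. ennreal ((lin D a z) ^ 4) \<partial>gauss D) \<le> ennreal (4 * 64)"
    by (rule order_trans[OF nn_integral_mono mgf[of 64]]) (simp_all only: ennreal_leI fourth zero_le_numeral)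
  then show "(\<integral>\<^sup>+ z. ennreal ((lin D a z) ^ 4) \<partial>gauss D) \<le> 256" by simp
qed

text \<open>Translation along \<open>a\<close> turns one level set into another, and by
  Cameron-Martin it preserves null sets. Hence one null level suffices, and it exists because a
  probability measure on the reals has only countably many atoms.\<close>

lemma gauss_hyperplane_null:
  assumes a: "(\<Sum>i<D. (a i)\<^sup>2) = 1"
  shows "AE z in gauss D. lin D a z \<noteq> c"
proof -
  have lin_meas [measurable]: "lin D a \<in> borel_measurable (gauss D)" by measurable
  let ?P = "distr (gauss D) borel (lin D a)"
  interpret P: prob_space ?P by (intro prob_space.prob_space_distr prob_space_gauss lin_meas)
  have shift: "AE z in gauss D. lin D a z \<noteq> b" if c': "AE z in gauss D. lin D a z \<noteq> b'" for b b'
  proof -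
    let ?\<phi> = "\<lambda>z. indicator {b'} (lin D a z) :: ennreal"
    let ?t = "b' - b"
    have "(\<integral>\<^sup>+ z. indicator {b} (lin D a z) \<partial>gauss D) = (\<integral>\<^sup>+ z. ?\<phi> (\<lambda>i\<in>{..<D}. z i + ?t * a i) \<partial>gauss D)"
    proof (intro nn_integral_cong)
      fix z
      have "lin D a (\<lambda>i\<in>{..<D}. z i + t * a i) = lin D a z + t * (\<Sum>i<D. (a i)\<^sup>2)" for t
        by (simp add: algebra_simps sum.distrib sum_distrib_left power2_eq_square)
      then show "indicator {b} (lin D a z) = ?\<phi> (\<lambda>i\<in>{..<D}. z i + ?t * a i)"
        using a by (auto simp: indicator_def)
    qed
    also have "\<dots> = (\<integral>\<^sup>+ z. ?\<phi> z * ennreal (exp (lin D (\<lambda>i. ?t * a i) z - (\<Sum>i<D. (?t * a i)\<^sup>2) / 2)) \<partial>gauss D)"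
      by (rule Cameron_Martin_gauss) measurable
    also have "\<dots> = (\<integral>\<^sup>+ z. 0 \<partial>gauss D)"
      using c' by (intro nn_integral_cong_AE) (auto elim!: eventually_mono)
    finally have "(\<integral>\<^sup>+ z. indicator {b} (lin D a z) \<partial>gauss D) = 0" by simp
    then have "AE z in gauss D. (indicator {b} (lin D a z) :: ennreal) = 0"
      by (subst (asm) nn_integral_0_iff_AE) simp_all
    then show ?thesis by (auto elim!: eventually_mono simp: indicator_def split: if_splits)
  qed
  have null: "AE z in gauss D. lin D a z \<noteq> b" if "measure ?P {b} = 0" for b
  proof -
    have "emeasure ?P {b} = 0" using that by (simp add: P.emeasure_eq_measure)
    then have "AE x in ?P. x \<noteq> b"
      by (intro AE_I[of _ _ "{b}"]) auto
    then show ?thesis by (subst (asm) AE_distr_iff) auto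
  qed
  have "\<exists>b. measure ?P {b} = 0"
  proof (rule ccontr)
    assume "\<not> ?thesis"
    then have "{x. measure ?P {x} \<noteq> 0} = UNIV" by auto
    with P.countable_support show False using uncountable_UNIV_real by simp
  qed
  then show ?thesis using null shift by blast
qed

lemma std_normal_moments:
  shows "has_bochner_integral std_normal_distribution (\<lambda>x. x\<^sup>2 - 1) 0"
    and "has_bochner_integral std_normal_distribution (\<lambda>x. (x\<^sup>2 - 1)\<^sup>2) 2"
proof -
  have 0: "has_bochner_integral lborel (\<lambda>x. std_normal_density x * x ^ (2 * 0)) 1"
    using std_normal_moment_even[of 0] by simp
  have 1: "has_bochner_integral lborel (\<lambda>x. std_normal_density x * x ^ (2 * 1)) 1"
    using std_normal_moment_even[of 1] by (simp add: fact_numeral)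
  have 2: "has_bochner_integral lborel (\<lambda>x. std_normal_density x * x ^ (2 * 2)) 3"
    using std_normal_moment_even[of 2] by (simp add: fact_numeral)
  have "has_bochner_integral lborel (\<lambda>x. std_normal_density x * (x\<^sup>2 - 1)) (1 - 1)"
    using has_bochner_integral_diff[OF 1 0] by (simp add: algebra_simps)
  then show "has_bochner_integral std_normal_distribution (\<lambda>x. x\<^sup>2 - 1) 0"
    by (intro has_bochner_integral_density) auto
  have "has_bochner_integral lborel (\<lambda>x. std_normal_density x * (x\<^sup>2 - 1)\<^sup>2) (3 - 2 * 1 + 1)"
  proof -
    have "(x\<^sup>2 - 1)\<^sup>2 = x ^ 4 - 2 * x\<^sup>2 + 1" for x :: real
      by (simp add: power2_eq_square power4_eq_xxxx algebra_simps)
    moreover have "has_bochner_integral lborel (\<lambda>x. std_normal_density x * x ^ (2 * 2)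
        - 2 * (std_normal_density x * x ^ (2 * 1)) + std_normal_density x * x ^ (2 * 0)) (3 - 2 * 1 + 1)"
      by (intro has_bochner_integral_add has_bochner_integral_diff has_bochner_integral_mult_right 0 1 2)
    ultimately show ?thesis by (simp add: distrib_left right_diff_distrib mult.left_commute)
  qed
  then show "has_bochner_integral std_normal_distribution (\<lambda>x. (x\<^sup>2 - 1)\<^sup>2) 2"
    by (intro has_bochner_integral_density) auto
qed

lemma gauss_sqnorm_variance:
  "(\<integral>\<^sup>+ z. ennreal (((\<Sum>i<D. (z i)\<^sup>2) - real D)\<^sup>2) \<partial>gauss D) = ennreal (2 * real D)"
proof -
  define s where "s = (\<lambda>x::real. x\<^sup>2 - 1)"
  have s_int: "integrable std_normal_distribution s" "(\<integral>x. s x \<partial>std_normal_distribution) = 0"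
    "integrable std_normal_distribution (\<lambda>x. (s x)\<^sup>2)" "(\<integral>x. (s x)\<^sup>2 \<partial>std_normal_distribution) = 2"
    using std_normal_moments by (simp_all add: s_def has_bochner_integral_iff)
  \<comment> \<open>The centred squares of distinct coordinates are uncorrelated: each product is
    written as a product over all coordinates with factor 1 elsewhere, so that the integral
    factorises.\<close>
  have pair: "has_bochner_integral (gauss D) (\<lambda>z. s (z i) * s (z j)) (if i = j then 2 else 0)"
    if "i < D" "j < D" for i j
  proof (cases "i = j")
    case True
    let ?f = "\<lambda>k x. if k = i then (s x)\<^sup>2 else 1"
    have int: "integrable std_normal_distribution (?f k)" for k
      using s_int(3) prob_space.finite_measure[OF prob_space_std_normal]
      by (cases "k = i") (auto intro!: finite_measure.integrable_const)
    have eq: "(\<Prod>k<D. ?f k (z k)) = s (z i) * s (z j)" for z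
      using that True by (simp add: prod.delta power2_eq_square)
    have "integrable (gauss D) (\<lambda>z. \<Prod>k<D. ?f k (z k))"
      by (intro gauss.product_integrable_prod int) simp
    moreover have "(\<integral>z. (\<Prod>k<D. ?f k (z k)) \<partial>gauss D) = (\<Prod>k<D. \<integral>x. ?f k x \<partial>std_normal_distribution)"
      by (intro gauss.product_integral_prod int) simp
    moreover have "(\<integral>x. ?f k x \<partial>std_normal_distribution) = (if k = i then 2 else 1)" for k
      using s_int(4) prob_space.prob_space[OF prob_space_std_normal] by simp
    ultimately show ?thesis
      unfolding eq using that True by (simp add: has_bochner_integral_iff prod.delta)
  next
    case False
    let ?f = "\<lambda>k x. if k = i \<or> k = j then s x else 1"
    have int: "integrable std_normal_distribution (?f k)" for k
      using s_int(1) prob_space.finite_measure[OF prob_space_std_normal]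
      by (cases "k = i \<or> k = j") (auto intro!: finite_measure.integrable_const)
    have eq: "(\<Prod>k<D. ?f k (z k)) = s (z i) * s (z j)" for z
    proof -
      have "(\<Prod>k<D. ?f k (z k)) = (\<Prod>k\<in>{i, j}. ?f k (z k))"
        by (rule prod.mono_neutral_right) (use that in auto)
      then show ?thesis using False by simp
    qed
    have "integrable (gauss D) (\<lambda>z. \<Prod>k<D. ?f k (z k))"
      by (intro gauss.product_integrable_prod int) simp
    moreover have "(\<integral>z. (\<Prod>k<D. ?f k (z k)) \<partial>gauss D) = (\<Prod>k<D. \<integral>x. ?f k x \<partial>std_normal_distribution)"
      by (intro gauss.product_integral_prod int) simp
    moreover have "(\<Prod>k<D. \<integral>x. ?f k x \<partial>std_normal_distribution) = 0"
      using that s_int(2) by (intro prod_zero) (auto intro!: bexI[of _ i])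
    ultimately show ?thesis
      unfolding eq using False by (simp add: has_bochner_integral_iff)
  qed
  have "has_bochner_integral (gauss D) (\<lambda>z. \<Sum>i<D. \<Sum>j<D. s (z i) * s (z j)) (\<Sum>i<D. \<Sum>j<D. if i = j then 2 else 0)"
    by (intro has_bochner_integral_sum pair) auto
  moreover have "(\<Sum>i<D. \<Sum>j<D. s (z i) * s (z j)) = ((\<Sum>i<D. (z i)\<^sup>2) - real D)\<^sup>2" for z
    by (simp add: s_def sum_subtractf power2_eq_square flip: sum_product)
  ultimately have "has_bochner_integral (gauss D) (\<lambda>z. ((\<Sum>i<D. (z i)\<^sup>2) - real D)\<^sup>2) (2 * real D)"
    by (simp add: sum.delta' mult.commute)
  then show ?thesis
    by (subst nn_integral_eq_integral) (auto simp: has_bochner_integral_iff)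
qed

text \<open>AM-GM with balance \<open>sqrt D\<close> replaces Cauchy-Schwarz: variance
  \<open>2D\<close> gives \<open>(1/2 + 1) * sqrt D\<close>.\<close>

lemma gauss_sqnorm_deviation:
  assumes "0 < D"
  shows "(\<integral>\<^sup>+ z. ennreal \<bar>(\<Sum>i<D. (z i)\<^sup>2) - real D\<bar> \<partial>gauss D) \<le> ennreal (2 * sqrt (real D))"
proof -
  let ?X = "\<lambda>z. (\<Sum>i<D. (z i)\<^sup>2) - real D"
  have D: "0 < sqrt (real D)" using assms by simp
  have amgm: "\<bar>x\<bar> \<le> sqrt (real D) / 2 + 1 / (2 * sqrt (real D)) * x\<^sup>2" for x
  proof -
    have "2 * \<bar>x\<bar> * sqrt (real D) \<le> (sqrt (real D))\<^sup>2 + x\<^sup>2"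
      using sum_squares_bound[of "\<bar>x\<bar>" "sqrt (real D)"] by simp
    then show ?thesis using D by (simp add: field_simps power2_eq_square)
  qed
  have "(\<integral>\<^sup>+ z. ennreal \<bar>?X z\<bar> \<partial>gauss D)
      \<le> (\<integral>\<^sup>+ z. ennreal (sqrt (real D) / 2) + ennreal (1 / (2 * sqrt (real D))) * ennreal ((?X z)\<^sup>2) \<partial>gauss D)"
    using D by (intro nn_integral_mono, subst ennreal_mult[symmetric], simp, simp, subst ennreal_plus[symmetric])
      (auto intro!: ennreal_leI order_trans[OF amgm] simp del: ennreal_plus)
  also have "\<dots> = ennreal (sqrt (real D) / 2) + ennreal (1 / (2 * sqrt (real D))) * ennreal (2 * real D)"
    by (subst nn_integral_add) (auto simp: nn_integral_cmult gauss_sqnorm_variance prob_space.emeasure_space_1[OF prob_space_gauss])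
  also have "\<dots> = ennreal (sqrt (real D) / 2 + 1 / (2 * sqrt (real D)) * (2 * real D))"
    by (subst ennreal_mult[symmetric], simp, simp, subst ennreal_plus[symmetric]) auto
  also have "\<dots> \<le> ennreal (2 * sqrt (real D))"
    using D by (intro ennreal_leI) (simp add: real_div_sqrt)
  finally show ?thesis .
qed

section \<open>Random vectors with explicit carriers\<close>

lemma space_borel_vec [simp]: "space (borel_vec n) = carrier_vec n"
  by (simp add: borel_vec_def)

lemma measurable_borel_vecI:
  assumes "\<And>x. x \<in> space M \<Longrightarrow> F x \<in> carrier_vec n"
    and "\<And>i. i < n \<Longrightarrow> (\<lambda>x. F x $ i) \<in> borel_measurable M"
  shows "F \<in> M \<rightarrow>\<^sub>M borel_vec n"
  unfolding borel_vec_def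
  by (rule measurable_vimage_algebra2) (use assms in \<open>auto intro!: measurable_restrict\<close>)

lemma borel_vec_component:
  assumes "i < n"
  shows "(\<lambda>w. w $ i) \<in> borel_measurable (borel_vec n)"
proof -
  have "(\<lambda>w. \<lambda>i\<in>{..<n}. w $ i) \<in> borel_vec n \<rightarrow>\<^sub>M (\<Pi>\<^sub>M i\<in>{..<n}. (borel :: real measure))"
    unfolding borel_vec_def by (rule measurable_vimage_algebra1) (auto simp: space_PiM)
  from measurable_compose[OF this measurable_component_singleton[of i]] show ?thesis
    using assms by simp
qed

lemma borel_vec_scalar_prod:
  assumes "dim_vec u = n"
  shows "(\<lambda>w. w \<bullet> u) \<in> borel_measurable (borel_vec n)"
  unfolding scalar_prod_def using assms
  by (intro borel_measurable_sum borel_measurable_times borel_vec_component borel_measurable_const) auto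

lemma measurable_vec_gauss: "(\<lambda>z. vec D z) \<in> gauss D \<rightarrow>\<^sub>M borel_vec D"
  by (rule measurable_borel_vecI) auto

lemma nn_integral_std_gaussian_vec:
  assumes "h \<in> borel_measurable (borel_vec D)"
  shows "(\<integral>\<^sup>+ z. h z \<partial>std_gaussian_vec D) = (\<integral>\<^sup>+ z. h (vec D z) \<partial>gauss D)"
  unfolding std_gaussian_vec_def using assms by (subst nn_integral_distr[OF measurable_vec_gauss]) auto

lemma sets_std_gaussian_vec [measurable_cong]: "sets (std_gaussian_vec D) = sets (borel_vec D)"
  by (simp add: std_gaussian_vec_def)

lemma space_std_gaussian_vec [simp]: "space (std_gaussian_vec D) = carrier_vec D"
  by (simp add: std_gaussian_vec_def)

lemma vec_scalar_prod: "dim_vec u = D \<Longrightarrow> vec D z \<bullet> u = lin D (\<lambda>i. u $ i) z"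
  by (simp add: scalar_prod_def lessThan_atLeast0 mult.commute)

lemma sqnorm_eq_sum: "sqnorm w = (\<Sum>i<dim_vec w. (w $ i)\<^sup>2)"
  by (simp add: sqnorm_def scalar_prod_def lessThan_atLeast0 power2_eq_square)

section \<open>Singular systems\<close>

locale singular_decomposition =
  fixes A :: "real mat" and D P :: nat and lam :: "nat \<Rightarrow> real" and u v :: "nat \<Rightarrow> real vec"
  assumes A: "A \<in> carrier_mat D P" and sing: "singular_system A lam u v"
begin

lemma lam_pos: "i \<in> {1..D} \<Longrightarrow> 0 < lam i"
  and u_carrier: "i \<in> {1..D} \<Longrightarrow> u i \<in> carrier_vec D"
  and v_carrier: "i \<in> {1..D} \<Longrightarrow> v i \<in> carrier_vec P"
  and A_v: "i \<in> {1..D} \<Longrightarrow> A *\<^sub>v v i = lam i \<cdot>\<^sub>v u i"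
  and A_u: "i \<in> {1..D} \<Longrightarrow> A\<^sup>T *\<^sub>v u i = lam i \<cdot>\<^sub>v v i"
  and u_orth: "i \<in> {1..D} \<Longrightarrow> j \<in> {1..D} \<Longrightarrow> u i \<bullet> u j = (if i = j then 1 else 0)"
  and v_orth: "i \<in> {1..D} \<Longrightarrow> j \<in> {1..D} \<Longrightarrow> v i \<bullet> v j = (if i = j then 1 else 0)"
  and lam_antimono: "i \<in> {1..D} \<Longrightarrow> j \<in> {1..D} \<Longrightarrow> i \<le> j \<Longrightarrow> lam j \<le> lam i"
  using A sing unfolding singular_system_def by auto

text \<open>The \<open>D\<close> orthonormal vectors form the columns of a square matrix, and a left
  inverse of a square matrix is also a right inverse.\<close>

lemma u_completeness:
  assumes "l < D" "m < D"
  shows "(\<Sum>i=1..D. u i $ l * u i $ m) = (if l = m then 1 else 0)"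
proof -
  define U where "U = mat D D (\<lambda>(l, k). u (Suc k) $ l)"
  have U: "U \<in> carrier_mat D D" by (simp add: U_def)
  have "U\<^sup>T * U = 1\<^sub>m D"
  proof (rule eq_matI)
    fix i j assume ij: "i < dim_row (1\<^sub>m D)" "j < dim_col (1\<^sub>m D)"
    then have c: "Suc i \<in> {1..D}" "Suc j \<in> {1..D}" by auto
    then have "dim_vec (u (Suc i)) = D" "dim_vec (u (Suc j)) = D" using u_carrier by auto
    then have "(U\<^sup>T * U) $$ (i, j) = u (Suc i) \<bullet> u (Suc j)"
      using ij by (simp add: U_def scalar_prod_def)
    then show "(U\<^sup>T * U) $$ (i, j) = 1\<^sub>m D $$ (i, j)"
      using ij u_orth[OF c] by simp
  qed (simp_all add: U_def)
  then have "U * U\<^sup>T = 1\<^sub>m D"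
    using mat_mult_left_right_inverse[of "U\<^sup>T" D U] U by auto
  then have "(U * U\<^sup>T) $$ (l, m) = 1\<^sub>m D $$ (l, m)" by simp
  moreover have "(U * U\<^sup>T) $$ (l, m) = (\<Sum>k<D. u (Suc k) $ l * u (Suc k) $ m)"
    using assms by (simp add: U_def scalar_prod_def lessThan_atLeast0)
  moreover have "\<dots> = (\<Sum>i=1..D. u i $ l * u i $ m)"
    by (simp add: One_nat_def sum.atLeast1_atMost_eq)
  ultimately show ?thesis using assms by simp
qed

lemma parseval:
  assumes "w \<in> carrier_vec D"
  shows "sqnorm w = (\<Sum>i=1..D. (w \<bullet> u i)\<^sup>2)"
proof -
  have dim: "dim_vec w = D" using assms by simp
  have "(\<Sum>i=1..D. (w \<bullet> u i)\<^sup>2) = (\<Sum>i=1..D. \<Sum>l<D. \<Sum>m<D. w $ l * w $ m * (u i $ l * u i $ m))"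
  proof (rule sum.cong[OF refl])
    fix i assume "i \<in> {1..D}"
    then have "dim_vec (u i) = D" using u_carrier by auto
    then show "(w \<bullet> u i)\<^sup>2 = (\<Sum>l<D. \<Sum>m<D. w $ l * w $ m * (u i $ l * u i $ m))"
      by (simp add: scalar_prod_def power2_eq_square sum_product lessThan_atLeast0 mult_ac)
  qed
  also have "\<dots> = (\<Sum>l<D. \<Sum>m<D. w $ l * w $ m * (\<Sum>i=1..D. u i $ l * u i $ m))"
    unfolding sum_distrib_left
    by (subst sum.swap, rule sum.cong[OF refl], rule sum.swap)
  also have "\<dots> = (\<Sum>l<D. \<Sum>m<D. if l = m then w $ l * w $ m else 0)"
    by (intro sum.cong refl) (simp add: u_completeness)
  also have "\<dots> = sqnorm w"
    by (simp add: sqnorm_eq_sum dim power2_eq_square)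
  finally show ?thesis by simp
qed

lemma spectral_apply_carrier: "y \<in> carrier_vec D \<Longrightarrow> spectral_apply lam u h y \<in> carrier_vec D"
  by (simp add: spectral_apply_def)

lemma spectral_apply_component:
  assumes y: "y \<in> carrier_vec D" and j: "j \<in> {1..D}"
  shows "spectral_apply lam u h y \<bullet> u j = h ((lam j)\<^sup>2) * (y \<bullet> u j)"
proof -
  have "dim_vec (u j) = D" "dim_vec y = D" using u_carrier[OF j] y by auto
  then have "spectral_apply lam u h y \<bullet> u j
      = (\<Sum>l<D. \<Sum>i=1..D. h ((lam i)\<^sup>2) * (y \<bullet> u i) * (u i $ l * u j $ l))"
    by (simp add: scalar_prod_def[of _ "u j"] spectral_apply_def sum_distrib_right lessThan_atLeast0 mult.assoc)
  also have "\<dots> = (\<Sum>i=1..D. h ((lam i)\<^sup>2) * (y \<bullet> u i) * (\<Sum>l<D. u i $ l * u j $ l))"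
    unfolding sum_distrib_left by (rule sum.swap)
  also have "\<dots> = (\<Sum>i=1..D. h ((lam i)\<^sup>2) * (y \<bullet> u i) * (if i = j then 1 else 0))"
    using \<open>dim_vec (u j) = D\<close> j
    by (intro sum.cong refl arg_cong[where f = "(*) _"])
      (simp add: u_orth[symmetric] scalar_prod_def lessThan_atLeast0)
  also have "\<dots> = h ((lam j)\<^sup>2) * (y \<bullet> u j)"
    using j by (simp add: if_distrib[of "(*) _"] cong: if_cong)
  finally show ?thesis .
qed

lemma A_mult_component:
  assumes "f \<in> carrier_vec P" "i \<in> {1..D}"
  shows "(A *\<^sub>v f) \<bullet> u i = lam i * (f \<bullet> v i)"
proof -
  have "(A *\<^sub>v f) \<bullet> u i = u i \<bullet> (A *\<^sub>v f)"
    using assms u_carrier A by (intro comm_scalar_prod[of _ D]) auto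
  also have "\<dots> = (A\<^sup>T *\<^sub>v u i) \<bullet> f"
    using transpose_vec_mult_scalar[OF A assms(1) u_carrier[OF assms(2)]] by simp
  also have "\<dots> = lam i * (v i \<bullet> f)"
    unfolding A_u[OF assms(2)] using v_carrier[OF assms(2)] assms(1) by simp
  finally show ?thesis
    using comm_scalar_prod[OF v_carrier[OF assms(2)] assms(1)] by simp
qed

lemma
  shows pinv_carrier: "pinv A \<in> carrier_mat P D"
    and mult_pinv: "w \<in> carrier_vec D \<Longrightarrow> A *\<^sub>v (pinv A *\<^sub>v w) = w"
proof -
  let ?G = "A * A\<^sup>T"
  have G: "?G \<in> carrier_mat D D" using A by auto
  \<comment> \<open>A kernel vector \<open>w\<close> of \<open>A A^T\<close> would have
    \<open>lam i ^ 2 * <w, u i> = 0\<close> for every \<open>i\<close>, hence \<open>w = 0\<close>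
    by Parseval. So the inverse in \<open>pinv\<close> is genuine.\<close>
  have "Determinant.det ?G \<noteq> 0"
  proof
    assume "Determinant.det ?G = 0"
    then obtain w where w: "w \<in> carrier_vec D" "w \<noteq> 0\<^sub>v D" "?G *\<^sub>v w = 0\<^sub>v D"
      using det_0_iff_vec_prod_zero[OF G] by blast
    have AT: "A\<^sup>T *\<^sub>v w \<in> carrier_vec P" using A w(1) by (intro mult_mat_vec_carrier[of _ _ D]) auto
    have "w \<bullet> u i = 0" if i: "i \<in> {1..D}" for i
    proof -
      have "0 = (?G *\<^sub>v w) \<bullet> u i" using w(3) u_carrier[OF i] by simp
      also have "?G *\<^sub>v w = A *\<^sub>v (A\<^sup>T *\<^sub>v w)"
        using A w(1) by (intro assoc_mult_mat_vec) auto
      also have "\<dots> \<bullet> u i = lam i * ((A\<^sup>T *\<^sub>v w) \<bullet> v i)"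
        by (rule A_mult_component[OF AT i])
      also have "(A\<^sup>T *\<^sub>v w) \<bullet> v i = w \<bullet> (A *\<^sub>v v i)"
        by (rule transpose_vec_mult_scalar[OF A v_carrier[OF i] w(1)])
      also have "\<dots> = lam i * (w \<bullet> u i)"
        unfolding A_v[OF i] using w(1) u_carrier[OF i] by simp
      finally show ?thesis using lam_pos[OF i] by simp
    qed
    then have "sqnorm w = 0" using parseval[OF w(1)] by simp
    then have "\<forall>l<D. w $ l = 0"
      using w(1) unfolding sqnorm_eq_sum by (subst (asm) sum_nonneg_eq_0_iff) auto
    then have "w = 0\<^sub>v D" using w(1) by (intro eq_vecI) auto
    with w(2) show False by simp
  qed
  then have unit: "?G \<in> Units (ring_mat TYPE(real) D ())"
    by (rule det_non_zero_imp_unit[OF G])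
  then obtain B where B: "mat_inverse ?G = Some B"
    using mat_inverse(1)[OF G, where b = "()"] by (cases "mat_inverse ?G") auto
  then have GB: "?G * B = 1\<^sub>m D" "B \<in> carrier_mat D D"
    using mat_inverse(2)[OF G B] by auto
  have p: "pinv A = A\<^sup>T * B" by (simp add: pinv_def B)
  show carrier: "pinv A \<in> carrier_mat P D" unfolding p using A GB(2) by auto
  assume w: "w \<in> carrier_vec D"
  have "A *\<^sub>v (pinv A *\<^sub>v w) = (A * pinv A) *\<^sub>v w"
    using A carrier w by (simp add: assoc_mult_mat_vec)
  also have "A * pinv A = ?G * B"
    unfolding p using A GB(2) by (intro assoc_mult_mat[symmetric]) auto
  finally show "A *\<^sub>v (pinv A *\<^sub>v w) = w" using GB(1) w by simp
qed

lemma dims: "dim_row A = D" "dim_col A = P"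
  using A by auto

end

section \<open>Measurability of the stopped estimator\<close>

text \<open>By continuity and compactness, the level is reached iff for every \<open>n\<close> some
  rational time gets below it up to \<open>1 / (n + 1)\<close>, which is a countable
  condition.\<close>

lemma hitting_measurable:
  fixes f :: "'a \<Rightarrow> real \<Rightarrow> real"
  assumes meas: "\<And>t. t \<in> {0..b} \<Longrightarrow> (\<lambda>y. f y t) \<in> borel_measurable M"
    and cont: "\<And>y. y \<in> space M \<Longrightarrow> continuous_on {0..b} (f y)" and b: "0 \<le> b"
  shows "{y \<in> space M. \<exists>t\<in>{0..b}. f y t \<le> \<kappa>} \<in> sets M"
proof -
  let ?Q = "\<rat> \<inter> {0..b} :: real set"
  have dense: "\<exists>q\<in>?Q. \<bar>q - t\<bar> < \<epsilon>" if t: "t \<in> {0..b}" and e: "0 < \<epsilon>" for t \<epsilon> :: real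
  proof -
    consider "b = 0" | "0 < b" "t < b" | "0 < b" "t = b" using t b by fastforce
    then show ?thesis
    proof cases
      case 1
      then show ?thesis using t e by (intro bexI[of _ 0]) auto
    next
      case 2
      then obtain q where "q \<in> \<rat>" "t < q" "q < min b (t + \<epsilon>)"
        using Rats_dense_in_real[of t "min b (t + \<epsilon>)"] e by auto
      then show ?thesis using t by (intro bexI[of _ q]) auto
    next
      case 3
      then obtain q where "q \<in> \<rat>" "max 0 (b - \<epsilon>) < q" "q < b"
        using Rats_dense_in_real[of "max 0 (b - \<epsilon>)" b] e by auto
      then show ?thesis using 3 by (intro bexI[of _ q]) auto
    qed
  qed
  have "(\<exists>t\<in>{0..b}. f y t \<le> \<kappa>) \<longleftrightarrow> (\<forall>n. \<exists>q\<in>?Q. f y q < \<kappa> + 1 / real (Suc n))"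
    if y: "y \<in> space M" for y
  proof
    assume "\<exists>t\<in>{0..b}. f y t \<le> \<kappa>"
    then obtain t where t: "t \<in> {0..b}" "f y t \<le> \<kappa>" by blast
    show "\<forall>n. \<exists>q\<in>?Q. f y q < \<kappa> + 1 / real (Suc n)"
    proof
      fix n
      have e: "0 < 1 / real (Suc n)" by simp
      obtain \<delta> where \<delta>: "0 < \<delta>" "\<And>s. s \<in> {0..b} \<Longrightarrow> dist s t < \<delta> \<Longrightarrow> dist (f y s) (f y t) < 1 / real (Suc n)"
        using cont[OF y] t(1) e unfolding continuous_on_iff by meson
      obtain q where "q \<in> ?Q" "\<bar>q - t\<bar> < \<delta>" using dense[OF t(1) \<delta>(1)] by blast
      then show "\<exists>q\<in>?Q. f y q < \<kappa> + 1 / real (Suc n)"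
        using \<delta>(2)[of q] t(2) by (intro bexI[of _ q]) (auto simp: dist_real_def)
    qed
  next
    assume *: "\<forall>n. \<exists>q\<in>?Q. f y q < \<kappa> + 1 / real (Suc n)"
    obtain t where t: "t \<in> {0..b}" "\<And>s. s \<in> {0..b} \<Longrightarrow> f y t \<le> f y s"
      using continuous_attains_inf[OF compact_Icc _ cont[OF y]] b by fastforce
    have "f y t \<le> \<kappa> + e" if e: "0 < e" for e
    proof -
      obtain n where "1 / real (Suc n) < e" by (rule nat_approx_posE[OF e])
      then show ?thesis using * t(2) by (meson IntD2 less_eq_real_def order_trans add_left_mono less_le_trans)
    qed
    then show "\<exists>t\<in>{0..b}. f y t \<le> \<kappa>" using t(1) field_le_epsilon by blast
  qed
  then have "{y \<in> space M. \<exists>t\<in>{0..b}. f y t \<le> \<kappa>}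
      = {y \<in> space M. \<forall>n. \<exists>q\<in>?Q. f y q < \<kappa> + 1 / real (Suc n)}" by auto
  moreover have "{y \<in> space M. \<exists>q\<in>?Q. f y q < e} \<in> sets M" for e
  proof -
    have "(\<Union>q\<in>?Q. {y \<in> space M. f y q < e}) \<in> sets M"
      by (intro sets.countable_UN' countable_Int1 countable_rat image_subsetI borel_measurable_less
          meas borel_measurable_const) auto
    also have "(\<Union>q\<in>?Q. {y \<in> space M. f y q < e}) = {y \<in> space M. \<exists>q\<in>?Q. f y q < e}" by blast
    finally show ?thesis .
  qed
  then have "{y \<in> space M. \<forall>n. \<exists>q\<in>?Q. f y q < \<kappa> + 1 / real (Suc n)} \<in> sets M"
    by (intro sets.sets_Collect_countable_All)
  ultimately show ?thesis by simp
qed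

text \<open>The hitting set is closed, so its infimum belongs to it. A value strictly below
  \<open>\<kappa>\<close> at a positive time would persist slightly earlier and contradict
  minimality.\<close>

lemma Inf_hitting:
  fixes f :: "real \<Rightarrow> real"
  assumes cont: "continuous_on {0..b} f" and ex: "\<exists>t\<in>{0..b}. f t \<le> \<kappa>"
  defines "\<tau> \<equiv> Inf {t\<in>{0..b}. f t \<le> \<kappa>}"
  shows "\<tau> \<in> {0..b}" "f \<tau> \<le> \<kappa>" "\<And>t. t \<in> {0..b} \<Longrightarrow> f t \<le> \<kappa> \<Longrightarrow> \<tau> \<le> t" "\<tau> = 0 \<or> f \<tau> = \<kappa>"
proof -
  let ?S = "{t\<in>{0..b}. f t \<le> \<kappa>}"
  have bdd: "bdd_below ?S" by (rule bdd_belowI[of _ 0]) auto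
  have "closed ?S"
    using continuous_closed_preimage[OF cont closed_atLeastAtMost closed_atMost[of \<kappa>]]
    by (simp add: vimage_def Int_def)
  then have "\<tau> \<in> ?S"
    unfolding \<tau>_def using closed_contains_Inf[OF _ bdd] ex by blast
  then show 1: "\<tau> \<in> {0..b}" "f \<tau> \<le> \<kappa>" by auto
  show 2: "\<tau> \<le> t" if "t \<in> {0..b}" "f t \<le> \<kappa>" for t
    unfolding \<tau>_def using that bdd by (intro cInf_lower) auto
  show "\<tau> = 0 \<or> f \<tau> = \<kappa>"
  proof (rule ccontr)
    assume "\<not> (\<tau> = 0 \<or> f \<tau> = \<kappa>)"
    then have "0 < \<tau>" "f \<tau> < \<kappa>" using 1 by auto
    then obtain \<delta> where \<delta>: "0 < \<delta>" "\<And>s. s \<in> {0..b} \<Longrightarrow> dist s \<tau> < \<delta> \<Longrightarrow> dist (f s) (f \<tau>) < \<kappa> - f \<tau>"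
      using cont 1(1) unfolding continuous_on_iff by (metis diff_gt_0_iff_gt)
    define s where "s = max (\<tau> / 2) (\<tau> - \<delta> / 2)"
    have "s \<in> {0..b}" "s < \<tau>" "dist s \<tau> < \<delta>"
      using 1(1) \<open>0 < \<tau>\<close> \<delta>(1) by (auto simp: s_def dist_real_def max_def field_simps)
    then have "f s \<le> \<kappa>" using \<delta>(2)[of s] by (auto simp: dist_real_def abs_less_iff)
    then show False using 2[of s] \<open>s \<in> {0..b}\<close> \<open>s < \<tau>\<close> by simp
  qed
qed

text \<open>On the event that the level is reached, \<open>\<tau> \<le> s\<close> means that it is
  reached by time \<open>s\<close>; off this event the infimum is the fixed number
  \<open>Inf {}\<close>.\<close>

lemma Inf_hitting_measurable:
  fixes f :: "'a \<Rightarrow> real \<Rightarrow> real"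
  assumes meas: "\<And>t. t \<in> {0..b} \<Longrightarrow> (\<lambda>y. f y t) \<in> borel_measurable M"
    and cont: "\<And>y. y \<in> space M \<Longrightarrow> continuous_on {0..b} (f y)" and b: "0 \<le> b"
  shows "(\<lambda>y. Inf {t\<in>{0..b}. f y t \<le> \<kappa>}) \<in> borel_measurable M"
proof (subst borel_measurable_iff_le, intro allI)
  fix s
  define E where "E = {y \<in> space M. \<exists>t\<in>{0..b}. f y t \<le> \<kappa>}"
  define \<tau> where "\<tau> y = Inf {t\<in>{0..b}. f y t \<le> \<kappa>}" for y
  define H where "H = (if 0 \<le> s then {y \<in> space M. \<exists>t\<in>{0..min s b}. f y t \<le> \<kappa>} else {})"
  have E: "E \<in> sets M" unfolding E_def by (rule hitting_measurable[OF meas cont b])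
  have H: "H \<in> sets M"
  proof (cases "0 \<le> s")
    case True
    have "{y \<in> space M. \<exists>t\<in>{0..min s b}. f y t \<le> \<kappa>} \<in> sets M"
      by (rule hitting_measurable) (use True b in \<open>auto intro!: meas intro: continuous_on_subset[OF cont]\<close>)
    then show ?thesis using True by (simp add: H_def)
  qed (simp add: H_def)
  have "\<tau> y \<le> s \<longleftrightarrow> y \<in> H" if "y \<in> E" for y
  proof -
    from that have "y \<in> space M" "\<exists>t\<in>{0..b}. f y t \<le> \<kappa>" by (auto simp: E_def)
    note inf = Inf_hitting(1-3)[OF cont[OF this(1)] this(2), folded \<tau>_def]
    show ?thesis
    proof
      assume "\<tau> y \<le> s"
      then show "y \<in> H" using inf(1,2) \<open>y \<in> space M\<close> by (auto simp: H_def)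
    next
      assume "y \<in> H"
      then obtain t where "t \<in> {0..b}" "t \<le> s" "f y t \<le> \<kappa>" by (auto simp: H_def split: if_splits)
      then show "\<tau> y \<le> s" using inf(3) by (meson order_trans)
    qed
  qed
  moreover have "\<tau> y = Inf {}" if "y \<in> space M - E" for y
    unfolding \<tau>_def using that by (intro arg_cong[where f = Inf]) (auto simp: E_def)
  moreover have "H \<subseteq> E" by (auto simp: H_def E_def)
  moreover have "E \<subseteq> space M" by (auto simp: E_def)
  ultimately have "y \<in> space M \<and> \<tau> y \<le> s \<longleftrightarrow> y \<in> H \<union> (if Inf {} \<le> s then space M - E else {})" for y
    by (cases "y \<in> E") auto
  then have "{y \<in> space M. \<tau> y \<le> s} = H \<union> (if Inf {} \<le> s then space M - E else {})"
    by (simp only: set_eq_iff mem_Collect_eq simp_thms)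
  then show "{y \<in> space M. Inf {t\<in>{0..b}. f y t \<le> \<kappa>} \<le> s} \<in> sets M"
    using H E unfolding \<tau>_def by auto
qed

text \<open>A telescoping sum: full increments before \<open>k\<close>, a fraction of the
  \<open>k\<close>-th, none later. At \<open>t = 0\<close> truncated subtraction gives
  \<open>k = 0\<close> and both sides are \<open>q 0\<close>.\<close>

lemma interpolation_clamp01:
  fixes q :: "nat \<Rightarrow> real poly"
  assumes "0 \<le> t" "t \<le> real n"
  defines "k \<equiv> nat \<lceil>t\<rceil> - 1"
  shows "Polynomial.smult (1 - (t - real k)) (q k) + Polynomial.smult (t - real k) (q (Suc k))
    = q 0 + (\<Sum>j<n. Polynomial.smult (clamp01 t j) (q (Suc j) - q j))"
proof (cases "t = 0")
  case True
  then show ?thesis by (simp add: k_def clamp01_def)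
next
  case False
  then have k: "real k < t" "t \<le> real (Suc k)"
    using assms(1) unfolding k_def by linarith+
  then have "k < n" using assms(2) by linarith
  have one: "clamp01 t j = 1" if "j < k" for j
  proof -
    have "real j + 1 \<le> real k" using that by linarith
    then show ?thesis using k by (simp add: clamp01_def)
  qed
  have zero: "clamp01 t j = 0" if "Suc k \<le> j" for j
  proof -
    have "real (Suc k) \<le> real j" using that by linarith
    then show ?thesis using k by (simp add: clamp01_def)
  qed
  have "(\<Sum>j<n. Polynomial.smult (clamp01 t j) (q (Suc j) - q j))
      = (\<Sum>j<Suc k. Polynomial.smult (clamp01 t j) (q (Suc j) - q j))"
    by (rule sum.mono_neutral_right) (use \<open>k < n\<close> zero in auto)
  also have "\<dots> = (\<Sum>j<k. q (Suc j) - q j) + Polynomial.smult (clamp01 t k) (q (Suc k) - q k)"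
    by (simp add: one)
  also have "(\<Sum>j<k. q (Suc j) - q j) = q k - q 0" by (rule sum_lessThan_telescope)
  also have "clamp01 t k = t - real k" using k by (simp add: clamp01_def)
  finally show ?thesis
    by (simp add: smult_diff_left smult_diff_right smult_add_left algebra_simps)
qed

section \<open>The conjugate gradient estimator in spectral coordinates\<close>

context singular_decomposition
begin

abbreviation "nodes \<equiv> (\<lambda>i. (lam i)\<^sup>2)"
abbreviation "weights y \<equiv> (\<lambda>i. (y \<bullet> u i)\<^sup>2)"
abbreviation "ipy y \<equiv> ip D nodes (weights y)"
abbreviation "basis y \<equiv> krylov_basis D nodes (weights y)"
abbreviation "dd \<equiv> card (lam ` {1..D})"

lemma weighted_nodes_weights: "weighted_nodes D (weights y)"
  by unfold_locales simp

lemma sqnorm_spectral_apply: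
  assumes "y \<in> carrier_vec D"
  shows "sqnorm (spectral_apply lam u (poly q) y) = ipy y q q"
  unfolding parseval[OF spectral_apply_carrier[OF assms]] ip_def
  by (intro sum.cong refl) (simp add: spectral_apply_component[OF assms] power2_eq_square mult_ac)

lemma cg_poly_eq:
  assumes "y \<in> carrier_vec D"
  shows "cg_poly lam u y k =
    (if \<forall>j<k. ipy y (basis y j) (basis y j) \<noteq> 0
     then cg_residual D nodes (weights y) k (\<lambda>_. 1) else 1)"
proof -
  have "is_cg_minimiser lam u y k = weighted_nodes.is_min D nodes (weights y) k"
    unfolding is_cg_minimiser_def weighted_nodes.is_min_def[OF weighted_nodes_weights]
      sqnorm_spectral_apply[OF assms] by (rule refl)
  then show ?thesis
    unfolding cg_poly_def by (simp only: weighted_nodes.the_min[OF weighted_nodes_weights])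
qed

lemma cg_poly_0: "y \<in> carrier_vec D \<Longrightarrow> cg_poly lam u y 0 = 1"
  by (simp add: cg_poly_eq cg_residual_def)

lemma cg_poly_interp_eq:
  assumes "y \<in> carrier_vec D" "t \<in> {0..real n}"
  shows "cg_poly_interp lam u y t
    = 1 + (\<Sum>j<n. Polynomial.smult (clamp01 t j) (cg_poly lam u y (Suc j) - cg_poly lam u y j))"
  using assms interpolation_clamp01[of t n "cg_poly lam u y"]
  by (simp add: cg_poly_interp_def Let_def cg_poly_0)

lemma card_nodes: "card (nodes ` {1..D}) = dd"
proof -
  have "inj_on (\<lambda>l. l\<^sup>2) (lam ` {1..D})"
    using lam_pos by (intro inj_onI) (auto simp: power2_eq_iff_nonneg less_imp_le)
  from card_image[OF this] show ?thesis by (simp add: image_image)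
qed

lemma positive_nodes_weights:
  assumes "\<And>i. i \<in> {1..D} \<Longrightarrow> y \<bullet> u i \<noteq> 0"
  shows "positive_nodes D nodes (weights y)"
  by unfold_locales (use assms lam_pos in \<open>auto simp: less_imp_neq[THEN not_sym]\<close>)

text \<open>Nonzero components keep all basis norms up to \<open>dd\<close> positive, so the default
  value 1 in \<open>cg_poly\<close> never occurs and the interpolation becomes damping of the last
  coefficient.\<close>

lemma cg_poly_interp_nondegenerate:
  assumes y: "y \<in> carrier_vec D" "\<And>i. i \<in> {1..D} \<Longrightarrow> y \<bullet> u i \<noteq> 0" and t: "t \<in> {0..real dd}"
  shows "cg_poly_interp lam u y t = cg_residual D nodes (weights y) dd (clamp01 t)"
proof -
  interpret positive_nodes D nodes "weights y" by (rule positive_nodes_weights[OF y(2)])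
  have q: "cg_poly lam u y k = res k (\<lambda>_. 1)" if "k \<le> dd" for k
    unfolding cg_poly_eq[OF y(1)] using krylov_basis_nonzero that by (simp add: card_nodes)
  have "cg_poly lam u y (Suc j) - cg_poly lam u y j = - Polynomial.smult (c j) (e j)" if "j < dd" for j
    using that by (simp add: q cg_residual_def)
  then have "cg_poly_interp lam u y t = 1 + (\<Sum>j<dd. Polynomial.smult (clamp01 t j) (- Polynomial.smult (c j) (e j)))"
    unfolding cg_poly_interp_eq[OF y(1) t] by simp
  then show ?thesis by (simp add: cg_residual_def sum_negf)
qed

lemma A_cg_estimator:
  assumes "y \<in> carrier_vec D"
  shows "A *\<^sub>v cg_estimator A lam u y t = y - spectral_apply lam u (poly (cg_poly_interp lam u y t)) y"
  unfolding cg_estimator_def using assms spectral_apply_carrier by (intro mult_pinv) auto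

lemma cg_estimator_carrier: "y \<in> carrier_vec D \<Longrightarrow> cg_estimator A lam u y t \<in> carrier_vec P"
  unfolding cg_estimator_def using pinv_carrier spectral_apply_carrier
  by (intro mult_mat_vec_carrier[of _ P D]) auto

lemma cg_sqresidual_eq:
  assumes "y \<in> carrier_vec D"
  shows "cg_sqresidual A lam u y t
    = ipy y (cg_poly_interp lam u y t) (cg_poly_interp lam u y t)"
proof -
  let ?s = "spectral_apply lam u (poly (cg_poly_interp lam u y t)) y"
  have s: "?s \<in> carrier_vec D" by (rule spectral_apply_carrier[OF assms])
  have "sqnorm (y - ?s - y) = sqnorm ?s"
    using assms s unfolding sqnorm_eq_sum by (intro sum.cong) auto
  then show ?thesis
    unfolding cg_sqresidual_def A_cg_estimator[OF assms] sqnorm_spectral_apply[OF assms] .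
qed

lemma ip_measurable:
  assumes "\<And>s. (\<lambda>y. poly (p y) s) \<in> borel_measurable (borel_vec D)"
    "\<And>s. (\<lambda>y. poly (q y) s) \<in> borel_measurable (borel_vec D)"
  shows "(\<lambda>y. ipy y (p y) (q y)) \<in> borel_measurable (borel_vec D)"
  unfolding ip_def
  by (intro borel_measurable_sum borel_measurable_times borel_measurable_power assms borel_vec_scalar_prod)
    (use u_carrier in auto)

text \<open>The recursion uses only arithmetic operations on functions of the observation, so strong
  induction applies, including where denominators vanish.\<close>

lemma krylov_basis_measurable:
  "(\<lambda>y. poly (basis y k) s) \<in> borel_measurable (borel_vec D)"
proof (induction k arbitrary: s rule: less_induct)
  case (less k)
  have "(\<lambda>y. poly (basis y k) s) = (\<lambda>y. poly (Polynomial.monom 1 (Suc k)) s -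
     (\<Sum>j<k. ipy y (Polynomial.monom 1 (Suc k)) (basis y j) /
         ipy y (basis y j) (basis y j) *
        poly (basis y j) s))"
    by (subst krylov_basis.simps) (simp add: poly_sum)
  also have "\<dots> \<in> borel_measurable (borel_vec D)"
    by (intro borel_measurable_diff borel_measurable_sum borel_measurable_times borel_measurable_divide
        ip_measurable less borel_measurable_const) auto
  finally show ?case .
qed

lemma cg_poly_measurable: "(\<lambda>y. poly (cg_poly lam u y k) s) \<in> borel_measurable (borel_vec D)"
proof -
  let ?n = "\<lambda>y j. ipy y (basis y j) (basis y j)"
  have "(\<lambda>y. if \<forall>j<k. ?n y j \<noteq> 0 then poly (cg_residual D nodes (weights y) k (\<lambda>_. 1)) s else 1)
      \<in> borel_measurable (borel_vec D)"
  proof (rule measurable_If)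
    have "(\<lambda>y. poly (cg_residual D nodes (weights y) k (\<lambda>_. 1)) s)
      = (\<lambda>y. 1 - (\<Sum>j<k. cg_coef D nodes (weights y) j * poly (basis y j) s))"
      by (simp add: cg_residual_def poly_sum)
    also have "\<dots> \<in> borel_measurable (borel_vec D)"
      unfolding cg_coef_def
      by (intro borel_measurable_diff borel_measurable_sum borel_measurable_times borel_measurable_divide
        ip_measurable krylov_basis_measurable borel_measurable_const)
    finally show "(\<lambda>y. poly (cg_residual D nodes (weights y) k (\<lambda>_. 1)) s) \<in> borel_measurable (borel_vec D)" .
    have [measurable]: "(\<lambda>y. ?n y j) \<in> borel_measurable (borel_vec D)" for j
      by (intro ip_measurable krylov_basis_measurable)
    show "{y \<in> space (borel_vec D). \<forall>j<k. ?n y j \<noteq> 0} \<in> sets (borel_vec D)"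
      by measurable
  qed simp
  also have "?this \<longleftrightarrow> ?thesis"
    by (intro measurable_cong) (auto simp: cg_poly_eq)
  finally show ?thesis .
qed

lemma cg_poly_interp_measurable:
  "(\<lambda>y. poly (cg_poly_interp lam u y t) s) \<in> borel_measurable (borel_vec D)"
  unfolding cg_poly_interp_def Let_def poly_add poly_smult
  by (intro borel_measurable_add borel_measurable_times cg_poly_measurable borel_measurable_const)

lemma cg_sqresidual_measurable: "(\<lambda>y. cg_sqresidual A lam u y t) \<in> borel_measurable (borel_vec D)"
proof -
  have "(\<lambda>y. ipy y (cg_poly_interp lam u y t) (cg_poly_interp lam u y t)) \<in> borel_measurable (borel_vec D)"
    by (intro ip_measurable cg_poly_interp_measurable)
  also have "?this \<longleftrightarrow> ?thesis"
    by (intro measurable_cong) (simp add: cg_sqresidual_eq)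
  finally show ?thesis .
qed

lemma cg_sqresidual_continuous:
  assumes "y \<in> carrier_vec D"
  shows "continuous_on {0..real n} (cg_sqresidual A lam u y)"
proof -
  have "continuous_on {0..real n} (\<lambda>t. \<Sum>i=1..D. weights y i
      * (1 + (\<Sum>j<n. clamp01 t j * (poly (cg_poly lam u y (Suc j)) (nodes i) - poly (cg_poly lam u y j) (nodes i))))
      * (1 + (\<Sum>j<n. clamp01 t j * (poly (cg_poly lam u y (Suc j)) (nodes i) - poly (cg_poly lam u y j) (nodes i)))))"
    by (intro continuous_intros)
  then show ?thesis
    by (rule continuous_on_eq) (simp add: cg_sqresidual_eq[OF assms] cg_poly_interp_eq[OF assms, of _ n] ip_def poly_sum)
qed

lemma stopping_time_measurable: "stopping_time A lam u \<kappa> \<in> borel_measurable (borel_vec D)"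
  unfolding stopping_time_def dims
  by (rule Inf_hitting_measurable) (auto intro: cg_sqresidual_measurable cg_sqresidual_continuous)

lemma stopped_cg_measurable: "stopped_cg A lam u \<kappa> \<in> estimators A"
  unfolding estimators_def dims
proof (rule measurable_borel_vecI)
  fix y :: "real vec" assume "y \<in> space (borel_vec D)"
  then show "stopped_cg A lam u \<kappa> y \<in> carrier_vec P"
    unfolding stopped_cg_def by (intro cg_estimator_carrier) simp
next
  fix m assume m: "m < P"
  let ?\<tau> = "stopping_time A lam u \<kappa>"
  let ?E = "{y \<in> space (borel_vec D). \<exists>t\<in>{0..real dd}. cg_sqresidual A lam u y t \<le> \<kappa>}"
  let ?r = "\<lambda>s y. poly (cg_poly_interp lam u y (?\<tau> y)) s"
  have E: "?E \<in> sets (borel_vec D)"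
    by (rule hitting_measurable) (auto intro: cg_sqresidual_measurable cg_sqresidual_continuous)
  have r: "?r s \<in> borel_measurable (borel_vec D)" for s
  proof -
    \<comment> \<open>At a random time the interpolation is a finite sum of measurable clamps of the
      time and fixed polynomials. If the level is never reached, the time is the constant
      \<open>Inf {}\<close>, possibly outside \<open>[0, dd]\<close>, and the interpolation at a
      fixed time is measurable anyway.\<close>
    let ?F = "\<lambda>y. if \<exists>t\<in>{0..real dd}. cg_sqresidual A lam u y t \<le> \<kappa>
        then 1 + (\<Sum>j<dd. clamp01 (?\<tau> y) j * (poly (cg_poly lam u y (Suc j)) s - poly (cg_poly lam u y j) s))
        else poly (cg_poly_interp lam u y (Inf {})) s"
    have "?F \<in> borel_measurable (borel_vec D)"
    proof (rule measurable_If[OF _ _ E])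
      have "(\<lambda>t. clamp01 t j) \<in> borel_measurable borel" for j
        unfolding clamp01_def by measurable
      from measurable_compose[OF stopping_time_measurable this]
      show "(\<lambda>y. 1 + (\<Sum>j<dd. clamp01 (?\<tau> y) j * (poly (cg_poly lam u y (Suc j)) s - poly (cg_poly lam u y j) s)))
          \<in> borel_measurable (borel_vec D)"
        by (intro borel_measurable_add borel_measurable_sum borel_measurable_times borel_measurable_diff
          borel_measurable_const cg_poly_measurable)
    qed (rule cg_poly_interp_measurable)
    also have "?this \<longleftrightarrow> ?r s \<in> borel_measurable (borel_vec D)"
    proof (rule measurable_cong)
      fix y assume "y \<in> space (borel_vec D)"
      then have y: "y \<in> carrier_vec D" by simp
      show "?F y = ?r s y"
      proof (cases "\<exists>t\<in>{0..real dd}. cg_sqresidual A lam u y t \<le> \<kappa>")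
        case True
        then have "?\<tau> y \<in> {0..real dd}"
          unfolding stopping_time_def dims by (intro Inf_hitting cg_sqresidual_continuous y)
        then show ?thesis using True by (simp add: cg_poly_interp_eq[OF y, of _ dd] poly_sum)
      next
        case False
        then have none: "{t \<in> {0..real dd}. cg_sqresidual A lam u y t \<le> \<kappa>} = {}" by auto
        have "?\<tau> y = Inf {}" unfolding stopping_time_def dims none ..
        then show ?thesis using False by simp
      qed
    qed
    finally show ?thesis .
  qed
  have "(\<lambda>y. \<Sum>l<D. pinv A $$ (m, l) * (y $ l - (\<Sum>i=1..D. ?r (nodes i) y * (y \<bullet> u i) * (u i $ l))))
      \<in> borel_measurable (borel_vec D)"
    by (intro borel_measurable_sum borel_measurable_times borel_measurable_diff r
        borel_vec_component borel_vec_scalar_prod borel_measurable_const) (use u_carrier in auto)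
  also have "?this \<longleftrightarrow> (\<lambda>y. stopped_cg A lam u \<kappa> y $ m) \<in> borel_measurable (borel_vec D)"
  proof (rule measurable_cong)
    fix y assume "y \<in> space (borel_vec D)"
    then have y: "dim_vec y = D" by simp
    have dim: "dim_row (pinv A) = P" "dim_col (pinv A) = D" using pinv_carrier by auto
    have row: "row (pinv A) m $ l = pinv A $$ (m, l)" if "l < D" for l using that m dim by simp
    show "(\<Sum>l<D. pinv A $$ (m, l) * (y $ l - (\<Sum>i=1..D. ?r (nodes i) y * (y \<bullet> u i) * (u i $ l))))
        = stopped_cg A lam u \<kappa> y $ m"
      using m dim y
      by (simp add: stopped_cg_def cg_estimator_def mult_mat_vec_def scalar_prod_def[of "row _ _"]
          spectral_apply_def lessThan_atLeast0 row)
  qed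
  finally show "(\<lambda>y. stopped_cg A lam u \<kappa> y $ m) \<in> borel_measurable (borel_vec D)" .
qed

end

section \<open>Upper bound for the risk\<close>

lemma gauss_moment_bounds:
  shows "(\<integral>\<^sup>+ z. ennreal ((lin D b z)\<^sup>2) \<partial>gauss D) \<le> ennreal (8 * (\<Sum>i<D. (b i)\<^sup>2))" (is ?A)
    and "(\<integral>\<^sup>+ z. ennreal ((lin D b z) ^ 4) \<partial>gauss D) \<le> ennreal (256 * (\<Sum>i<D. (b i)\<^sup>2)\<^sup>2)" (is ?B)
proof -
  let ?G = "\<Sum>i<D. (b i)\<^sup>2"
  have G: "0 \<le> ?G" by (intro sum_nonneg) auto
  have "?A \<and> ?B"
  proof (cases "?G = 0")
    case True
    then have "\<forall>i<D. b i = 0" by (subst (asm) sum_nonneg_eq_0_iff) auto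
    then have "lin D b z = 0" for z by simp
    then show ?thesis by simp
  next
    case False
    define s where "s = sqrt ?G"
    have s: "0 < s" "s\<^sup>2 = ?G" using False G by (auto simp: s_def less_le)
    define a where "a i = b i / s" for i
    have a: "(\<Sum>i<D. (a i)\<^sup>2) = 1"
      using s False by (simp add: a_def power_divide flip: sum_divide_distrib)
    have lin: "lin D b z = s * lin D a z" for z
      using s(1) by (simp add: a_def sum_distrib_left)
    have "(\<integral>\<^sup>+ z. ennreal ((lin D b z)\<^sup>2) \<partial>gauss D) = ennreal ?G * (\<integral>\<^sup>+ z. ennreal ((lin D a z)\<^sup>2) \<partial>gauss D)"
      unfolding lin power_mult_distrib s(2) by (subst nn_integral_cmult[symmetric]) (auto simp: ennreal_mult G)
    also have "\<dots> \<le> ennreal ?G * 8"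
      by (intro mult_left_mono gauss_even_moments a) simp
    also have "\<dots> = ennreal (8 * ?G)" using G by (simp add: ennreal_mult mult.commute)
    finally have 1: ?A .
    have s4: "s ^ 4 = ?G\<^sup>2" using s(2) by (metis power2_eq_square power4_eq_xxxx mult.assoc)
    have "(\<integral>\<^sup>+ z. ennreal ((lin D b z) ^ 4) \<partial>gauss D) = ennreal (?G\<^sup>2) * (\<integral>\<^sup>+ z. ennreal ((lin D a z) ^ 4) \<partial>gauss D)"
      unfolding lin power_mult_distrib s4 by (subst nn_integral_cmult[symmetric]) (auto simp: ennreal_mult)
    also have "\<dots> \<le> ennreal (?G\<^sup>2) * 256"
      by (intro mult_left_mono gauss_even_moments a) simp
    also have "\<dots> = ennreal (256 * ?G\<^sup>2)" by (simp add: ennreal_mult mult.commute)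
    finally show ?thesis using 1 by blast
  qed
  then show ?A ?B by auto
qed

context singular_decomposition
begin

lemma u_components_sqsum:
  assumes "m \<in> {1..D}"
  shows "(\<Sum>l<D. (\<Sum>i=m..D. a i * u i $ l)\<^sup>2) = (\<Sum>i=m..D. (a i)\<^sup>2)"
proof -
  have "(\<Sum>l<D. (\<Sum>i=m..D. a i * u i $ l)\<^sup>2) = (\<Sum>l<D. \<Sum>i=m..D. \<Sum>j=m..D. a i * a j * (u i $ l * u j $ l))"
    by (simp add: power2_eq_square sum_product mult_ac)
  also have "\<dots> = (\<Sum>i=m..D. \<Sum>j=m..D. a i * a j * (\<Sum>l<D. u i $ l * u j $ l))"
    unfolding sum_distrib_left
    by (subst sum.swap, rule sum.cong[OF refl], rule sum.swap)
  also have "\<dots> = (\<Sum>i=m..D. \<Sum>j=m..D. if i = j then a i * a j else 0)"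
  proof (intro sum.cong refl)
    fix i j assume "i \<in> {m..D}" "j \<in> {m..D}"
    then have ij: "i \<in> {1..D}" "j \<in> {1..D}" using assms by auto
    then have "dim_vec (u j) = D" using u_carrier by auto
    then have "(\<Sum>l<D. u i $ l * u j $ l) = (if i = j then 1 else 0)"
      using u_orth[OF ij] by (simp add: scalar_prod_def lessThan_atLeast0)
    then show "a i * a j * (\<Sum>l<D. u i $ l * u j $ l) = (if i = j then a i * a j else 0)" by simp
  qed
  also have "\<dots> = (\<Sum>i=m..D. (a i)\<^sup>2)" by (simp add: power2_eq_square)
  finally show ?thesis .
qed

lemma sqnorm_prediction_error:
  assumes f: "f \<in> carrier_vec P" and y: "y \<in> carrier_vec D"
  shows "sqnorm (A *\<^sub>v (cg_estimator A lam u y t - f))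
    = (\<Sum>i=1..D. (y \<bullet> u i - (A *\<^sub>v f) \<bullet> u i - poly (cg_poly_interp lam u y t) (nodes i) * (y \<bullet> u i))\<^sup>2)"
proof -
  let ?r = "spectral_apply lam u (poly (cg_poly_interp lam u y t)) y"
  have g: "A *\<^sub>v f \<in> carrier_vec D" using A f by auto
  have r: "?r \<in> carrier_vec D" by (rule spectral_apply_carrier[OF y])
  have "A *\<^sub>v (cg_estimator A lam u y t - f) = A *\<^sub>v cg_estimator A lam u y t - A *\<^sub>v f"
    by (rule mult_minus_distrib_mat_vec[OF A cg_estimator_carrier[OF y] f])
  then have eq: "A *\<^sub>v (cg_estimator A lam u y t - f) = y - ?r - A *\<^sub>v f"
    unfolding A_cg_estimator[OF y] .
  have "y - ?r - A *\<^sub>v f \<in> carrier_vec D" using y r g by auto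
  from parseval[OF this] show ?thesis unfolding eq
  proof (rule trans, intro sum.cong refl arg_cong[where f = "\<lambda>x. x\<^sup>2"])
    fix i assume i: "i \<in> {1..D}"
    have "(y - ?r - A *\<^sub>v f) \<bullet> u i = y \<bullet> u i - ?r \<bullet> u i - (A *\<^sub>v f) \<bullet> u i"
      using y r g u_carrier[OF i] by (simp add: minus_scalar_prod_distrib[of _ D])
    then show "(y - ?r - A *\<^sub>v f) \<bullet> u i
        = y \<bullet> u i - (A *\<^sub>v f) \<bullet> u i - poly (cg_poly_interp lam u y t) (nodes i) * (y \<bullet> u i)"
      unfolding spectral_apply_component[OF y i] by simp
  qed
qed

text \<open>\<open>M\<close> may depend on the observation; it will be chosen to dominate all
  normalised tail sums. Four times the cross term costs \<open>4a + M\<close>, which turns 48 into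
  52.\<close>

lemma stopped_cg_loss:
  fixes f y :: "real vec"
  assumes f: "f \<in> carrier_vec P" and y: "y \<in> carrier_vec D" "\<And>i. i \<in> {1..D} \<Longrightarrow> y \<bullet> u i \<noteq> 0"
    and kappa: "0 < \<kappa>" and rho: "0 < \<rho>" and M: "0 \<le> M"
  defines "g \<equiv> \<lambda>i. (A *\<^sub>v f) \<bullet> u i"
  defines "\<xi> \<equiv> \<lambda>i. y \<bullet> u i - g i"
  assumes tail: "\<And>m. m \<in> {1..D} \<Longrightarrow> (\<Sum>i=m..D. g i * \<xi> i)\<^sup>2 \<le> M * (\<Sum>i=m..D. (g i)\<^sup>2)"
  shows "sqnorm (A *\<^sub>v (stopped_cg A lam u \<kappa> y - f))
    \<le> 52 * (\<Sum>i=1..D. exp (- (\<rho> * nodes i)) * (g i)\<^sup>2) + 72 * (\<Sum>i=1..D. min 1 (\<rho> * nodes i) * (\<xi> i)\<^sup>2)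
      + M + 2 * \<bar>\<kappa> - (\<Sum>i=1..D. (\<xi> i)\<^sup>2)\<bar>"
proof -
  interpret positive_nodes D nodes "weights y" by (rule positive_nodes_weights[OF y(2)])
  let ?\<tau> = "stopping_time A lam u \<kappa> y"
  have dd: "d = dd" by (rule card_nodes)
  have R: "cg_sqresidual A lam u y t = ipw (res dd (clamp01 t)) (res dd (clamp01 t))" if "t \<in> {0..real dd}" for t
  proof -
    have "cg_poly_interp lam u y t = res dd (clamp01 t)"
      by (rule cg_poly_interp_nondegenerate) (use y that in auto)
    then show ?thesis unfolding cg_sqresidual_eq[OF y(1)] by simp
  qed
  have "res dd (clamp01 (real dd)) = res dd (\<lambda>_. 1)"
    by (rule res_cong) (simp add: clamp01_def of_nat_Suc[symmetric] less_eq_Suc_le del: of_nat_Suc)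
  then have "cg_sqresidual A lam u y (real dd) = 0"
    using res_d_zero by (simp add: R ip_def dd)
  then have "\<exists>t\<in>{0..real dd}. cg_sqresidual A lam u y t \<le> \<kappa>"
    using kappa by (intro bexI[of _ "real dd"]) auto
  note hit = Inf_hitting[OF cg_sqresidual_continuous[OF y(1)] this]
  have \<tau>: "?\<tau> \<in> {0..real dd}" "cg_sqresidual A lam u y ?\<tau> \<le> \<kappa>" "?\<tau> = 0 \<or> cg_sqresidual A lam u y ?\<tau> = \<kappa>"
    using hit unfolding stopping_time_def dims by blast+
  obtain w where w: "\<And>i. i \<in> {1..D} \<Longrightarrow> 0 \<le> w i \<and> w i \<le> 1 \<and> w i \<le> exp (- (\<rho> * nodes i)) \<and> 1 - w i \<le> \<rho> * nodes i"
    and mono: "\<And>i j. i \<in> {1..D} \<Longrightarrow> j \<in> {1..D} \<Longrightarrow> nodes i \<le> nodes j \<Longrightarrow> w j \<le> w i"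
    and loss: "(\<Sum>i=1..D. (\<xi> i - poly (res d (clamp01 ?\<tau>)) (nodes i) * (g i + \<xi> i))\<^sup>2)
      \<le> 48 * (\<Sum>i=1..D. w i * (g i)\<^sup>2) + 72 * (\<Sum>i=1..D. (1 - w i) * (\<xi> i)\<^sup>2)
        + 4 * \<bar>\<Sum>i=1..D. w i * (g i * \<xi> i)\<bar> + 2 * \<bar>\<kappa> - (\<Sum>i=1..D. (\<xi> i)\<^sup>2)\<bar>"
  proof (rule stopped_loss_bound[OF _ rho, of g \<xi> ?\<tau> \<kappa>], goal_cases)
    case (4 w)
    show ?case by (rule 4(1)[OF _ _ 4(4)]) (use 4(2,3) in auto)
  qed (use \<tau> in \<open>auto simp: \<xi>_def dd R\<close>)
  have eq: "sqnorm (A *\<^sub>v (stopped_cg A lam u \<kappa> y - f))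
      = (\<Sum>i=1..D. (\<xi> i - poly (res d (clamp01 ?\<tau>)) (nodes i) * (g i + \<xi> i))\<^sup>2)"
  proof -
    have "cg_poly_interp lam u y ?\<tau> = res dd (clamp01 ?\<tau>)"
      by (rule cg_poly_interp_nondegenerate) (use y \<tau>(1) in auto)
    then show ?thesis
      unfolding stopped_cg_def sqnorm_prediction_error[OF f y(1)] dd by (simp add: \<xi>_def g_def)
  qed
  have cross: "\<bar>\<Sum>i=1..D. w i * (g i * \<xi> i)\<bar> \<le> (\<Sum>i=1..D. w i * (g i)\<^sup>2) + M / 4"
  proof (rule monotone_weights_cross_term)
    fix i j assume ij: "1 \<le> i" "i \<le> j" "j \<le> D"
    then have "nodes j \<le> nodes i"
      using lam_pos[of j] lam_antimono[of i j] by (auto intro!: power_mono less_imp_le)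
    then show "w i \<le> w j" using ij by (intro mono) auto
  qed (use w M tail in auto)
  have a: "(\<Sum>i=1..D. w i * (g i)\<^sup>2) \<le> (\<Sum>i=1..D. exp (- (\<rho> * nodes i)) * (g i)\<^sup>2)"
    using w by (intro sum_mono mult_right_mono) auto
  have S: "(\<Sum>i=1..D. (1 - w i) * (\<xi> i)\<^sup>2) \<le> (\<Sum>i=1..D. min 1 (\<rho> * nodes i) * (\<xi> i)\<^sup>2)"
    using w by (intro sum_mono mult_right_mono) auto
  have arith: "48 * a + 72 * s + 4 * c + k \<le> 52 * a' + 72 * s' + M + k"
    if "a \<le> a'" "s \<le> s'" "c \<le> a + M / 4" for a a' s s' c k :: real
    using that by (simp add: algebra_simps)
  show ?thesis unfolding eq by (rule order_trans[OF loss arith[OF a S cross]])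
qed

end

section \<open>From the loss to its expectation\<close>

text \<open>Measurability and signs travel with the bound, so that expectations of composite
  majorants are estimated compositionally in \<open>ennreal\<close>.\<close>

definition mean_le :: "'a measure \<Rightarrow> ('a \<Rightarrow> real) \<Rightarrow> real \<Rightarrow> bool" where
  "mean_le M F a \<longleftrightarrow> F \<in> borel_measurable M \<and> (\<forall>z. 0 \<le> F z) \<and> 0 \<le> a \<and>
     (\<integral>\<^sup>+ z. ennreal (F z) \<partial>M) \<le> ennreal a"

lemma mean_le_add:
  assumes "mean_le M F a" "mean_le M G b"
  shows "mean_le M (\<lambda>z. F z + G z) (a + b)"
proof -
  have "(\<integral>\<^sup>+ z. ennreal (F z + G z) \<partial>M) = (\<integral>\<^sup>+ z. ennreal (F z) \<partial>M) + (\<integral>\<^sup>+ z. ennreal (G z) \<partial>M)"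
    using assms unfolding mean_le_def by (subst nn_integral_add[symmetric]) auto
  then show ?thesis using assms unfolding mean_le_def by (auto intro!: add_mono)
qed

lemma mean_le_cmult:
  assumes "mean_le M F a" "0 \<le> c"
  shows "mean_le M (\<lambda>z. c * F z) (c * a)"
proof -
  have "(\<integral>\<^sup>+ z. ennreal (c * F z) \<partial>M) = ennreal c * (\<integral>\<^sup>+ z. ennreal (F z) \<partial>M)"
    using assms unfolding mean_le_def by (subst nn_integral_cmult[symmetric]) (auto simp: ennreal_mult)
  also have "\<dots> \<le> ennreal c * ennreal a"
    using assms unfolding mean_le_def by (intro mult_left_mono) auto
  finally show ?thesis using assms unfolding mean_le_def by (auto simp: ennreal_mult)
qed

lemma mean_le_const: "prob_space M \<Longrightarrow> 0 \<le> c \<Longrightarrow> mean_le M (\<lambda>_. c) c"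
  by (simp add: mean_le_def prob_space.emeasure_space_1)

lemma mean_le_sum:
  assumes "prob_space M" "\<And>i. i \<in> I \<Longrightarrow> mean_le M (F i) (a i)"
  shows "mean_le M (\<lambda>z. \<Sum>i\<in>I. F i z) (\<Sum>i\<in>I. a i)"
  using assms(2)
proof (induction I rule: infinite_finite_induct)
  case (insert i I)
  then show ?case by (simp add: mean_le_add)
qed (use mean_le_const[OF assms(1), of 0] in auto)

context singular_decomposition
begin

lemma scalar_prod_shift:
  assumes f: "f \<in> carrier_vec P" and z: "z \<in> carrier_vec D" and i: "i \<in> {1..D}"
  shows "(A *\<^sub>v f + \<delta> \<cdot>\<^sub>v z) \<bullet> u i = (A *\<^sub>v f) \<bullet> u i + \<delta> * (z \<bullet> u i)"
proof -
  have "A *\<^sub>v f \<in> carrier_vec D" using A f by auto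
  then show ?thesis using z u_carrier[OF i] by (simp add: add_scalar_prod_distrib[of _ D])
qed

lemma AE_nondegenerate:
  assumes "f \<in> carrier_vec P" "0 < \<delta>"
  shows "AE z in std_gaussian_vec D. \<forall>i\<in>{1..D}. (A *\<^sub>v f + \<delta> \<cdot>\<^sub>v z) \<bullet> u i \<noteq> 0"
proof (rule AE_finite_allI)
  fix i assume i: "i \<in> {1..D}"
  let ?c = "- ((A *\<^sub>v f) \<bullet> u i) / \<delta>"
  have dim: "dim_vec (u i) = D" using u_carrier[OF i] by auto
  have meas: "{z \<in> space (borel_vec D). z \<bullet> u i \<noteq> ?c} \<in> sets (borel_vec D)"
    using borel_vec_scalar_prod[OF dim] by measurable
  have "(\<Sum>l<D. (u i $ l)\<^sup>2) = 1"
    using u_orth[OF i i] dim by (simp add: scalar_prod_def lessThan_atLeast0 power2_eq_square)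
  from gauss_hyperplane_null[OF this]
  have "AE z in std_gaussian_vec D. z \<bullet> u i \<noteq> ?c"
    unfolding std_gaussian_vec_def AE_distr_iff[OF measurable_vec_gauss meas] vec_scalar_prod[OF dim] .
  moreover have "AE z in std_gaussian_vec D. z \<in> carrier_vec D"
    using AE_space[of "std_gaussian_vec D"] by simp
  ultimately show "AE z in std_gaussian_vec D. (A *\<^sub>v f + \<delta> \<cdot>\<^sub>v z) \<bullet> u i \<noteq> 0"
  proof eventually_elim
    case (elim z)
    then show ?case using assms(2) by (auto simp: scalar_prod_shift[OF assms(1) elim(2) i] field_simps)
  qed
qed simp

lemma stopped_cg_risk:
  assumes f: "f \<in> carrier_vec P" and D: "0 < D" and "0 < \<delta>" "0 < \<kappa>" "0 < \<rho>" "0 \<le> K"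
    and kappa: "\<bar>\<kappa> - \<delta>\<^sup>2 * real D\<bar> \<le> K * \<delta>\<^sup>2 * sqrt (real D)"
  shows "pred_risk A \<delta> (stopped_cg A lam u \<kappa>) f
    \<le> ennreal (52 * (\<Sum>i=1..D. exp (- (\<rho> * nodes i)) * ((A *\<^sub>v f) \<bullet> u i)\<^sup>2)
        + 576 * \<delta>\<^sup>2 * (\<Sum>i=1..D. min 1 (\<rho> * nodes i)) + (261 + 2 * K) * (\<delta>\<^sup>2 * sqrt (real D)))"
proof -
  define g where "g i = (A *\<^sub>v f) \<bullet> u i" for i
  define G where "G m = (\<Sum>i=m..D. (g i)\<^sup>2)" for m
  define a where "a = (\<Sum>i=1..D. exp (- (\<rho> * nodes i)) * (g i)\<^sup>2)"
  define s where "s = sqrt (real D)"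
  have s: "0 < s" "s\<^sup>2 = real D" using D by (simp_all add: s_def)
  have a0: "0 \<le> a" unfolding a_def by (intro sum_nonneg) auto
  define T where "T z m = (\<Sum>i=m..D. g i * (z \<bullet> u i))" for z m
  \<comment> \<open>The maximum over \<open>m\<close> of \<open>x = T^2 / G\<close> is bounded
    through \<open>x \<le> s + x^2 / s\<close>. Replacing the maximum by a sum of \<open>D\<close>
    fourth-moment terms then costs only \<open>D / s = s\<close>, hence order \<open>sqrt D\<close>
    instead of \<open>D\<close>.\<close>
  define N where "N z = \<delta>\<^sup>2 * (s + (\<Sum>m=1..D. 1 / ((G m)\<^sup>2 * s) * (T z m) ^ 4))" for z
  define B where "B z = 52 * a + 72 * (\<Sum>i=1..D. min 1 (\<rho> * nodes i) * (\<delta>\<^sup>2 * (z \<bullet> u i)\<^sup>2)) + N z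
      + 2 * (K * \<delta>\<^sup>2 * s + \<delta>\<^sup>2 * \<bar>(\<Sum>i=1..D. (z \<bullet> u i)\<^sup>2) - real D\<bar>)" for z
  have N0: "0 \<le> N z" for z
    unfolding N_def using s by (intro mult_nonneg_nonneg add_nonneg_nonneg sum_nonneg) auto
  have tail: "(\<delta> * T z m)\<^sup>2 \<le> N z * G m" if m: "m \<in> {1..D}" for z m
  proof (cases "G m = 0")
    case True
    then have "\<forall>i\<in>{m..D}. g i = 0" unfolding G_def by (subst (asm) sum_nonneg_eq_0_iff) auto
    then show ?thesis using True by (simp add: T_def)
  next
    case False
    then have G: "0 < G m" by (auto simp: G_def less_le intro: sum_nonneg)
    define x where "x = (T z m)\<^sup>2 / G m"
    have "2 * x * s \<le> s\<^sup>2 + x\<^sup>2" using sum_squares_bound[of x s] by simp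
    then have "2 * x \<le> s + x\<^sup>2 / s" using s(1) by (simp add: field_simps power2_eq_square)
    moreover have "0 \<le> x" using G by (simp add: x_def)
    ultimately have "x \<le> s + x\<^sup>2 / s" by simp
    also have "x\<^sup>2 / s = 1 / ((G m)\<^sup>2 * s) * (T z m) ^ 4"
      by (simp add: x_def power_divide)
    also have "\<dots> \<le> (\<Sum>m=1..D. 1 / ((G m)\<^sup>2 * s) * (T z m) ^ 4)"
      using m s by (intro member_le_sum) auto
    finally have "\<delta>\<^sup>2 * (x * G m) \<le> N z * G m"
      unfolding N_def using G by (simp add: mult.assoc mult_left_mono)
    moreover have "x * G m = (T z m)\<^sup>2" using G by (simp add: x_def)
    ultimately show ?thesis by (simp add: power_mult_distrib)
  qed
  have bound: "sqnorm (A *\<^sub>v (stopped_cg A lam u \<kappa> (A *\<^sub>v f + \<delta> \<cdot>\<^sub>v z) - f)) \<le> B z"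
    if z: "z \<in> carrier_vec D" and nd: "\<forall>i\<in>{1..D}. (A *\<^sub>v f + \<delta> \<cdot>\<^sub>v z) \<bullet> u i \<noteq> 0" for z
  proof -
    let ?\<xi> = "\<lambda>i. (A *\<^sub>v f + \<delta> \<cdot>\<^sub>v z) \<bullet> u i - (A *\<^sub>v f) \<bullet> u i"
    let ?y = "A *\<^sub>v f + \<delta> \<cdot>\<^sub>v z"
    have y: "?y \<in> carrier_vec D" using A f z by auto
    have xi: "?\<xi> i = \<delta> * (z \<bullet> u i)" if "i \<in> {1..D}" for i
      using scalar_prod_shift[OF f z that] by simp
    have "sqnorm (A *\<^sub>v (stopped_cg A lam u \<kappa> ?y - f))
      \<le> 52 * (\<Sum>i=1..D. exp (- (\<rho> * nodes i)) * ((A *\<^sub>v f) \<bullet> u i)\<^sup>2)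
        + 72 * (\<Sum>i=1..D. min 1 (\<rho> * nodes i) * (?\<xi> i)\<^sup>2)
        + N z + 2 * \<bar>\<kappa> - (\<Sum>i=1..D. (?\<xi> i)\<^sup>2)\<bar>"
    proof (rule stopped_cg_loss[OF f y _ assms(4,5) N0])
      fix m assume m: "m \<in> {1..D}"
      have "(\<Sum>i=m..D. (A *\<^sub>v f) \<bullet> u i * ?\<xi> i) = \<delta> * T z m"
        unfolding T_def sum_distrib_left using m
        by (intro sum.cong refl) (auto simp: xi g_def)
      then show "(\<Sum>i=m..D. (A *\<^sub>v f) \<bullet> u i * ?\<xi> i)\<^sup>2
          \<le> N z * (\<Sum>i=m..D. ((A *\<^sub>v f) \<bullet> u i)\<^sup>2)"
        using tail[OF m, of z] by (simp add: G_def g_def)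
    qed (use nd in auto)
    also have "(\<Sum>i=1..D. exp (- (\<rho> * nodes i)) * ((A *\<^sub>v f) \<bullet> u i)\<^sup>2) = a"
      by (simp add: a_def g_def)
    also have "(\<Sum>i=1..D. min 1 (\<rho> * nodes i) * (?\<xi> i)\<^sup>2)
        = (\<Sum>i=1..D. min 1 (\<rho> * nodes i) * (\<delta>\<^sup>2 * (z \<bullet> u i)\<^sup>2))"
      by (intro sum.cong refl) (simp add: xi power_mult_distrib)
    also have "(\<Sum>i=1..D. (?\<xi> i)\<^sup>2) = \<delta>\<^sup>2 * (\<Sum>i=1..D. (z \<bullet> u i)\<^sup>2)"
      unfolding sum_distrib_left by (intro sum.cong refl) (simp add: xi power_mult_distrib)
    also have "\<bar>\<kappa> - \<delta>\<^sup>2 * (\<Sum>i=1..D. (z \<bullet> u i)\<^sup>2)\<bar>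
        \<le> K * \<delta>\<^sup>2 * s + \<delta>\<^sup>2 * \<bar>(\<Sum>i=1..D. (z \<bullet> u i)\<^sup>2) - real D\<bar>"
    proof -
      have "\<kappa> - \<delta>\<^sup>2 * (\<Sum>i=1..D. (z \<bullet> u i)\<^sup>2) = (\<kappa> - \<delta>\<^sup>2 * real D) - \<delta>\<^sup>2 * ((\<Sum>i=1..D. (z \<bullet> u i)\<^sup>2) - real D)"
        by (simp add: algebra_simps)
      then have "\<bar>\<kappa> - \<delta>\<^sup>2 * (\<Sum>i=1..D. (z \<bullet> u i)\<^sup>2)\<bar>
          \<le> \<bar>\<kappa> - \<delta>\<^sup>2 * real D\<bar> + \<bar>\<delta>\<^sup>2 * ((\<Sum>i=1..D. (z \<bullet> u i)\<^sup>2) - real D)\<bar>"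
        by (simp only: abs_triangle_ineq4)
      then show ?thesis using kappa unfolding s_def abs_mult by simp
    qed
    finally show ?thesis unfolding B_def by simp
  qed
  have prob: "prob_space (gauss D)" by (rule prob_space_gauss)
  have dim: "dim_vec (u i) = D" if "i \<in> {1..D}" for i using u_carrier[OF that] by auto
  have T_lin: "T (vec D z) m = lin D (\<lambda>l. \<Sum>i=m..D. g i * u i $ l) z" if "m \<in> {1..D}" for z m
  proof -
    have "T (vec D z) m = (\<Sum>i=m..D. \<Sum>l<D. g i * u i $ l * z l)"
      unfolding T_def using that dim
      by (intro sum.cong refl) (auto simp: vec_scalar_prod sum_distrib_left mult.assoc)
    also have "\<dots> = (\<Sum>l<D. \<Sum>i=m..D. g i * u i $ l * z l)" by (rule sum.swap)
    finally show ?thesis by (simp add: sum_distrib_right)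
  qed
  have u1: "(\<Sum>l<D. (u i $ l)\<^sup>2) = 1" if "i \<in> {1..D}" for i
    using u_orth[OF that that] dim[OF that] by (simp add: scalar_prod_def lessThan_atLeast0 power2_eq_square)
  have X: "mean_le (gauss D) (\<lambda>z. (vec D z \<bullet> u i)\<^sup>2) 8" if "i \<in> {1..D}" for i
    unfolding vec_scalar_prod[OF dim[OF that]]
    using gauss_moment_bounds(1)[of D "\<lambda>l. u i $ l"] u1[OF that] by (simp add: mean_le_def)
  have X4: "mean_le (gauss D) (\<lambda>z. 1 / ((G m)\<^sup>2 * s) * (T (vec D z) m) ^ 4) (256 / s)" if m: "m \<in> {1..D}" for m
  proof -
    have "mean_le (gauss D) (\<lambda>z. (T (vec D z) m) ^ 4) (256 * (G m)\<^sup>2)"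
      unfolding T_lin[OF m]
      using gauss_moment_bounds(2)[of D "\<lambda>l. \<Sum>i=m..D. g i * u i $ l"]
      unfolding u_components_sqsum[OF m] G_def by (simp add: mean_le_def)
    then have "mean_le (gauss D) (\<lambda>z. 1 / ((G m)\<^sup>2 * s) * (T (vec D z) m) ^ 4) (1 / ((G m)\<^sup>2 * s) * (256 * (G m)\<^sup>2))"
      using s by (intro mean_le_cmult) auto
    \<comment> \<open>An inequality, since for \<open>G m = 0\<close> the left side is 0 by the
      convention for division by zero.\<close>
    moreover have "1 / ((G m)\<^sup>2 * s) * (256 * (G m)\<^sup>2) \<le> 256 / s"
      using s by (cases "G m = 0") auto
    ultimately show ?thesis
      unfolding mean_le_def using s by (auto intro: order_trans[OF _ ennreal_leI])
  qed
  have dev: "mean_le (gauss D) (\<lambda>z. \<bar>(\<Sum>i=1..D. (vec D z \<bullet> u i)\<^sup>2) - real D\<bar>) (2 * s)"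
  proof -
    have "(\<Sum>i=1..D. (vec D z \<bullet> u i)\<^sup>2) = (\<Sum>l<D. (z l)\<^sup>2)" for z
      using parseval[of "vec D z"] by (simp add: sqnorm_eq_sum)
    then show ?thesis
      using gauss_sqnorm_deviation[OF D] s by (simp add: mean_le_def s_def)
  qed
  \<comment> \<open>The constants: \<open>72 * 8 = 576\<close>; the random \<open>N\<close>
    contributes \<open>1 + 256\<close>, and the noise deviation \<open>2 * 2\<close>, which makes
    261.\<close>
  have mean: "mean_le (gauss D) (\<lambda>z. B (vec D z))
    (52 * a + 72 * (\<Sum>i=1..D. min 1 (\<rho> * nodes i) * (\<delta>\<^sup>2 * 8)) + \<delta>\<^sup>2 * (s + (\<Sum>m=1..D. 256 / s))
      + 2 * (K * \<delta>\<^sup>2 * s + \<delta>\<^sup>2 * (2 * s)))" (is "mean_le _ _ ?m")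
    unfolding B_def N_def
    by (intro mean_le_add mean_le_cmult mean_le_sum mean_le_const X X4 dev prob)
      (use a0 s assms in auto)
  have B_meas: "(\<lambda>z. ennreal (B z)) \<in> borel_measurable (borel_vec D)"
    unfolding B_def N_def T_def
    by (intro measurable_compose[OF _ measurable_ennreal] borel_measurable_add borel_measurable_times borel_measurable_sum
        borel_measurable_power borel_measurable_abs borel_measurable_diff borel_measurable_const borel_vec_scalar_prod)
      (use dim in auto)
  have "pred_risk A \<delta> (stopped_cg A lam u \<kappa>) f \<le> (\<integral>\<^sup>+ z. ennreal (B z) \<partial>std_gaussian_vec D)"
    unfolding pred_risk_def dims
  proof (rule nn_integral_mono_AE)
    have "AE z in std_gaussian_vec D. z \<in> carrier_vec D"
      using AE_space[of "std_gaussian_vec D"] by simp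
    with AE_nondegenerate[OF f assms(3)]
    show "AE z in std_gaussian_vec D. ennreal (sqnorm (A *\<^sub>v (stopped_cg A lam u \<kappa> (A *\<^sub>v f + \<delta> \<cdot>\<^sub>v z) - f)))
        \<le> ennreal (B z)"
      by eventually_elim (intro ennreal_leI bound)
  qed
  also have "\<dots> = (\<integral>\<^sup>+ z. ennreal (B (vec D z)) \<partial>gauss D)"
    by (rule nn_integral_std_gaussian_vec[OF B_meas])
  also have "\<dots> \<le> ennreal ?m"
    using mean by (simp add: mean_le_def)
  also have "(\<Sum>m=1..D. 256 / s) = 256 * s"
    using s by (simp add: power2_eq_square field_simps)
  finally show ?thesis
    by (simp add: a_def g_def s_def algebra_simps flip: sum_distrib_left)
qed

end

section \<open>Balancing bias and variance\<close>

text \<open>The rate is the noise level times an effective dimension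
  \<open>E = (R^2/\<delta>^2)^(1/q)\<close>; both bounds are proved in this form.\<close>

lemma pred_rate_eq:
  assumes "0 < \<mu>" "0 < p" "0 < R" "0 < \<delta>"
  shows "pred_rate \<mu> p R \<delta> = \<delta>\<^sup>2 * (R\<^sup>2 / \<delta>\<^sup>2) powr (1 / (4 * \<mu> * p + 2 * p + 1))"
proof -
  define q where "q = 4 * \<mu> * p + 2 * p + 1"
  have q: "0 < q" using assms by (simp add: q_def add_pos_pos)
  have "(R\<^sup>2 / \<delta>\<^sup>2) = (R / \<delta>) powr 2"
    using assms by (simp add: powr_numeral power_divide)
  then have "(R\<^sup>2 / \<delta>\<^sup>2) powr (1 / q) = (R / \<delta>) powr (2 / q)"
    by (simp only: powr_powr times_divide_eq_right mult_1_right)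
  also have "\<dots> = R powr (2 / q) / \<delta> powr (2 / q)"
    using assms by (simp add: powr_divide)
  finally have "\<delta>\<^sup>2 * (R\<^sup>2 / \<delta>\<^sup>2) powr (1 / q) = R powr (2 / q) * (\<delta> powr 2 / \<delta> powr (2 / q))"
    using assms by (simp add: powr_numeral)
  also have "\<delta> powr 2 / \<delta> powr (2 / q) = \<delta> powr (2 - 2 / q)"
    by (rule powr_diff[symmetric])
  also have "2 - 2 / q = (8 * \<mu> * p + 4 * p) / q"
    using q by (simp add: field_simps q_def)
  finally show ?thesis by (simp add: pred_rate_def q_def)
qed

text \<open>The maximum is attained at \<open>y = s\<close>; the sharp factor
  \<open>exp (- s)\<close> is dropped by using \<open>y/s \<le> exp (y/s)\<close>.\<close>

lemma powr_times_exp_le: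
  fixes s y :: real
  assumes "0 < s" "0 \<le> y"
  shows "y powr s * exp (- y) \<le> s powr s"
proof -
  have "y / s \<le> exp (y / s)" using exp_ge_add_one_self[of "y / s"] by linarith
  then have "(y / s) powr s \<le> exp (y / s) powr s"
    using assms by (intro powr_mono2) auto
  also have "\<dots> = exp y" using assms by (simp add: powr_def)
  finally have "y powr s \<le> s powr s * exp y"
    using assms by (simp add: powr_divide field_simps)
  then show ?thesis by (simp add: exp_minus field_simps)
qed

text \<open>Indices are grouped into blocks of length \<open>n\<close>. Block \<open>j\<close>
  contributes at most \<open>n * j^(-s)\<close>, block 0 at most \<open>n\<close>, and the series
  converges, so the bound is uniform in \<open>D\<close>.\<close>

lemma sum_min_powr_le:
  fixes s :: real
  assumes "1 < s"
  obtains Z where "0 < Z" "\<And>D n. 0 < n \<Longrightarrow> (\<Sum>i=1..D. min 1 ((real n / real i) powr s)) \<le> real n * Z"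
proof -
  define b where "b j = (if j = 0 then 1 else real j powr (- s))" for j :: nat
  have "summable (\<lambda>j. real j powr (- s))" using assms by (simp add: summable_real_powr_iff)
  then have "summable b"
    by (rule summable_comparison_test_ev[rotated])
      (auto simp: b_def eventually_sequentially intro!: exI[of _ 1])
  have b0: "0 \<le> b j" for j by (simp add: b_def)
  have le: "(\<Sum>i=1..D. min 1 ((real n / real i) powr s)) \<le> real n * suminf b" if n: "0 < n" for D n
  proof -
    have "(\<Sum>i=1..D. min 1 ((real n / real i) powr s)) \<le> (\<Sum>i=1..D. b (i div n))"
    proof (rule sum_mono)
      fix i assume i: "i \<in> {1..D}"
      show "min 1 ((real n / real i) powr s) \<le> b (i div n)"
      proof (cases "i div n = 0")
        case False
        then have j: "0 < real (i div n)" by simp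
        have "real (i div n) * real n \<le> real i"
          by (metis div_times_less_eq_dividend of_nat_le_iff of_nat_mult)
        then have "real n / real i \<le> 1 / real (i div n)"
          using i j by (simp add: field_simps)
        then have "(real n / real i) powr s \<le> (1 / real (i div n)) powr s"
          using assms by (intro powr_mono2) auto
        also have "\<dots> = b (i div n)" using False by (simp add: b_def powr_divide powr_minus field_simps)
        finally show ?thesis by simp
      qed (simp add: b_def)
    qed
    also have "\<dots> \<le> (\<Sum>i<Suc D * n. b (i div n))"
    proof (rule sum_mono2)
      have "D < Suc D * n" using n by (cases n) auto
      then show "{1..D} \<subseteq> {..<Suc D * n}" by auto
    qed (auto simp: b0)
    also have "\<dots> = (\<Sum>m<Suc D. \<Sum>i\<in>{m * n..<m * n + n}. b (i div n))"
      by (rule sum.nat_group[symmetric])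
    also have "\<dots> = (\<Sum>m<Suc D. real n * b m)"
    proof (rule sum.cong[OF refl])
      fix m
      have "i div n = m" if "i \<in> {m * n..<m * n + n}" for i
        using that by (intro div_nat_eqI) (auto simp: mult.commute)
      then have "(\<Sum>i\<in>{m * n..<m * n + n}. b (i div n)) = (\<Sum>i\<in>{m * n..<m * n + n}. b m)"
        by (intro sum.cong refl) simp
      then show "(\<Sum>i\<in>{m * n..<m * n + n}. b (i div n)) = real n * b m" by simp
    qed
    also have "\<dots> = real n * (\<Sum>m<Suc D. b m)" by (rule sum_distrib_left[symmetric])
    also have "\<dots> \<le> real n * suminf b"
      by (intro mult_left_mono sum_le_suminf \<open>summable b\<close>) (auto simp: b0)
    finally show ?thesis .
  qed
  moreover have "0 < suminf b"
    using \<open>summable b\<close> by (rule suminf_pos2[where i = 0]) (auto simp: b_def)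
  ultimately show ?thesis using that by blast
qed

context singular_decomposition
begin

text \<open>With exponent \<open>1 + 2\<mu>\<close>, the squared singular value is
  \<open>\<rho>^(-(1+2\<mu>)) * (\<rho> * lam^2)^(1+2\<mu>) * lam^(-4\<mu>)\<close>. The middle
  factor is absorbed by the exponential and the last one by the source condition.\<close>

lemma bias_bound:
  assumes f: "f \<in> carrier_vec P" and R: "source_norm D lam v \<mu> f \<le> R" and "0 < \<mu>" "0 < \<rho>"
  shows "(\<Sum>i=1..D. exp (- (\<rho> * nodes i)) * ((A *\<^sub>v f) \<bullet> u i)\<^sup>2)
    \<le> (1 + 2 * \<mu>) powr (1 + 2 * \<mu>) * (\<rho> powr (- (1 + 2 * \<mu>)) * R\<^sup>2)"
proof -
  let ?s = "1 + 2 * \<mu>"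
  let ?S = "\<Sum>i=1..D. lam i powr (- 4 * \<mu>) * (f \<bullet> v i)\<^sup>2"
  have S0: "0 \<le> ?S" by (intro sum_nonneg) auto
  have "sqrt ?S \<le> R" using R by (simp add: source_norm_def)
  then have "(sqrt ?S)\<^sup>2 \<le> R\<^sup>2" using S0 by (intro power_mono) auto
  then have S: "?S \<le> R\<^sup>2" using S0 by simp
  have "(\<Sum>i=1..D. exp (- (\<rho> * nodes i)) * ((A *\<^sub>v f) \<bullet> u i)\<^sup>2)
      \<le> (\<Sum>i=1..D. ?s powr ?s * \<rho> powr (- ?s) * (lam i powr (- 4 * \<mu>) * (f \<bullet> v i)\<^sup>2))"
  proof (rule sum_mono)
    fix i assume i: "i \<in> {1..D}"
    have l: "0 < lam i" by (rule lam_pos[OF i])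
    have "nodes i = lam i powr (2 * ?s) * lam i powr (- 4 * \<mu>)"
      using l by (simp add: powr_add[symmetric] algebra_simps powr_numeral)
    also have "lam i powr (2 * ?s) = nodes i powr ?s"
    proof -
      have "nodes i = lam i powr 2" using l by (simp add: powr_numeral)
      then show ?thesis by (simp only: powr_powr)
    qed
    also have "nodes i powr ?s = \<rho> powr (- ?s) * (\<rho> * nodes i) powr ?s"
      using l assms by (simp add: powr_mult powr_add[symmetric] mult.assoc[symmetric])
    finally have n: "nodes i = \<rho> powr (- ?s) * (\<rho> * nodes i) powr ?s * lam i powr (- 4 * \<mu>)" .
    have "(\<rho> * nodes i) powr ?s * exp (- (\<rho> * nodes i)) \<le> ?s powr ?s"
      using assms l by (intro powr_times_exp_le) auto
    then have "((\<rho> * nodes i) powr ?s * exp (- (\<rho> * nodes i))) * (\<rho> powr (- ?s) * (lam i powr (- 4 * \<mu>) * (f \<bullet> v i)\<^sup>2))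
        \<le> ?s powr ?s * (\<rho> powr (- ?s) * (lam i powr (- 4 * \<mu>) * (f \<bullet> v i)\<^sup>2))"
      by (intro mult_right_mono) auto
    moreover have "exp (- (\<rho> * nodes i)) * ((A *\<^sub>v f) \<bullet> u i)\<^sup>2 = exp (- (\<rho> * nodes i)) * nodes i * (f \<bullet> v i)\<^sup>2"
      unfolding A_mult_component[OF f i] by (simp add: power_mult_distrib)
    moreover have "\<dots> = ((\<rho> * nodes i) powr ?s * exp (- (\<rho> * nodes i))) * (\<rho> powr (- ?s) * (lam i powr (- 4 * \<mu>) * (f \<bullet> v i)\<^sup>2))"
      by (subst (2) n) (simp only: mult_ac)
    ultimately show "exp (- (\<rho> * nodes i)) * ((A *\<^sub>v f) \<bullet> u i)\<^sup>2
        \<le> ?s powr ?s * \<rho> powr (- ?s) * (lam i powr (- 4 * \<mu>) * (f \<bullet> v i)\<^sup>2)"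
      by (simp only: mult.assoc)
  qed
  also have "\<dots> = ?s powr ?s * (\<rho> powr (- ?s) * ?S)"
    by (simp only: sum_distrib_left[symmetric] mult.assoc)
  also have "\<dots> \<le> ?s powr ?s * (\<rho> powr (- ?s) * R\<^sup>2)"
    using S by (intro mult_left_mono) auto
  finally show ?thesis .
qed

end

lemma stopped_cg_upper_bound:
  assumes "0 < \<mu>" "1 / 2 < p" "0 < C\<^sub>A" "0 \<le> C\<^sub>\<kappa>"
  shows "\<exists>C>0. \<forall>D P A lam u v \<delta> \<kappa> R f.
        cg_setting p C\<^sub>A C\<^sub>\<kappa> D P A lam u v \<delta> \<kappa> \<and> 1 \<le> R \<and>
        f \<in> carrier_vec P \<and> source_norm D lam v \<mu> f \<le> R \<longrightarrow>
        pred_risk A \<delta> (stopped_cg A lam u \<kappa>) f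
          \<le> ennreal (C * (pred_rate \<mu> p R \<delta> + \<delta>\<^sup>2 * sqrt (real D)))"
proof -
  have "1 < 2 * p" using assms by simp
  then obtain Z where Z: "0 < Z" "\<And>D n. 0 < n \<Longrightarrow> (\<Sum>i=1..D. min 1 ((real n / real i) powr (2 * p))) \<le> real n * Z"
    by (rule sum_min_powr_le) blast
  let ?s = "1 + 2 * \<mu>"
  let ?K = "Z * (C\<^sub>A powr (1 / p) + 1)"
  define q where "q = 4 * \<mu> * p + 2 * p + 1"
  have q: "0 < q" using assms by (simp add: q_def add_pos_pos)
  define C where "C = 52 * ?s powr ?s + 576 * ?K + (261 + 2 * C\<^sub>\<kappa>)"
  have "0 \<le> 52 * ?s powr ?s" "0 \<le> 576 * ?K" using Z(1) by auto
  then have "0 < C" unfolding C_def using assms(4) by linarith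
  moreover have "pred_risk A \<delta> (stopped_cg A lam u \<kappa>) f
          \<le> ennreal (C * (pred_rate \<mu> p R \<delta> + \<delta>\<^sup>2 * sqrt (real D)))"
    if set: "cg_setting p C\<^sub>A C\<^sub>\<kappa> D P A lam u v \<delta> \<kappa>" and R: "1 \<le> R"
      and f: "f \<in> carrier_vec P" "source_norm D lam v \<mu> f \<le> R" for D P A lam u v \<delta> \<kappa> R f
  proof -
    have D: "0 < D" and \<delta>: "0 < \<delta>" "\<delta> < 1" and \<kappa>: "0 < \<kappa>" "\<bar>\<kappa> - \<delta>\<^sup>2 * real D\<bar> \<le> C\<^sub>\<kappa> * \<delta>\<^sup>2 * sqrt (real D)"
      and lam: "\<And>i. i \<in> {1..D} \<Longrightarrow> lam i \<le> C\<^sub>A * real i powr (- p)"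
      using set by (auto simp: cg_setting_def)
    interpret singular_decomposition A D P lam u v
      using set by unfold_locales (auto simp: cg_setting_def)
    define E where "E = (R\<^sup>2 / \<delta>\<^sup>2) powr (1 / q)"
    have "\<delta>\<^sup>2 \<le> R\<^sup>2" using \<delta> R by (intro power_mono) auto
    then have ratio: "1 \<le> R\<^sup>2 / \<delta>\<^sup>2" using \<delta> by simp
    then have E: "1 \<le> E" unfolding E_def using q by (simp add: ge_one_powr_ge_zero)
    \<comment> \<open>The solution of
      \<open>\<rho>^(-(1+2\<mu>)) * R^2 = \<delta>^2 * \<rho>^(1/(2p))\<close>: by
      \<open>2p(1+2\<mu>) = q - 1\<close> both sides equal \<open>\<delta>^2 * E\<close>.\<close>
    define \<rho> where "\<rho> = E powr (2 * p)"
    have \<rho>: "0 < \<rho>" using E by (simp add: \<rho>_def)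
    have rate: "pred_rate \<mu> p R \<delta> = \<delta>\<^sup>2 * E"
      unfolding E_def q_def using assms \<delta> R by (intro pred_rate_eq) auto
    have bias: "\<rho> powr (- ?s) * R\<^sup>2 = \<delta>\<^sup>2 * E"
    proof -
      have "\<rho> powr (- ?s) = E powr (1 - q)"
        by (simp add: \<rho>_def powr_powr q_def algebra_simps)
      also have "\<dots> = E / E powr q" using E by (simp add: powr_diff)
      also have "E powr q = R\<^sup>2 / \<delta>\<^sup>2" using ratio q by (simp add: E_def powr_powr)
      finally show ?thesis using R \<delta> by simp
    qed
    \<comment> \<open>The spectral decay gives
      \<open>\<rho> * lam i ^ 2 \<le> (E * C_A^(1/p) / i)^(2p)\<close>; \<open>n\<close> is an
      integer majorant of the numerator, still of order \<open>E\<close>.\<close>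
    define n where "n = Suc (nat \<lfloor>E * C\<^sub>A powr (1 / p)\<rfloor>)"
    have n: "E * C\<^sub>A powr (1 / p) \<le> real n" "real n \<le> E * (C\<^sub>A powr (1 / p) + 1)"
    proof -
      have "0 \<le> E * C\<^sub>A powr (1 / p)" using E by simp
      then show "E * C\<^sub>A powr (1 / p) \<le> real n" unfolding n_def by linarith
      have "real n \<le> E * C\<^sub>A powr (1 / p) + 1"
        using \<open>0 \<le> E * C\<^sub>A powr (1 / p)\<close> unfolding n_def by linarith
      then show "real n \<le> E * (C\<^sub>A powr (1 / p) + 1)" using E by (simp add: distrib_left)
    qed
    have var: "(\<Sum>i=1..D. min 1 (\<rho> * nodes i)) \<le> E * ?K"
    proof -
      have "(\<Sum>i=1..D. min 1 (\<rho> * nodes i)) \<le> (\<Sum>i=1..D. min 1 ((real n / real i) powr (2 * p)))"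
      proof (intro sum_mono min.mono order_refl)
        fix i assume i: "i \<in> {1..D}"
        then have ri: "0 < real i" by simp
        have "nodes i \<le> (C\<^sub>A * real i powr (- p))\<^sup>2"
          using lam[OF i] lam_pos[OF i] by (intro power_mono) auto
        then have "\<rho> * nodes i \<le> \<rho> * (C\<^sub>A * real i powr (- p))\<^sup>2"
          using \<rho> by simp
        also have "(C\<^sub>A * real i powr (- p))\<^sup>2 = (C\<^sub>A powr (1 / p) / real i) powr (2 * p)"
        proof -
          have "(C\<^sub>A * real i powr (- p))\<^sup>2 = (C\<^sub>A * real i powr (- p)) powr 2"
            using assms ri by (simp add: powr_numeral)
          also have "\<dots> = C\<^sub>A powr 2 * real i powr (- (2 * p))"
            using assms ri by (simp add: powr_mult powr_powr mult.commute)
          also have "C\<^sub>A powr 2 = (C\<^sub>A powr (1 / p)) powr (2 * p)"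
            using assms by (simp add: powr_powr)
          finally show ?thesis using assms ri by (simp add: powr_divide powr_minus field_simps)
        qed
        also have "\<rho> * \<dots> = (E * C\<^sub>A powr (1 / p) / real i) powr (2 * p)"
          unfolding \<rho>_def times_divide_eq_right[symmetric] using E by (subst powr_mult) auto
        also have "\<dots> \<le> (real n / real i) powr (2 * p)"
          using n(1) ri E assms by (intro powr_mono2 divide_right_mono) auto
        finally show "\<rho> * nodes i \<le> (real n / real i) powr (2 * p)" .
      qed
      also have "\<dots> \<le> real n * Z" by (rule Z(2)) (simp add: n_def)
      also have "\<dots> \<le> E * (C\<^sub>A powr (1 / p) + 1) * Z" using n(2) Z(1) by (intro mult_right_mono) auto
      finally show ?thesis by (simp add: mult_ac)
    qed
    have "pred_risk A \<delta> (stopped_cg A lam u \<kappa>) f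
      \<le> ennreal (52 * (\<Sum>i=1..D. exp (- (\<rho> * nodes i)) * ((A *\<^sub>v f) \<bullet> u i)\<^sup>2)
        + 576 * \<delta>\<^sup>2 * (\<Sum>i=1..D. min 1 (\<rho> * nodes i)) + (261 + 2 * C\<^sub>\<kappa>) * (\<delta>\<^sup>2 * sqrt (real D)))"
      by (rule stopped_cg_risk[OF f(1) D \<delta>(1) \<kappa>(1) \<rho> assms(4) \<kappa>(2)])
    also have "\<dots> \<le> ennreal (52 * (?s powr ?s * (\<delta>\<^sup>2 * E))
        + 576 * \<delta>\<^sup>2 * (E * ?K) + (261 + 2 * C\<^sub>\<kappa>) * (\<delta>\<^sup>2 * sqrt (real D)))"
      using bias_bound[OF f assms(1) \<rho>] var unfolding bias
      by (intro ennreal_leI add_mono mult_left_mono order_refl) auto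
    also have "\<dots> \<le> ennreal (C * (\<delta>\<^sup>2 * E + \<delta>\<^sup>2 * sqrt (real D)))"
    proof (rule ennreal_leI)
      define c1 where "c1 = 52 * ?s powr ?s + 576 * ?K"
      define c2 where "c2 = 261 + 2 * C\<^sub>\<kappa>"
      have c: "0 \<le> c1" "0 \<le> c2" "C = c1 + c2"
        using Z(1) assms(4) by (auto simp: c1_def c2_def C_def)
      have "0 \<le> c1 * (\<delta>\<^sup>2 * sqrt (real D))" "0 \<le> c2 * (\<delta>\<^sup>2 * E)" using c E by auto
      then have "c1 * (\<delta>\<^sup>2 * E) + c2 * (\<delta>\<^sup>2 * sqrt (real D)) \<le> C * (\<delta>\<^sup>2 * E + \<delta>\<^sup>2 * sqrt (real D))"
        unfolding c(3) distrib_left distrib_right by linarith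
      then show "52 * (?s powr ?s * (\<delta>\<^sup>2 * E)) + 576 * \<delta>\<^sup>2 * (E * ?K)
          + (261 + 2 * C\<^sub>\<kappa>) * (\<delta>\<^sup>2 * sqrt (real D)) \<le> C * (\<delta>\<^sup>2 * E + \<delta>\<^sup>2 * sqrt (real D))"
        unfolding c1_def c2_def by (simp add: algebra_simps)
    qed
    finally show ?thesis unfolding rate .
  qed
  ultimately show ?thesis by blast
qed

section \<open>Minimax lower bound\<close>

context singular_decomposition
begin

lemma vec_eq_by_components:
  assumes "w \<in> carrier_vec D" "w' \<in> carrier_vec D" "\<And>i. i \<in> {1..D} \<Longrightarrow> w \<bullet> u i = w' \<bullet> u i"
  shows "w = w'"
proof -
  have c: "w - w' \<in> carrier_vec D" using assms by auto
  have "(w - w') \<bullet> u i = 0" if "i \<in> {1..D}" for i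
    using assms u_carrier[OF that] that by (simp add: minus_scalar_prod_distrib[of _ D])
  then have "sqnorm (w - w') = 0" using parseval[OF c] by simp
  then have "(\<Sum>l<D. (w $ l - w' $ l)\<^sup>2) = 0" using assms by (simp add: sqnorm_eq_sum)
  then have "\<forall>l<D. w $ l = w' $ l" by (subst (asm) sum_nonneg_eq_0_iff) auto
  then show ?thesis using assms by (intro eq_vecI) auto
qed

end

lemma borel_vec_affine:
  assumes w: "w \<in> carrier_vec D"
  shows "(\<lambda>z. w + \<delta> \<cdot>\<^sub>v z) \<in> borel_vec D \<rightarrow>\<^sub>M borel_vec D"
proof (rule measurable_borel_vecI)
  fix i assume i: "i < D"
  have "(\<lambda>z. w $ i + \<delta> * z $ i) \<in> borel_measurable (borel_vec D)"
    by (intro borel_measurable_add borel_measurable_times borel_vec_component borel_measurable_const i)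
  then show "(\<lambda>z. (w + \<delta> \<cdot>\<^sub>v z) $ i) \<in> borel_measurable (borel_vec D)"
    by (rule measurable_cong[THEN iffD1, rotated]) (use i w in auto)
qed (use w in auto)

text \<open>After a Cameron-Martin shift both experiments live on the same probability space, where the two
  squared errors add up to at least \<open>2 b\<^sup>2\<close>.\<close>

lemma two_point_lower_bound:
  assumes h: "h \<in> borel_measurable (borel_vec D)" and y0: "y0 \<in> carrier_vec D" and u: "u \<in> carrier_vec D"
    and u1: "u \<bullet> u = 1" and \<delta>: "0 < \<delta>" and b: "(b / \<delta>)\<^sup>2 \<le> 1 / 16"
  shows "ennreal (b\<^sup>2 / 4) \<le>
    (\<integral>\<^sup>+ z. ennreal ((h (y0 + b \<cdot>\<^sub>v u + \<delta> \<cdot>\<^sub>v z) - b)\<^sup>2) \<partial>std_gaussian_vec D)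
    + (\<integral>\<^sup>+ z. ennreal ((h (y0 - b \<cdot>\<^sub>v u + \<delta> \<cdot>\<^sub>v z) + b)\<^sup>2) \<partial>std_gaussian_vec D)"
  (is "_ \<le> ?L")
proof -
  have dim: "dim_vec y0 = D" "dim_vec u = D" using y0 u by auto
  define a where "a l = b / \<delta> * u $ l" for l
  define \<theta> where "\<theta> = (b / \<delta>)\<^sup>2"
  define k where "k z = h (y0 + \<delta> \<cdot>\<^sub>v vec D z)" for z
  have hm: "(\<lambda>z. h (w + \<delta> \<cdot>\<^sub>v z)) \<in> borel_measurable (borel_vec D)" if "w \<in> carrier_vec D" for w
    by (rule measurable_compose[OF borel_vec_affine[OF that] h])
  have k [measurable]: "k \<in> borel_measurable (gauss D)"
    unfolding k_def by (rule measurable_compose[OF measurable_vec_gauss hm[OF y0]])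
  have a1: "(\<Sum>l<D. (a l)\<^sup>2) = \<theta>"
  proof -
    have "(\<Sum>l<D. (u $ l)\<^sup>2) = 1"
      using u1 dim by (simp add: scalar_prod_def lessThan_atLeast0 power2_eq_square)
    moreover have "(\<Sum>l<D. (a l)\<^sup>2) = \<theta> * (\<Sum>l<D. (u $ l)\<^sup>2)"
      by (simp only: a_def \<theta>_def power_mult_distrib sum_distrib_left)
    ultimately show ?thesis by simp
  qed
  have shift: "(\<integral>\<^sup>+ z. ennreal ((h (y0 + (s * b) \<cdot>\<^sub>v u + \<delta> \<cdot>\<^sub>v z) - s * b)\<^sup>2) \<partial>std_gaussian_vec D)
      = (\<integral>\<^sup>+ z. ennreal ((k z - s * b)\<^sup>2 * exp (s * lin D a z - \<theta> / 2)) \<partial>gauss D)"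
    if s: "s\<^sup>2 = 1" for s
  proof -
    have "(\<integral>\<^sup>+ z. ennreal ((h (y0 + (s * b) \<cdot>\<^sub>v u + \<delta> \<cdot>\<^sub>v z) - s * b)\<^sup>2) \<partial>std_gaussian_vec D)
        = (\<integral>\<^sup>+ z. ennreal ((h (y0 + (s * b) \<cdot>\<^sub>v u + \<delta> \<cdot>\<^sub>v vec D z) - s * b)\<^sup>2) \<partial>gauss D)"
      by (rule nn_integral_std_gaussian_vec)
        (intro measurable_compose[OF _ measurable_ennreal] borel_measurable_power borel_measurable_diff hm
          borel_measurable_const, use y0 u in auto)
    also have "\<dots> = (\<integral>\<^sup>+ z. ennreal ((k (\<lambda>l\<in>{..<D}. z l + s * a l) - s * b)\<^sup>2) \<partial>gauss D)"
    proof (intro nn_integral_cong)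
      fix z
      have "y0 + (s * b) \<cdot>\<^sub>v u + \<delta> \<cdot>\<^sub>v vec D z = y0 + \<delta> \<cdot>\<^sub>v vec D (\<lambda>l\<in>{..<D}. z l + s * a l)"
        using dim \<delta> by (intro eq_vecI) (auto simp: a_def field_simps)
      then show "ennreal ((h (y0 + (s * b) \<cdot>\<^sub>v u + \<delta> \<cdot>\<^sub>v vec D z) - s * b)\<^sup>2)
          = ennreal ((k (\<lambda>l\<in>{..<D}. z l + s * a l) - s * b)\<^sup>2)"
        by (simp add: k_def)
    qed
    also have "\<dots> = (\<integral>\<^sup>+ z. ennreal ((k z - s * b)\<^sup>2)
        * ennreal (exp (lin D (\<lambda>l. s * a l) z - (\<Sum>l<D. (s * a l)\<^sup>2) / 2)) \<partial>gauss D)"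
      by (rule Cameron_Martin_gauss) measurable
    also have "\<dots> = (\<integral>\<^sup>+ z. ennreal ((k z - s * b)\<^sup>2 * exp (s * lin D a z - \<theta> / 2)) \<partial>gauss D)"
    proof (intro nn_integral_cong)
      fix z
      have "(\<Sum>l<D. (s * a l)\<^sup>2) = \<theta>" using s a1 by (simp add: power_mult_distrib)
      then show "ennreal ((k z - s * b)\<^sup>2) * ennreal (exp (lin D (\<lambda>l. s * a l) z - (\<Sum>l<D. (s * a l)\<^sup>2) / 2))
          = ennreal ((k z - s * b)\<^sup>2 * exp (s * lin D a z - \<theta> / 2))"
        by (simp add: ennreal_mult sum_distrib_left mult.assoc)
    qed
    finally show ?thesis .
  qed
  have minus: "y0 - b \<cdot>\<^sub>v u = y0 + (- 1 * b) \<cdot>\<^sub>v u" using dim by (intro eq_vecI) auto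
  have L: "?L = (\<integral>\<^sup>+ z. ennreal ((k z - b)\<^sup>2 * exp (lin D a z - \<theta> / 2)) \<partial>gauss D)
      + (\<integral>\<^sup>+ z. ennreal ((k z + b)\<^sup>2 * exp (- lin D a z - \<theta> / 2)) \<partial>gauss D)"
    using shift[of 1] shift[of "- 1"] unfolding minus by simp
  \<comment> \<open>Both exponentials are replaced by their common minorant
    \<open>exp (- |t| - \<theta>/2)\<close> and linearised. Completing the square trades
    \<open>|t|\<close> for \<open>t^2\<close>, whose mean is at most
    \<open>8\<theta>\<close>.\<close>
  have pt: "b\<^sup>2 * (1 - \<theta>) \<le> (K - b)\<^sup>2 * exp (t - \<theta> / 2) + (K + b)\<^sup>2 * exp (- t - \<theta> / 2) + b\<^sup>2 * t\<^sup>2" for K t :: real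
  proof -
    let ?e = "exp (- \<bar>t\<bar> - \<theta> / 2)"
    have "2 * b\<^sup>2 * ?e \<le> ((K - b)\<^sup>2 + (K + b)\<^sup>2) * ?e"
      by (intro mult_right_mono) (auto simp: power2_eq_square algebra_simps)
    also have "\<dots> = (K - b)\<^sup>2 * ?e + (K + b)\<^sup>2 * ?e" by (rule distrib_right)
    also have "\<dots> \<le> (K - b)\<^sup>2 * exp (t - \<theta> / 2) + (K + b)\<^sup>2 * exp (- t - \<theta> / 2)"
      by (intro add_mono mult_left_mono) auto
    finally have 1: "2 * b\<^sup>2 * ?e \<le> (K - b)\<^sup>2 * exp (t - \<theta> / 2) + (K + b)\<^sup>2 * exp (- t - \<theta> / 2)" .
    have "1 + (- \<bar>t\<bar> - \<theta> / 2) \<le> ?e" by (rule exp_ge_add_one_self)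
    then have "2 * b\<^sup>2 * (1 + (- \<bar>t\<bar> - \<theta> / 2)) \<le> 2 * b\<^sup>2 * ?e" by (intro mult_left_mono) auto
    moreover have "0 \<le> b\<^sup>2 * (\<bar>t\<bar> - 1)\<^sup>2" by simp
    then have "b\<^sup>2 * (1 - \<theta>) \<le> 2 * b\<^sup>2 * (1 + (- \<bar>t\<bar> - \<theta> / 2)) + b\<^sup>2 * t\<^sup>2"
      by (simp add: power2_diff algebra_simps)
    ultimately show ?thesis using 1 by linarith
  qed
  have prob: "emeasure (gauss D) (space (gauss D)) = 1" by (rule prob_space.emeasure_space_1[OF prob_space_gauss])
  have "ennreal (b\<^sup>2 * (1 - \<theta>)) = (\<integral>\<^sup>+ z. ennreal (b\<^sup>2 * (1 - \<theta>)) \<partial>gauss D)"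
    using prob by simp
  also have "\<dots> \<le> (\<integral>\<^sup>+ z. ennreal ((k z - b)\<^sup>2 * exp (lin D a z - \<theta> / 2))
      + ennreal ((k z + b)\<^sup>2 * exp (- lin D a z - \<theta> / 2)) + ennreal (b\<^sup>2 * (lin D a z)\<^sup>2) \<partial>gauss D)"
  proof (rule nn_integral_mono)
    fix z
    have "ennreal x + ennreal y + ennreal w = ennreal (x + y + w)" if "0 \<le> x" "0 \<le> y" "0 \<le> w" for x y w
      using that by simp
    then show "ennreal (b\<^sup>2 * (1 - \<theta>)) \<le> ennreal ((k z - b)\<^sup>2 * exp (lin D a z - \<theta> / 2))
        + ennreal ((k z + b)\<^sup>2 * exp (- lin D a z - \<theta> / 2)) + ennreal (b\<^sup>2 * (lin D a z)\<^sup>2)"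
      using ennreal_leI[OF pt[of "k z" "lin D a z"]] by simp
  qed
  also have "\<dots> = ?L + (\<integral>\<^sup>+ z. ennreal (b\<^sup>2 * (lin D a z)\<^sup>2) \<partial>gauss D)"
    unfolding L by (simp add: nn_integral_add)
  also have "(\<integral>\<^sup>+ z. ennreal (b\<^sup>2 * (lin D a z)\<^sup>2) \<partial>gauss D) \<le> ennreal (b\<^sup>2 * (8 * \<theta>))"
  proof -
    have "mean_le (gauss D) (\<lambda>z. (lin D a z)\<^sup>2) (8 * \<theta>)"
      using gauss_moment_bounds(1)[of D a] unfolding a1 by (simp add: mean_le_def \<theta>_def)
    from mean_le_cmult[OF this, of "b\<^sup>2"] show ?thesis by (simp add: mean_le_def)
  qed
  finally have main: "ennreal (b\<^sup>2 * (1 - \<theta>)) \<le> ?L + ennreal (b\<^sup>2 * (8 * \<theta>))"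
    by (simp add: add_left_mono)
  \<comment> \<open>\<open>1 - 9\<theta> \<ge> 7/16\<close> since
    \<open>\<theta> \<le> 1/16\<close>.\<close>
  have "b\<^sup>2 / 4 + b\<^sup>2 * (8 * \<theta>) \<le> b\<^sup>2 * (1 - \<theta>)"
  proof -
    have "b\<^sup>2 * \<theta> \<le> b\<^sup>2 * (1 / 16)" using b by (intro mult_left_mono) (auto simp: \<theta>_def)
    moreover have "b\<^sup>2 * (1 - \<theta>) = b\<^sup>2 - b\<^sup>2 * \<theta>" "b\<^sup>2 * (8 * \<theta>) = 8 * (b\<^sup>2 * \<theta>)"
      by (simp_all add: algebra_simps)
    ultimately show ?thesis using zero_le_power2[of b] by linarith
  qed
  then have "ennreal (b\<^sup>2 / 4) + ennreal (b\<^sup>2 * (8 * \<theta>)) \<le> ?L + ennreal (b\<^sup>2 * (8 * \<theta>))"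
    using main by (subst ennreal_plus[symmetric]) (auto simp: \<theta>_def simp del: ennreal_plus intro: order_trans[OF ennreal_leI])
  then show ?thesis by (simp add: ennreal_add_left_cancel_le add.commute)
qed

context singular_decomposition
begin

definition sgn_of :: "nat set \<Rightarrow> nat \<Rightarrow> real" where
  "sgn_of S i = (if i \<in> S then 1 else - 1)"

text \<open>Dividing by the singular values makes the image under \<open>A\<close> a vertex of a
  cube of half-side \<open>b\<close> in the coordinates \<open>u 1, ..., u n\<close>, with signs
  encoded by \<open>S\<close>.\<close>

definition hypothesis :: "nat \<Rightarrow> real \<Rightarrow> nat set \<Rightarrow> real vec" where
  "hypothesis n b S = vec P (\<lambda>l. \<Sum>i=1..n. sgn_of S i * b / lam i * v i $ l)"

lemma hypothesis_carrier: "hypothesis n b S \<in> carrier_vec P"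
  by (simp add: hypothesis_def)

lemma hypothesis_component:
  assumes "n \<le> D" "j \<in> {1..D}"
  shows "hypothesis n b S \<bullet> v j = (if j \<le> n then sgn_of S j * b / lam j else 0)"
proof -
  have "dim_vec (v j) = P" using v_carrier[OF assms(2)] by auto
  then have "hypothesis n b S \<bullet> v j = (\<Sum>l<P. \<Sum>i=1..n. sgn_of S i * b / lam i * (v i $ l * v j $ l))"
    by (simp add: hypothesis_def scalar_prod_def lessThan_atLeast0 sum_distrib_right mult.assoc)
  also have "\<dots> = (\<Sum>i=1..n. sgn_of S i * b / lam i * (\<Sum>l<P. v i $ l * v j $ l))"
    unfolding sum_distrib_left by (rule sum.swap)
  also have "\<dots> = (\<Sum>i=1..n. if i = j then sgn_of S i * b / lam i else 0)"
  proof (intro sum.cong refl)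
    fix i assume "i \<in> {1..n}"
    then have "i \<in> {1..D}" using assms(1) by auto
    from v_orth[OF this assms(2)] have "(\<Sum>l<P. v i $ l * v j $ l) = (if i = j then 1 else 0)"
      using \<open>dim_vec (v j) = P\<close> by (simp add: scalar_prod_def lessThan_atLeast0)
    then show "sgn_of S i * b / lam i * (\<Sum>l<P. v i $ l * v j $ l) = (if i = j then sgn_of S i * b / lam i else 0)"
      by simp
  qed
  also have "\<dots> = (if j \<le> n then sgn_of S j * b / lam j else 0)" using assms(2) by (simp add: sum.delta')
  finally show ?thesis .
qed

lemma A_hypothesis_component:
  assumes "n \<le> D" "j \<in> {1..D}"
  shows "(A *\<^sub>v hypothesis n b S) \<bullet> u j = (if j \<le> n then sgn_of S j * b else 0)"
  using lam_pos[OF assms(2)]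
  by (simp add: A_mult_component[OF hypothesis_carrier assms(2)] hypothesis_component[OF assms])

lemma A_carrier: "f \<in> carrier_vec P \<Longrightarrow> A *\<^sub>v f \<in> carrier_vec D"
  using A by auto

lemma hypercube_lower_bound:
  assumes F: "F \<in> estimators A" and n: "n \<le> D" and \<delta>: "0 < \<delta>" and b: "(b / \<delta>)\<^sup>2 \<le> 1 / 16"
    and \<F>: "\<And>S. S \<subseteq> {1..n} \<Longrightarrow> hypothesis n b S \<in> \<F>"
  shows "ennreal (real n * b\<^sup>2 / 8) \<le> max_pred_risk A \<delta> F \<F>"
proof (cases "n = 0")
  case False
  define h where "h i y = lam i * (F y \<bullet> v i)" for i y
  define Y where "Y S z = A *\<^sub>v hypothesis n b S + \<delta> \<cdot>\<^sub>v z" for S z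
  define E where "E S i = (\<integral>\<^sup>+ z. ennreal ((h i (Y S z) - sgn_of S i * b)\<^sup>2) \<partial>std_gaussian_vec D)" for S i
  let ?X = "max_pred_risk A \<delta> F \<F>"
  have F_meas: "F \<in> borel_vec D \<rightarrow>\<^sub>M borel_vec P" using F by (simp add: estimators_def dims)
  have h_meas: "h i \<in> borel_measurable (borel_vec D)" if "i \<in> {1..D}" for i
    unfolding h_def using v_carrier[OF that]
    by (intro borel_measurable_times borel_measurable_const measurable_compose[OF F_meas borel_vec_scalar_prod]) auto
  have Y_meas: "Y S \<in> std_gaussian_vec D \<rightarrow>\<^sub>M borel_vec D" for S
    unfolding Y_def measurable_cong_sets[OF sets_std_gaussian_vec refl]
    by (rule borel_vec_affine[OF A_carrier[OF hypothesis_carrier]])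
  have risk: "(\<Sum>i=1..n. E S i) \<le> ?X" if S: "S \<subseteq> {1..n}" for S
  proof -
    have "(\<Sum>i=1..n. E S i) = (\<integral>\<^sup>+ z. (\<Sum>i=1..n. ennreal ((h i (Y S z) - sgn_of S i * b)\<^sup>2)) \<partial>std_gaussian_vec D)"
      unfolding E_def using n
      by (intro nn_integral_sum[symmetric] measurable_compose[OF _ measurable_ennreal] borel_measurable_power
          borel_measurable_diff borel_measurable_const measurable_compose[OF Y_meas h_meas]) auto
    also have "\<dots> \<le> pred_risk A \<delta> F (hypothesis n b S)"
      unfolding pred_risk_def dims
    proof (rule nn_integral_mono)
      fix z assume "z \<in> space (std_gaussian_vec D)"
      then have z: "z \<in> carrier_vec D" by simp
      have Yc: "Y S z \<in> space (borel_vec D)"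
        using z A_carrier[OF hypothesis_carrier] by (simp add: Y_def)
      then have Fc: "F (Y S z) \<in> carrier_vec P" using measurable_space[OF F_meas] by simp
      let ?w = "F (Y S z) - hypothesis n b S"
      have wc: "?w \<in> carrier_vec P" using Fc hypothesis_carrier by auto
      have comp: "(A *\<^sub>v ?w) \<bullet> u i = h i (Y S z) - sgn_of S i * b" if i: "i \<in> {1..n}" for i
      proof -
        have iD: "i \<in> {1..D}" using i n by auto
        have "(A *\<^sub>v ?w) \<bullet> u i = lam i * (?w \<bullet> v i)" by (rule A_mult_component[OF wc iD])
        also have "?w \<bullet> v i = F (Y S z) \<bullet> v i - hypothesis n b S \<bullet> v i"
          using Fc hypothesis_carrier v_carrier[OF iD] by (intro minus_scalar_prod_distrib)
        finally show ?thesis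
          using i lam_pos[OF iD] by (simp add: hypothesis_component[OF n iD] h_def right_diff_distrib)
      qed
      have "(\<Sum>i=1..n. (h i (Y S z) - sgn_of S i * b)\<^sup>2) = (\<Sum>i=1..n. ((A *\<^sub>v ?w) \<bullet> u i)\<^sup>2)"
        by (intro sum.cong refl) (simp add: comp)
      also have "\<dots> \<le> (\<Sum>i=1..D. ((A *\<^sub>v ?w) \<bullet> u i)\<^sup>2)"
        using n by (intro sum_mono2) auto
      also have "\<dots> = sqnorm (A *\<^sub>v ?w)" by (rule parseval[OF A_carrier[OF wc], symmetric])
      finally show "(\<Sum>i=1..n. ennreal ((h i (Y S z) - sgn_of S i * b)\<^sup>2))
          \<le> ennreal (sqnorm (A *\<^sub>v (F (A *\<^sub>v hypothesis n b S + \<delta> \<cdot>\<^sub>v z) - hypothesis n b S)))"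
        by (simp add: sum_ennreal Y_def ennreal_leI)
    qed
    also have "\<dots> \<le> ?X" unfolding max_pred_risk_def by (intro SUP_upper \<F> S)
    finally show ?thesis .
  qed
  have pair: "ennreal (b\<^sup>2 / 4) \<le> E (insert i S) i + E S i" if i: "i \<in> {1..n}" and S: "S \<subseteq> {1..n} - {i}" for i S
  proof -
    have iD: "i \<in> {1..D}" using i n by auto
    note uc = u_carrier[OF iD]
    \<comment> \<open>The midpoint between the two mean observations that differ only in the sign of
      coordinate \<open>i\<close>.\<close>
    define y0 where "y0 = A *\<^sub>v hypothesis n b S + b \<cdot>\<^sub>v u i"
    have AS: "A *\<^sub>v hypothesis n b T \<in> carrier_vec D" for T by (rule A_carrier[OF hypothesis_carrier])
    have y0: "y0 \<in> carrier_vec D" using AS uc by (simp add: y0_def)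
    have low: "A *\<^sub>v hypothesis n b S = y0 - b \<cdot>\<^sub>v u i"
      using AS[of S] uc by (intro eq_vecI) (auto simp: y0_def dims)
    have up: "A *\<^sub>v hypothesis n b (insert i S) = y0 + b \<cdot>\<^sub>v u i"
    proof (rule vec_eq_by_components[OF AS])
      show "y0 + b \<cdot>\<^sub>v u i \<in> carrier_vec D" using y0 uc by simp
      fix j assume j: "j \<in> {1..D}"
      have "(y0 + b \<cdot>\<^sub>v u i) \<bullet> u j = (A *\<^sub>v hypothesis n b S) \<bullet> u j + b * (u i \<bullet> u j) + b * (u i \<bullet> u j)"
        unfolding y0_def using AS[of S] uc u_carrier[OF j] by (simp add: add_scalar_prod_distrib[of _ D])
      then show "(A *\<^sub>v hypothesis n b (insert i S)) \<bullet> u j = (y0 + b \<cdot>\<^sub>v u i) \<bullet> u j"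
        unfolding A_hypothesis_component[OF n j] u_orth[OF iD j] using i S by (auto simp: sgn_of_def)
    qed
    have "u i \<bullet> u i = 1" using u_orth[OF iD iD] by simp
    from two_point_lower_bound[OF h_meas[OF iD] y0 uc this \<delta> b]
    show ?thesis
      unfolding E_def Y_def up low using i S by (auto simp: sgn_of_def subset_iff)
  qed
  have card: "card (Pow ({1..n} - {i})) = 2 ^ (n - 1)" if "i \<in> {1..n}" for i
    using that by (simp add: card_Pow)
  \<comment> \<open>Each of the \<open>n\<close> coordinates splits the cube into
    \<open>2^(n-1)\<close> pairs of neighbours, each worth \<open>b^2/4\<close>. Averaging over the
    \<open>2^n\<close> vertices yields \<open>n * b^2 / 8\<close>.\<close>
  have "ennreal (real n * (2 ^ (n - 1) * (b\<^sup>2 / 4))) = (\<Sum>i=1..n. \<Sum>S\<in>Pow ({1..n} - {i}). ennreal (b\<^sup>2 / 4))"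
  proof -
    have "(\<Sum>i=1..n. \<Sum>S\<in>Pow ({1..n} - {i}). ennreal (b\<^sup>2 / 4)) = of_nat n * (of_nat (2 ^ (n - 1)) * ennreal (b\<^sup>2 / 4))"
      by (simp add: card del: of_nat_power)
    also have "\<dots> = ennreal (real n * (real (2 ^ (n - 1)) * (b\<^sup>2 / 4)))"
    proof -
      have *: "of_nat n * (of_nat k * ennreal e) = ennreal (real n * (real k * e))" if "0 \<le> e" for k e
        using that by (simp add: ennreal_of_nat_eq_real_of_nat ennreal_mult)
      show ?thesis by (rule *) simp
    qed
    finally show ?thesis by simp
  qed
  also have "\<dots> \<le> (\<Sum>i=1..n. \<Sum>S\<in>Pow ({1..n} - {i}). E (insert i S) i + E S i)"
    by (intro sum_mono pair) auto
  also have "\<dots> = (\<Sum>i=1..n. \<Sum>S\<in>Pow {1..n}. E S i)"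
  proof (rule sum.cong[OF refl])
    fix i assume i: "i \<in> {1..n}"
    have Pow_eq: "Pow {1..n} = insert i ` Pow ({1..n} - {i}) \<union> Pow ({1..n} - {i})"
      using Pow_insert[of i "{1..n} - {i}"] i by (simp add: insert_absorb Un_commute)
    have "inj_on (insert i) (Pow ({1..n} - {i}))"
      by (intro inj_onI) (metis Diff_iff PowD insert_ident singletonI subset_iff)
    moreover have "insert i ` Pow ({1..n} - {i}) \<inter> Pow ({1..n} - {i}) = {}" by auto
    ultimately have "(\<Sum>S\<in>Pow {1..n}. E S i) = (\<Sum>S\<in>Pow ({1..n} - {i}). E (insert i S) i) + (\<Sum>S\<in>Pow ({1..n} - {i}). E S i)"
      unfolding Pow_eq by (subst sum.union_disjoint) (auto simp: sum.reindex)
    then show "(\<Sum>S\<in>Pow ({1..n} - {i}). E (insert i S) i + E S i) = (\<Sum>S\<in>Pow {1..n}. E S i)"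
      by (simp add: sum.distrib)
  qed
  also have "\<dots> = (\<Sum>S\<in>Pow {1..n}. \<Sum>i=1..n. E S i)" by (rule sum.swap)
  also have "\<dots> \<le> (\<Sum>S\<in>Pow {1..n}. ?X)" by (intro sum_mono risk) auto
  also have "\<dots> = ennreal (2 ^ n) * ?X"
    by (simp add: card_Pow ennreal_of_nat_eq_real_of_nat)
  finally have "ennreal (real n * (2 ^ (n - 1) * (b\<^sup>2 / 4))) \<le> ennreal (2 ^ n) * ?X" .
  also have "real n * (2 ^ (n - 1) * (b\<^sup>2 / 4)) = 2 ^ n * (real n * b\<^sup>2 / 8)"
    using False by (cases n) auto
  also have "ennreal \<dots> = ennreal (2 ^ n) * ennreal (real n * b\<^sup>2 / 8)"
    by (rule ennreal_mult) auto
  finally have "ennreal (2 ^ n) * ennreal (real n * b\<^sup>2 / 8) \<le> ennreal (2 ^ n) * ?X" .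
  then show ?thesis by (subst (asm) ennreal_mult_le_mult_iff) auto
qed simp

end

lemma minimax_lower_bound:
  assumes "0 < \<mu>" "1 / 2 < p" "0 < c\<^sub>A" "0 < K"
  shows "\<exists>C>0. \<forall>D P A lam u v \<delta> R.
        A \<in> carrier_mat D P \<and> singular_system A lam u v \<and> 0 < D \<and> 0 < \<delta> \<and> \<delta> < 1 \<and> 1 \<le> R \<and>
        (\<forall>i\<in>{1..D}. c\<^sub>A * real i powr (- p) \<le> lam i) \<and>
        (R\<^sup>2 / \<delta>\<^sup>2) powr (1 / (4 * \<mu> * p + 2 * p + 1)) \<le> K * real D \<longrightarrow>
        ennreal (pred_rate \<mu> p R \<delta>) \<le> ennreal C * minimax_pred_risk A \<delta> (source_ball A lam v \<mu> R)"
proof -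
  define q where "q = 4 * \<mu> * p + 2 * p + 1"
  have q: "0 < q" using assms by (simp add: q_def add_pos_pos)
  define s where "s = 4 * \<mu> + 2"
  have s: "0 < s" "s * p + 1 = q" using assms by (simp_all add: s_def q_def algebra_simps)
  \<comment> \<open>The ratio of \<open>b\<close> to the noise level: \<open>1/4\<close> keeps
    neighbouring hypotheses statistically close, and the power of the spectral constant keeps the
    cube inside the source ball.\<close>
  define \<theta> where "\<theta> = min (1 / 4) (c\<^sub>A powr (s / 2))"
  have \<theta>: "0 < \<theta>" "\<theta> \<le> 1 / 4" "\<theta> \<le> c\<^sub>A powr (s / 2)" using assms by (auto simp: \<theta>_def)
  \<comment> \<open>The price of capping the effective dimension at \<open>D\<close>, since
    \<open>E \<le> K * D\<close>.\<close>
  define \<eta> where "\<eta> = min 1 (1 / K)"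
  have \<eta>: "0 < \<eta>" "\<eta> \<le> 1" "\<eta> \<le> 1 / K" using assms by (auto simp: \<eta>_def)
  define C where "C = 16 / (\<eta> * \<theta>\<^sup>2)"
  have C: "0 < C" using \<eta> \<theta> by (simp add: C_def)
  moreover have "ennreal (pred_rate \<mu> p R \<delta>) \<le> ennreal C * minimax_pred_risk A \<delta> (source_ball A lam v \<mu> R)"
    if A: "A \<in> carrier_mat D P" "singular_system A lam u v" and D: "0 < D" and \<delta>: "0 < \<delta>" "\<delta> < 1" and R: "1 \<le> R"
      and lam: "\<forall>i\<in>{1..D}. c\<^sub>A * real i powr (- p) \<le> lam i"
      and K: "(R\<^sup>2 / \<delta>\<^sup>2) powr (1 / (4 * \<mu> * p + 2 * p + 1)) \<le> K * real D" for D P A lam u v \<delta> R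
  proof -
    interpret singular_decomposition A D P lam u v using A by unfold_locales
    define E where "E = (R\<^sup>2 / \<delta>\<^sup>2) powr (1 / q)"
    have "\<delta>\<^sup>2 \<le> R\<^sup>2" using \<delta> R by (intro power_mono) auto
    then have ratio: "1 \<le> R\<^sup>2 / \<delta>\<^sup>2" using \<delta> by simp
    then have E: "1 \<le> E" unfolding E_def using q by (simp add: ge_one_powr_ge_zero)
    have rate: "pred_rate \<mu> p R \<delta> = \<delta>\<^sup>2 * E"
      unfolding E_def q_def using assms \<delta> R by (intro pred_rate_eq) auto
    define m where "m = min E (real D)"
    have m: "1 \<le> m" "m \<le> E" "m \<le> real D" using E D by (auto simp: m_def)
    \<comment> \<open>As \<open>m \<ge> 1\<close>, rounding down leaves at least one coordinate and
      loses at most a factor 2.\<close>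
    define n where "n = nat \<lfloor>m\<rfloor>"
    have "1 \<le> \<lfloor>m\<rfloor>" using m(1) by (simp add: le_floor_iff)
    then have n: "real n \<le> m" "m \<le> 2 * real n"
      unfolding n_def by linarith+
    have nD: "n \<le> D" using n(1) m(3) by linarith
    have "\<eta> * E \<le> m"
    proof -
      have "\<eta> * E \<le> 1 * E" using \<eta> E by (intro mult_right_mono) auto
      moreover have "\<eta> * E \<le> 1 / K * (K * real D)"
        using \<eta> E K assms(4) unfolding E_def q_def by (intro mult_mono) auto
      ultimately show ?thesis using assms(4) by (simp add: m_def)
    qed
    then have n_ge: "\<eta> * E \<le> 2 * real n" using n(2) by linarith
    define b where "b = \<delta> * \<theta>"
    have b: "(b / \<delta>)\<^sup>2 \<le> 1 / 16"
      using power_mono[OF \<theta>(2), of 2] \<theta>(1) \<delta> by (simp add: b_def power_divide)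
    \<comment> \<open>Each of the \<open>n\<close> coordinates costs at most
      \<open>b^2 * c_A^(-s) * n^(s * p)\<close>. Because \<open>s * p + 1 = q\<close>, the total is
      governed by \<open>n^q \<le> E^q = R^2/\<delta>^2\<close>.\<close>
    have ball: "hypothesis n b S \<in> source_ball A lam v \<mu> R" for S
    proof -
      have "(\<Sum>i=1..D. lam i powr (- 4 * \<mu>) * (hypothesis n b S \<bullet> v i)\<^sup>2)
          \<le> (\<Sum>i=1..D. if i \<in> {1..n} then c\<^sub>A powr (- s) * real n powr (s * p) * b\<^sup>2 else 0)"
      proof (rule sum_mono)
        fix i assume i: "i \<in> {1..D}"
        show "lam i powr (- 4 * \<mu>) * (hypothesis n b S \<bullet> v i)\<^sup>2
          \<le> (if i \<in> {1..n} then c\<^sub>A powr (- s) * real n powr (s * p) * b\<^sup>2 else 0)"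
        proof (cases "i \<in> {1..n}")
          case True
          note l = lam_pos[OF i]
          have ri: "0 < real i" "real i \<le> real n" using True by auto
          have "(hypothesis n b S \<bullet> v i)\<^sup>2 = b\<^sup>2 * lam i powr (- 2)"
            using True l by (simp add: hypothesis_component[OF nD i] sgn_of_def power_divide
                powr_minus powr_numeral field_simps)
          then have "lam i powr (- 4 * \<mu>) * (hypothesis n b S \<bullet> v i)\<^sup>2 = b\<^sup>2 * lam i powr (- s)"
            by (simp add: s_def powr_add[symmetric] algebra_simps)
          also have "\<dots> \<le> b\<^sup>2 * (c\<^sub>A * real i powr (- p)) powr (- s)"
            using lam i assms ri s by (intro mult_left_mono powr_mono2') auto
          also have "(c\<^sub>A * real i powr (- p)) powr (- s) = c\<^sub>A powr (- s) * real i powr (s * p)"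
            using assms ri by (simp add: powr_mult powr_powr mult.commute)
          also have "b\<^sup>2 * (c\<^sub>A powr (- s) * real i powr (s * p)) \<le> b\<^sup>2 * (c\<^sub>A powr (- s) * real n powr (s * p))"
            using ri s assms by (intro mult_left_mono powr_mono2) auto
          finally show ?thesis using True by (simp add: mult_ac)
        next
          case False
          then show ?thesis using i by (simp add: hypothesis_component[OF nD i])
        qed
      qed
      also have "\<dots> = (\<Sum>i=1..n. c\<^sub>A powr (- s) * real n powr (s * p) * b\<^sup>2)"
        by (rule sum.mono_neutral_cong_right) (use nD in auto)
      also have "\<dots> = c\<^sub>A powr (- s) * (real n * real n powr (s * p)) * b\<^sup>2" by simp
      also have "real n * real n powr (s * p) = real n powr q"
        using n m(1) s(2) powr_add[of "real n" "s * p" 1] by (simp add: mult.commute)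
      also have "c\<^sub>A powr (- s) * real n powr q * b\<^sup>2 \<le> c\<^sub>A powr (- s) * (R\<^sup>2 / \<delta>\<^sup>2) * (\<delta>\<^sup>2 * c\<^sub>A powr s)"
      proof (intro mult_mono)
        have "real n powr q \<le> E powr q" using n(1) m(2) q by (intro powr_mono2) auto
        also have "\<dots> = R\<^sup>2 / \<delta>\<^sup>2" using ratio q by (simp add: E_def powr_powr)
        finally show "real n powr q \<le> R\<^sup>2 / \<delta>\<^sup>2" .
        have "\<theta>\<^sup>2 \<le> (c\<^sub>A powr (s / 2))\<^sup>2" using \<theta> by (intro power_mono) auto
        also have "\<dots> = c\<^sub>A powr s" by (simp add: power2_eq_square powr_add[symmetric])
        finally show "b\<^sup>2 \<le> \<delta>\<^sup>2 * c\<^sub>A powr s" by (simp add: b_def power_mult_distrib mult_left_mono)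
      qed auto
      also have "\<dots> = R\<^sup>2"
      proof -
        have "c\<^sub>A powr (- s) * c\<^sub>A powr s = 1" using assms by (simp add: powr_add[symmetric])
        then show ?thesis using \<delta> by (simp add: field_simps)
      qed
      finally have "source_norm D lam v \<mu> (hypothesis n b S) \<le> sqrt (R\<^sup>2)"
        unfolding source_norm_def by (rule real_sqrt_le_mono)
      then show ?thesis using R hypothesis_carrier by (simp add: source_ball_def dims)
    qed
    have low: "ennreal (real n * b\<^sup>2 / 8) \<le> minimax_pred_risk A \<delta> (source_ball A lam v \<mu> R)"
      unfolding minimax_pred_risk_def
      by (intro INF_greatest hypercube_lower_bound nD \<delta>(1) b ball)
    have "pred_rate \<mu> p R \<delta> \<le> C * (real n * b\<^sup>2 / 8)"
    proof -
      have "E \<le> 2 * real n / \<eta>" using n_ge \<eta>(1) by (simp add: pos_le_divide_eq mult.commute)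
      then have "\<delta>\<^sup>2 * E \<le> \<delta>\<^sup>2 * (2 * real n / \<eta>)" by (intro mult_left_mono) auto
      also have "\<dots> = C * (real n * b\<^sup>2 / 8)"
        unfolding C_def b_def using \<eta> \<theta> by (simp add: power_mult_distrib)
      finally show ?thesis unfolding rate .
    qed
    then have "ennreal (pred_rate \<mu> p R \<delta>) \<le> ennreal C * ennreal (real n * b\<^sup>2 / 8)"
      using C by (simp add: ennreal_mult[symmetric] ennreal_leI)
    also have "\<dots> \<le> ennreal C * minimax_pred_risk A \<delta> (source_ball A lam v \<mu> R)"
      by (intro mult_left_mono low) simp
    finally show ?thesis .
  qed
  ultimately show ?thesis by blast
qed

theorem corollary6p9:
  fixes \<mu> p C\<^sub>A C\<^sub>\<kappa> :: real
  assumes "0 < \<mu>" and "1 / 2 < p" and "0 < C\<^sub>A" and "0 \<le> C\<^sub>\<kappa>"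
  shows
    "(\<exists>C>0. \<forall>D P A lam u v \<delta> \<kappa> R f.
        cg_setting p C\<^sub>A C\<^sub>\<kappa> D P A lam u v \<delta> \<kappa> \<and> 1 \<le> R \<and>
        f \<in> carrier_vec P \<and> source_norm D lam v \<mu> f \<le> R \<longrightarrow>
        stopped_cg A lam u \<kappa> \<in> estimators A \<and>
        pred_risk A \<delta> (stopped_cg A lam u \<kappa>) f
          \<le> ennreal (C * (pred_rate \<mu> p R \<delta> + \<delta>\<^sup>2 * sqrt (real D))))
     \<and>
     (\<forall>c\<^sub>A K\<^sub>1 K\<^sub>2. 0 < c\<^sub>A \<and> 0 < K\<^sub>1 \<and> 0 < K\<^sub>2 \<longrightarrow>
        (\<exists>C>0. \<forall>D P A lam u v \<delta> \<kappa> R.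
           cg_setting p C\<^sub>A C\<^sub>\<kappa> D P A lam u v \<delta> \<kappa> \<and> 1 \<le> R \<and>
           (\<forall>i\<in>{1..D}. c\<^sub>A * real i powr (- p) \<le> lam i) \<and>
           sqrt (real D) \<le> K\<^sub>1 * (R\<^sup>2 / \<delta>\<^sup>2) powr (1 / (4 * \<mu> * p + 2 * p + 1)) \<and>
           (R\<^sup>2 / \<delta>\<^sup>2) powr (1 / (4 * \<mu> * p + 2 * p + 1)) \<le> K\<^sub>2 * real D \<longrightarrow>
           minimax_pred_risk A \<delta> (source_ball A lam v \<mu> R)
             \<le> max_pred_risk A \<delta> (stopped_cg A lam u \<kappa>) (source_ball A lam v \<mu> R) \<and>
           max_pred_risk A \<delta> (stopped_cg A lam u \<kappa>) (source_ball A lam v \<mu> R)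
             \<le> ennreal (C * pred_rate \<mu> p R \<delta>) \<and>
           ennreal (pred_rate \<mu> p R \<delta>)
             \<le> ennreal C * minimax_pred_risk A \<delta> (source_ball A lam v \<mu> R)))"
proof -
  let ?E = "\<lambda>R \<delta>. (R\<^sup>2 / \<delta>\<^sup>2) powr (1 / (4 * \<mu> * p + 2 * p + 1))"
  have decomp: "singular_decomposition A D P lam u v" if "cg_setting p C\<^sub>A C\<^sub>\<kappa> D P A lam u v \<delta> \<kappa>"
    for D P A lam u v \<delta> \<kappa>
    using that by unfold_locales (auto simp: cg_setting_def)
  note est = singular_decomposition.stopped_cg_measurable[OF decomp]
  from stopped_cg_upper_bound[OF assms] obtain C1 where C1: "0 < C1"
    and upper: "\<And>D P A lam u v \<delta> \<kappa> R f. cg_setting p C\<^sub>A C\<^sub>\<kappa> D P A lam u v \<delta> \<kappa> \<Longrightarrow> 1 \<le> R \<Longrightarrow>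
      f \<in> carrier_vec P \<Longrightarrow> source_norm D lam v \<mu> f \<le> R \<Longrightarrow>
      pred_risk A \<delta> (stopped_cg A lam u \<kappa>) f \<le> ennreal (C1 * (pred_rate \<mu> p R \<delta> + \<delta>\<^sup>2 * sqrt (real D)))"
  proof (elim exE conjE, goal_cases)
    case (1 C)
    show ?case by (rule 1(1)[OF 1(2)]) (use 1(3) in blast)
  qed
  show ?thesis
  proof (intro conjI allI impI, goal_cases)
    case 1
    show ?case using C1 upper est by blast
  next
    case (2 c\<^sub>A K\<^sub>1 K\<^sub>2)
    then have c: "0 < c\<^sub>A" "0 < K\<^sub>1" "0 < K\<^sub>2" by auto
    from minimax_lower_bound[OF assms(1,2) c(1,3)] obtain C2 where C2: "0 < C2"
      and lower: "\<And>D P A lam u v \<delta> R. A \<in> carrier_mat D P \<Longrightarrow> singular_system A lam u v \<Longrightarrow> 0 < D \<Longrightarrow>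
        0 < \<delta> \<Longrightarrow> \<delta> < 1 \<Longrightarrow> 1 \<le> R \<Longrightarrow> \<forall>i\<in>{1..D}. c\<^sub>A * real i powr (- p) \<le> lam i \<Longrightarrow>
        ?E R \<delta> \<le> K\<^sub>2 * real D \<Longrightarrow>
        ennreal (pred_rate \<mu> p R \<delta>) \<le> ennreal C2 * minimax_pred_risk A \<delta> (source_ball A lam v \<mu> R)"
    proof (elim exE conjE, goal_cases)
      case (1 C)
      show ?case by (rule 1(1)[OF 1(2)]) (use 1(3) in blast)
    qed
    \<comment> \<open>In the stated range \<open>\<delta>^2 * sqrt D\<close> is at most
      \<open>K_1\<close> times the rate, whence \<open>C1 * (1 + K_1)\<close>; the maximum lets one
      constant serve both bounds.\<close>
    define C where "C = max (C1 * (1 + K\<^sub>1)) C2"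
    show ?case
    proof (intro exI[of _ C] conjI allI impI, goal_cases)
      case 1
      show ?case using C2 by (simp add: C_def)
    next
      case (2 D P A lam u v \<delta> \<kappa> R)
      then show ?case
        unfolding minimax_pred_risk_def by (intro INF_lower est) auto
    next
      case (3 D P A lam u v \<delta> \<kappa> R)
      then have set: "cg_setting p C\<^sub>A C\<^sub>\<kappa> D P A lam u v \<delta> \<kappa>" and R: "1 \<le> R"
        and K: "sqrt (real D) \<le> K\<^sub>1 * ?E R \<delta>" by auto
      interpret singular_decomposition A D P lam u v by (rule decomp[OF set])
      have \<delta>: "0 < \<delta>" using set by (simp add: cg_setting_def)
      have rate: "pred_rate \<mu> p R \<delta> = \<delta>\<^sup>2 * ?E R \<delta>"
        using assms R \<delta> by (intro pred_rate_eq) auto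
      have "\<delta>\<^sup>2 * sqrt (real D) \<le> \<delta>\<^sup>2 * (K\<^sub>1 * ?E R \<delta>)"
        using K by (intro mult_left_mono) auto
      then have "pred_rate \<mu> p R \<delta> + \<delta>\<^sup>2 * sqrt (real D) \<le> (1 + K\<^sub>1) * pred_rate \<mu> p R \<delta>"
        unfolding rate by (simp add: algebra_simps)
      then have "C1 * (pred_rate \<mu> p R \<delta> + \<delta>\<^sup>2 * sqrt (real D)) \<le> C1 * ((1 + K\<^sub>1) * pred_rate \<mu> p R \<delta>)"
        using C1 by (intro mult_left_mono) auto
      also have "\<dots> \<le> C * pred_rate \<mu> p R \<delta>"
        unfolding mult.assoc[symmetric] by (intro mult_right_mono) (auto simp: C_def rate)
      finally have le: "C1 * (pred_rate \<mu> p R \<delta> + \<delta>\<^sup>2 * sqrt (real D)) \<le> C * pred_rate \<mu> p R \<delta>" .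
      show ?case
        unfolding max_pred_risk_def
      proof (rule SUP_least)
        fix f assume "f \<in> source_ball A lam v \<mu> R"
        then have "f \<in> carrier_vec P" "source_norm D lam v \<mu> f \<le> R" by (auto simp: source_ball_def dims)
        from upper[OF set R this] show "pred_risk A \<delta> (stopped_cg A lam u \<kappa>) f \<le> ennreal (C * pred_rate \<mu> p R \<delta>)"
          by (rule order_trans) (rule ennreal_leI[OF le])
      qed
    next
      case (4 D P A lam u v \<delta> \<kappa> R)
      then have "ennreal (pred_rate \<mu> p R \<delta>) \<le> ennreal C2 * minimax_pred_risk A \<delta> (source_ball A lam v \<mu> R)"
        by (intro lower[of A D P lam u v \<delta> R]) (auto simp: cg_setting_def)
      also have "\<dots> \<le> ennreal C * minimax_pred_risk A \<delta> (source_ball A lam v \<mu> R)"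
        by (intro mult_right_mono ennreal_leI) (auto simp: C_def)
      finally show ?case .
    qed
  qed
qed

end
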